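(* Let $\alpha>-\frac12$, $1\le p<+\infty$, $1\le q\le+\infty$ and $\beta>0$. Then $$\mathcal{B}\mathcal{D}_{p,q}^{\beta,\alpha}=\mathcal{K}\mathcal{D}_{p,q}^{\beta,\alpha}$$ (equality of subspaces of $L^p(\mu_\alpha)$).
   Context: Let $\alpha>-\frac12$. The measure $\mu_\alpha$ on $\mathbb{R}$ is $d\mu_\alpha(x)=\frac{|x|^{2\alpha+1}}{2^{\alpha+1}\Gamma(\alpha+1)}\,dx$; $L^p(\mu_\alpha)=L^p(\mathbb{R},d\mu_\alpha)$ with norm $\|\cdot\|_{p,\alpha}$. Dunkl operator: for $f\in C^\infty(\mathbb{R})$, $\Lambda_\alpha(f)(x)=\frac{df}{dx}(x)+\frac{2\alpha+1}{x}\left[\frac{f(x)-f(-x)}{2}\right]$. For $f\in L^p(\mu_\alpha)$, $\Lambda_\alpha f$ is understood in the sense of distributions, so $\Lambda_\alpha f\in L^p(\mu_\alpha)$ means that there is $g\in L^p(\mu_\alpha)$ (denoted $\Lambda_\alpha f$) with $\int f\,\Lambda_\alpha\phi\,d\mu_\alpha=-\int g\,\phi\,d\mu_\alpha$ for all $\phi\in C_c^\infty(\mathbb{R})$. Dunkl translation: for $x,y,z\in\mathbb{R}$ let $$W_\alpha(x,y,z)=\frac{\Gamma(\alpha+1)^2}{2^{\alpha-1}\sqrt{\pi}\,\Gamma(\alpha+\frac12)}\,(1-b_{x,y,z}+b_{z,x,y}+b_{z,y,x})\,\Delta_\alpha(x,y,z),$$ where $b_{x,y,z}=\frac{x^2+y^2-z^2}{2xy}$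 if $x,y\in\mathbb{R}\setminus\{0\}$, $z\in\mathbb{R}$, and $b_{x,y,z}=0$ otherwise; and $\Delta_\alpha(x,y,z)=\frac{\left([(|x|+|y|)^2-z^2][z^2-(|x|-|y|)^2]\right)^{\alpha-\frac12}}{|xyz|^{2\alpha}}$ if $|z|\in[\,||x|-|y||,\,|x|+|y|\,]$, and $0$ otherwise. Let $\gamma_{x,y}$ be the signed measure given by $d\gamma_{x,y}(z)=W_\alpha(x,y,z)\,d\mu_\alpha(z)$ if $x,y\ne0$, $\gamma_{x,y}=\delta_x$ if $y=0$, $\gamma_{x,y}=\delta_y$ if $x=0$. For continuous $f$, $\tau_x(f)(y)=\int_{\mathbb{R}}f(z)\,d\gamma_{x,y}(z)$. The operator $\tau_x$ extends to a bounded operator on $L^p(\mu_\alpha)$ with $\|\tau_x(f)\|_{p,\alpha}\le4\|f\|_{p,\alpha}$. Modulus: for $f\in L^p(\mu_\alpha)$ and $x>0$, $w_{p,\alpha}(f,x)=\sup_{|t|\le x}\|\tau_t(f)-f\|_{p,\alpha}$. The Besov-Dunkl space $\mathcal{B}\mathcal{D}_{p,q}^{\beta,\alpha}$ is the set of $f\in L^p(\mu_\alpha)$ with $\int_0^{+\infty}\left(\frac{w_{p,\alpha}(f,x)}{x^\beta}\right)^q\frac{dx}{x}<+\infty$ if $q<+\infty$, and $\sup_{x\in(0,+\infty)}\frac{w_{p,\alpha}(f,x)}{x^\beta}<+\infty$ if $q=+\infty$. Let $\mathcal{D}_{p,\alpha}=\{f\in L^p(\mu_\alpha):\Lambda_\alpha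 f\in L^p(\mu_\alpha)\}$. The Peetre $K$-functional is, for $f\in L^p(\mu_\alpha)$ and $x>0$, $$K_{p,\alpha}(f,x)=\inf\{\|f_0\|_{p,\alpha}+x\|\Lambda_\alpha f_1\|_{p,\alpha}:\ f_0\in L^p(\mu_\alpha),\ f_1\in\mathcal{D}_{p,\alpha},\ f=f_0+f_1\}.$$ The space $\mathcal{K}\mathcal{D}_{p,q}^{\beta,\alpha}$ is the set of $f\in L^p(\mu_\alpha)$ with $\int_0^{+\infty}\left(\frac{K_{p,\alpha}(f,x)}{x^\beta}\right)^q\frac{dx}{x}<+\infty$ if $q<+\infty$, and $\sup_{x\in(0,+\infty)}\frac{K_{p,\alpha}(f,x)}{x^\beta}<+\infty$ if $q=+\infty$. *)

theory Defs
  imports "HOL-Analysis.Analysis"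
begin

definition dunkl_measure :: "real \<Rightarrow> real measure" where
  "dunkl_measure \<alpha> = density lborel
     (\<lambda>x. ennreal (\<bar>x\<bar> powr (2 * \<alpha> + 1) / (2 powr (\<alpha> + 1) * Gamma (\<alpha> + 1))))"

(* Elements of L^p are represented by functions. Every notion below is insensitive to changes
   on null sets, so equality of two such sets of functions is equality of subspaces of L^p. *)
definition Lp :: "real \<Rightarrow> real \<Rightarrow> (real \<Rightarrow> complex) set" where
  "Lp \<alpha> p = {f. f \<in> borel_measurable (dunkl_measure \<alpha>) \<and>
                 integrable (dunkl_measure \<alpha>) (\<lambda>x. norm (f x) powr p)}"

definition Lp_norm :: "real \<Rightarrow> real \<Rightarrow> (real \<Rightarrow> complex) \<Rightarrow> real" where
  "Lp_norm \<alpha> p f = (LINT x|dunkl_measure \<alpha>. norm (f x) powr p) powr (1 / p)"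

(* At x = 0 the difference quotient is read as 0 rather than as its limit; since {0} is a null set
   this does not affect the integrals below. *)
definition dunkl_op :: "real \<Rightarrow> (real \<Rightarrow> complex) \<Rightarrow> real \<Rightarrow> complex" where
  "dunkl_op \<alpha> f x = vector_derivative f (at x)
     + ((2 * \<alpha> + 1) / x) *\<^sub>R ((f x - f (- x)) / 2)"

definition smooth :: "(real \<Rightarrow> complex) \<Rightarrow> bool" where
  "smooth f \<longleftrightarrow> (\<forall>n x. ((\<lambda>g y. vector_derivative g (at y)) ^^ n) f differentiable (at x))"

definition test_function :: "(real \<Rightarrow> complex) \<Rightarrow> bool" where
  "test_function \<phi> \<longleftrightarrow> smooth \<phi> \<and> compact (closure {x. \<phi> x \<noteq> 0})"

definition has_dunkl_derivative :: "real \<Rightarrow> (real \<Rightarrow> complex) \<Rightarrow> (real \<Rightarrow> complex) \<Rightarrow> bool" where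
  "has_dunkl_derivative \<alpha> f g \<longleftrightarrow> (\<forall>\<phi>. test_function \<phi> \<longrightarrow>
     (LINT x|dunkl_measure \<alpha>. f x * dunkl_op \<alpha> \<phi> x) = - (LINT x|dunkl_measure \<alpha>. g x * \<phi> x))"

definition dunkl_b :: "real \<Rightarrow> real \<Rightarrow> real \<Rightarrow> real" where
  "dunkl_b x y z = (if x \<noteq> 0 \<and> y \<noteq> 0 then (x\<^sup>2 + y\<^sup>2 - z\<^sup>2) / (2 * x * y) else 0)"

definition dunkl_Delta :: "real \<Rightarrow> real \<Rightarrow> real \<Rightarrow> real \<Rightarrow> real" where
  "dunkl_Delta \<alpha> x y z =
     (if \<bar>z\<bar> \<in> {\<bar>\<bar>x\<bar> - \<bar>y\<bar>\<bar> .. \<bar>x\<bar> + \<bar>y\<bar>}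
      then (((\<bar>x\<bar> + \<bar>y\<bar>)\<^sup>2 - z\<^sup>2) * (z\<^sup>2 - (\<bar>x\<bar> - \<bar>y\<bar>)\<^sup>2)) powr (\<alpha> - 1/2)
           / \<bar>x * y * z\<bar> powr (2 * \<alpha>)
      else 0)"

definition dunkl_W :: "real \<Rightarrow> real \<Rightarrow> real \<Rightarrow> real \<Rightarrow> real" where
  "dunkl_W \<alpha> x y z =
     (Gamma (\<alpha> + 1))\<^sup>2 / (2 powr (\<alpha> - 1) * sqrt pi * Gamma (\<alpha> + 1/2))
     * (1 - dunkl_b x y z + dunkl_b z x y + dunkl_b z y x) * dunkl_Delta \<alpha> x y z"

(* The integral of f against the signed measure gamma_{x,y}, written out. *)
definition dunkl_translation_cont ::
    "real \<Rightarrow> real \<Rightarrow> (real \<Rightarrow> complex) \<Rightarrow> real \<Rightarrow> complex" where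
  "dunkl_translation_cont \<alpha> x f y =
     (if y = 0 then f x
      else if x = 0 then f y
      else LINT z|dunkl_measure \<alpha>. dunkl_W \<alpha> x y z *\<^sub>R f z)"

definition Lp_bounded_operator ::
    "real \<Rightarrow> real \<Rightarrow> ((real \<Rightarrow> complex) \<Rightarrow> real \<Rightarrow> complex) \<Rightarrow> bool" where
  "Lp_bounded_operator \<alpha> p T \<longleftrightarrow>
     (\<forall>f\<in>Lp \<alpha> p. T f \<in> Lp \<alpha> p) \<and>
     (\<forall>f\<in>Lp \<alpha> p. \<forall>g\<in>Lp \<alpha> p. AE y in dunkl_measure \<alpha>. T (\<lambda>z. f z + g z) y = T f y + T g y) \<and>
     (\<forall>c. \<forall>f\<in>Lp \<alpha> p. AE y in dunkl_measure \<alpha>. T (\<lambda>z. c * f z) y = c * T f y) \<and>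
     (\<exists>C. \<forall>f\<in>Lp \<alpha> p. Lp_norm \<alpha> p (T f) \<le> C * Lp_norm \<alpha> p f)"

(* The extension to L^p of the translation of continuous functions. By density of the continuous
   functions in L^p, any two candidates agree almost everywhere on each f in L^p. *)
definition dunkl_translation ::
    "real \<Rightarrow> real \<Rightarrow> real \<Rightarrow> (real \<Rightarrow> complex) \<Rightarrow> real \<Rightarrow> complex" where
  "dunkl_translation \<alpha> p x = (SOME T. Lp_bounded_operator \<alpha> p T \<and>
     (\<forall>f\<in>Lp \<alpha> p. continuous_on UNIV f \<longrightarrow>
        (AE y in dunkl_measure \<alpha>. T f y = dunkl_translation_cont \<alpha> x f y)))"

(* For f in L^p the supremum is over a bounded set, as the translations are uniformly bounded. *)
definition dunkl_modulus :: "real \<Rightarrow> real \<Rightarrow> (real \<Rightarrow> complex) \<Rightarrow> real \<Rightarrow> real" where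
  "dunkl_modulus \<alpha> p f x =
     (SUP t\<in>{t. \<bar>t\<bar> \<le> x}. Lp_norm \<alpha> p (\<lambda>y. dunkl_translation \<alpha> p t f y - f y))"

definition dunkl_K :: "real \<Rightarrow> real \<Rightarrow> (real \<Rightarrow> complex) \<Rightarrow> real \<Rightarrow> real" where
  "dunkl_K \<alpha> p f x =
     Inf {Lp_norm \<alpha> p f0 + x * Lp_norm \<alpha> p g | f0 f1 g.
            f0 \<in> Lp \<alpha> p \<and> f1 \<in> Lp \<alpha> p \<and> g \<in> Lp \<alpha> p \<and> has_dunkl_derivative \<alpha> f1 g \<and>
            (AE y in dunkl_measure \<alpha>. f y = f0 y + f1 y)}"

definition finite_weighted_norm :: "ereal \<Rightarrow> real \<Rightarrow> (real \<Rightarrow> real) \<Rightarrow> bool" where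
  "finite_weighted_norm q \<beta> h \<longleftrightarrow>
     (if q = \<infinity> then bdd_above ((\<lambda>x. h x / x powr \<beta>) ` {0<..})
      else (\<integral>\<^sup>+x\<in>{0<..}. ennreal ((h x / x powr \<beta>) powr real_of_ereal q / x) \<partial>lborel) < \<infinity>)"

definition besov_dunkl :: "real \<Rightarrow> real \<Rightarrow> ereal \<Rightarrow> real \<Rightarrow> (real \<Rightarrow> complex) set" where
  "besov_dunkl \<alpha> p q \<beta> = {f \<in> Lp \<alpha> p. finite_weighted_norm q \<beta> (dunkl_modulus \<alpha> p f)}"

definition peetre_dunkl :: "real \<Rightarrow> real \<Rightarrow> ereal \<Rightarrow> real \<Rightarrow> (real \<Rightarrow> complex) set" where
  "peetre_dunkl \<alpha> p q \<beta> = {f \<in> Lp \<alpha> p. finite_weighted_norm q \<beta> (dunkl_K \<alpha> p f)}"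

end

(* The modulus of smoothness w(f, x) and the K-functional K(f, x) are comparable up to constants
   for every x > 0, hence define the same spaces.

   The cosine substitution v = (z^2 - x^2 - y^2) / (2xy) turns the translation of a function
   psi(z) = E(z^2) + z G(z^2) into an average over |v| <= 1 of E(q) + (x + y) G(q), where
   q = x^2 + y^2 + 2xyv, with weight proportional to (1 + v) (1 - v^2)^(alpha - 1/2). It also shows
   that the kernel W(x, y, .) has total variation at most 4; with its symmetries, Schur's test
   bounds the translations on L^p.

   w <= C K: integration by parts in v shows that the Dunkl operators in x and in y agree on the
   translate of psi. With a first order Taylor formula in the translation parameter, the increment
   of the translate of psi becomes the Dunkl operator of an average of translates of psi. By
   duality tau_t f - f = - int k(-t, s) tau_(-s) (Lambda f) ds with |k| <= 1, so that its norm is at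
   most 8 |t| ||Lambda f||. Moments against smooth bumps show that the test functions psi suffice.

   K <= C w: the Dunkl convolution f_1 of f with an even C^2 bump of width t satisfies
   ||f - f_1|| <= w(f, t) and ||Lambda f_1|| <= C w(f, t) / t, as the derivative of the bump is odd
   and thus has integral zero. *)
theory Submission
  imports Defs
begin

text \<open>The obstacle in w <= C K is that f has only a distributional derivative, while the
  translate of a test function is an integral over v whose smoothness is not visible. The weak
  derivative is therefore applied to the integrand with v fixed, which is a test function for every
  |v| <= 1, and the averages over v and over the Taylor parameter are taken afterwards. This
  dictates the order: the Taylor formula acts in the translation parameter, the symmetry of the
  averaged Dunkl derivative moves the operator to the space variable, and only there can it be
  passed to f.

  The kernel is singular when x, y or z is 0, so the identities are proved off the origin, a null
  set. The translation in the definitions is a chosen extension; the estimates are made for the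
  explicit kernel operator \<open>T\<close> and carried over by density. Absolute kernel bounds,
  Fubini and Jensen's inequality are the only tools, so p = 1 stands on the same footing as p > 1.
  The constants 4, 8, 20 and 80 matter only through their uniformity in f, t and x.\<close>

section \<open>Integral kernels and measure theory on the line\<close>

(* No measurability of f is needed, which spares a discussion of the modulus and the K-functional as
   functions of x. *)
lemma nn_integral_cmult_le:
  fixes c :: real and f :: "'a \<Rightarrow> ennreal"
  assumes c: "c > 0"
  shows "(\<integral>\<^sup>+x. ennreal c * f x \<partial>M) \<le> ennreal c * (\<integral>\<^sup>+x. f x \<partial>M)"
proof -
  have cc: "ennreal c * (ennreal (1/c) * s) = s" for s
    using c by (simp add: mult.assoc[symmetric] ennreal_mult[symmetric])
  have cc': "ennreal (1/c) * (ennreal c * s) = s" for s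
    using c by (simp add: mult.assoc[symmetric] ennreal_mult[symmetric])
  show ?thesis
    unfolding nn_integral_def[of M "\<lambda>x. ennreal c * f x"]
  proof (rule SUP_least)
    fix g assume g: "g \<in> {g. simple_function M g \<and> g \<le> (\<lambda>x. ennreal c * f x)}"
    then have sg: "simple_function M g" and le: "\<And>x. g x \<le> ennreal c * f x" by (auto simp: le_fun_def)
    have "ennreal (1/c) * g x \<le> f x" for x
      using mult_left_mono[OF le[of x], of "ennreal (1/c)"] cc' by simp
    then have "integral\<^sup>S M (\<lambda>x. ennreal (1/c) * g x) \<le> integral\<^sup>N M f"
      unfolding nn_integral_def using sg
      by (intro SUP_upper) (auto simp: le_fun_def)
    then have "ennreal (1/c) * integral\<^sup>S M g \<le> integral\<^sup>N M f"
      by (subst (asm) simple_integral_mult[OF sg])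
    from mult_left_mono[OF this, of "ennreal c"] show "integral\<^sup>S M g \<le> ennreal c * integral\<^sup>N M f"
      by (simp add: cc)
  qed
qed

text \<open>Convexity of \<open>s powr p\<close>: the tangent inequality at t, solved for s. The
  right-hand side is affine in \<open>s powr p\<close>, so it can be integrated against any kernel
  before t is chosen.\<close>

lemma real_le_powr_tangent:
  fixes s t p :: real
  assumes "s \<ge> 0" "t > 0" "p \<ge> 1"
  shows "s \<le> (1 - 1/p) * t + s powr p * t powr (1 - p) / p"
proof (cases "s = 0")
  case True then show ?thesis using assms by simp
next
  case False
  then have s: "s > 0" using assms by simp
  have "(s powr p * t powr (1-p)) powr (1/p) * t powr (1 - 1/p)
      \<le> (1/p) * (s powr p * t powr (1-p)) + (1-1/p) * t"
    using assms s by (intro Youngs_inequality_0) auto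
  moreover have "(s powr p * t powr (1-p)) powr (1/p) * t powr (1 - 1/p) = s"
  proof -
    have "(s powr p * t powr (1-p)) powr (1/p) * t powr (1 - 1/p) = s * (t powr ((1-p)/p) * t powr (1 - 1/p))"
      using assms s by (simp add: powr_mult powr_powr)
    also have "\<dots> = s * t powr ((1-p)/p + (1 - 1/p))" by (simp add: powr_add)
    also have "(1-p)/p + (1 - 1/p) = 0" using assms by (simp add: field_simps)
    finally show ?thesis using assms by simp
  qed
  ultimately show ?thesis by (simp add: algebra_simps)
qed

lemma le_one_plus_powr:
  fixes s p :: real
  assumes "s \<ge> 0" "p \<ge> 1"
  shows "s \<le> 1 + s powr p"
proof (cases "s \<le> 1")
  case True then show ?thesis using powr_ge_zero[of s p] by linarith
next
  case False
  then have "s powr 1 \<le> s powr p" using assms by (intro powr_mono) auto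
  then show ?thesis using False by simp
qed

text \<open>Hoelder's inequality for the measure with density |k|, of mass at most A. The tangent
  inequality is integrated with a free t, which is optimised afterwards; this treats p = 1 and p > 1
  alike.\<close>

lemma jensen_kernel:
  fixes h :: "'a \<Rightarrow> complex" and k :: "'a \<Rightarrow> real"
  assumes p: "p \<ge> 1" and [measurable]: "k \<in> borel_measurable N" "h \<in> borel_measurable N"
    and A: "0 \<le> A" "(\<integral>\<^sup>+z. ennreal \<bar>k z\<bar> \<partial>N) \<le> ennreal A"
    and int: "integrable N (\<lambda>z. \<bar>k z\<bar> * norm (h z) powr p)"
  shows "integrable N (\<lambda>z. k z *\<^sub>R h z)"
    and "norm (LINT z|N. k z *\<^sub>R h z) powr p \<le> A powr (p - 1) * (LINT z|N. \<bar>k z\<bar> * norm (h z) powr p)"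
proof -
  have ik: "integrable N (\<lambda>z. \<bar>k z\<bar>)"
    using A(2) by (intro integrableI_bounded) (auto simp: le_less_trans)
  have ikA: "(LINT z|N. \<bar>k z\<bar>) \<le> A"
    using A nn_integral_eq_integral[OF ik] by simp
  have ih: "integrable N (\<lambda>z. \<bar>k z\<bar> * norm (h z))"
  proof (rule Bochner_Integration.integrable_bound)
    show "integrable N (\<lambda>z. \<bar>k z\<bar> + \<bar>k z\<bar> * norm (h z) powr p)"
      using ik int by (rule Bochner_Integration.integrable_add)
    have "\<bar>k z\<bar> * norm (h z) \<le> \<bar>k z\<bar> + \<bar>k z\<bar> * norm (h z) powr p" for z
      using mult_left_mono[OF le_one_plus_powr[of "norm (h z)" p], of "\<bar>k z\<bar>"] p
      by (simp add: algebra_simps)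
    then show "AE z in N. norm (\<bar>k z\<bar> * norm (h z)) \<le> norm (\<bar>k z\<bar> + \<bar>k z\<bar> * norm (h z) powr p)"
      by (intro AE_I2) (auto intro: order_trans[OF _ abs_ge_self])
  qed measurable
  show ikh: "integrable N (\<lambda>z. k z *\<^sub>R h z)"
    by (rule Bochner_Integration.integrable_bound[OF ih]) auto
  define S where "S = (LINT z|N. \<bar>k z\<bar> * norm (h z) powr p)"
  define X where "X = (LINT z|N. \<bar>k z\<bar> * norm (h z))"
  have S0: "S \<ge> 0" unfolding S_def by (intro integral_nonneg_AE) auto
  have X0: "X \<ge> 0" unfolding X_def by (intro integral_nonneg_AE) auto
  have nX: "norm (LINT z|N. k z *\<^sub>R h z) \<le> X"
    unfolding X_def using integral_norm_bound[of N "\<lambda>z. k z *\<^sub>R h z"] by simp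
  have "X powr p \<le> A powr (p - 1) * S"
  proof (cases "S = 0 \<or> A = 0")
    case True
    \<comment> \<open>No positive t is available here. Since \<open>0 powr 0 = 0\<close>, the
      right-hand side vanishes for A = 0 even if p = 1, so X = 0 has to be shown outright.\<close>
    have "X = 0"
    proof (cases "S = 0")
      case True
      have "AE z in N. \<bar>k z\<bar> * norm (h z) powr p = 0"
        using True int integral_nonneg_eq_0_iff_AE[OF int] by (simp add: S_def)
      then have "AE z in N. \<bar>k z\<bar> * norm (h z) = 0" by eventually_elim auto
      then show ?thesis unfolding X_def by (simp add: integral_eq_zero_AE)
    next
      case False
      have "(LINT z|N. \<bar>k z\<bar>) = 0"
        using True False ikA by (intro antisym integral_nonneg_AE) auto
      then have "AE z in N. \<bar>k z\<bar> = 0" using integral_nonneg_eq_0_iff_AE[OF ik] by simp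
      then have "AE z in N. \<bar>k z\<bar> * norm (h z) = 0" by eventually_elim auto
      then show ?thesis unfolding X_def by (simp add: integral_eq_zero_AE)
    qed
    then show ?thesis using S0 by simp
  next
    case False
    then have pos: "S > 0" "A > 0" using S0 A by auto
    \<comment> \<open>The minimiser over t of the bound below; its two terms then add up to t *
      A.\<close>
    define t where "t = (S/A) powr (1/p)"
    have t: "t > 0" using pos by (simp add: t_def)
    have tp: "t powr p = S / A" using p pos by (simp add: t_def powr_powr)
    have "X \<le> (LINT z|N. (1-1/p)*t * \<bar>k z\<bar> + t powr (1-p) / p * (\<bar>k z\<bar> * norm (h z) powr p))"
      unfolding X_def
    proof (rule integral_mono[OF ih])
      show "integrable N (\<lambda>z. (1-1/p)*t * \<bar>k z\<bar> + t powr (1-p) / p * (\<bar>k z\<bar> * norm (h z) powr p))"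
        using ik int by (intro Bochner_Integration.integrable_add integrable_mult_right) auto
      fix z
      show "\<bar>k z\<bar> * norm (h z) \<le> (1-1/p)*t * \<bar>k z\<bar> + t powr (1-p) / p * (\<bar>k z\<bar> * norm (h z) powr p)"
        using mult_left_mono[OF real_le_powr_tangent[of "norm (h z)" t p], of "\<bar>k z\<bar>"] p t
        by (simp add: algebra_simps)
    qed
    also have "\<dots> = (1-1/p)*t * (LINT z|N. \<bar>k z\<bar>) + t powr (1-p) / p * S"
      unfolding S_def using ik int by (subst Bochner_Integration.integral_add) auto
    also have "\<dots> \<le> (1-1/p)*t * A + t powr (1-p) / p * S"
      using ikA p t by (intro add_right_mono mult_left_mono) auto
    also have "t powr (1-p) * S = t * A"
    proof -
      have "t powr (1-p) = t / (S/A)" using t by (simp add: powr_diff tp)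
      then show ?thesis using pos by (simp add: field_simps)
    qed
    then have "t powr (1-p) / p * S = t * A / p" by (simp add: field_simps)
    also have "(1-1/p)*t * A + t * A / p = t * A" using p by (simp add: field_simps)
    finally have "X \<le> t * A" .
    then have "X powr p \<le> (t * A) powr p" using X0 p by (intro powr_mono2) auto
    also have "\<dots> = S / A * A powr p" using t pos by (simp add: powr_mult tp)
    also have "\<dots> = A powr (p-1) * S" using pos by (simp add: powr_diff field_simps)
    finally show ?thesis .
  qed
  moreover have "norm (LINT z|N. k z *\<^sub>R h z) powr p \<le> X powr p"
    using nX p by (intro powr_mono2) auto
  ultimately show "norm (LINT z|N. k z *\<^sub>R h z) powr p \<le> A powr (p - 1) * (LINT z|N. \<bar>k z\<bar> * norm (h z) powr p)"
    by (simp add: S_def)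
qed

text \<open>Jensen in z for almost every y, then integration over y. The column bound of Schur's
  test is contained in the double integral bounded by B, and h may depend on y too: this covers a
  single translation as well as an average of translations.\<close>

lemma schur_kernel:
  fixes h :: "'a \<Rightarrow> 'b \<Rightarrow> complex" and K :: "'a \<Rightarrow> 'b \<Rightarrow> real"
  assumes p: "p \<ge> 1" and "sigma_finite_measure N"
    and K[measurable]: "(\<lambda>(y,z). K y z) \<in> borel_measurable (M \<Otimes>\<^sub>M N)"
    and h[measurable]: "(\<lambda>(y,z). h y z) \<in> borel_measurable (M \<Otimes>\<^sub>M N)"
    and A: "0 \<le> A" "AE y in M. (\<integral>\<^sup>+z. ennreal \<bar>K y z\<bar> \<partial>N) \<le> ennreal A"
    and B: "0 \<le> B" "(\<integral>\<^sup>+y. \<integral>\<^sup>+z. ennreal (\<bar>K y z\<bar> * norm (h y z) powr p) \<partial>N \<partial>M) \<le> ennreal B"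
  shows "AE y in M. integrable N (\<lambda>z. K y z *\<^sub>R h y z)"
    and "(\<lambda>y. LINT z|N. K y z *\<^sub>R h y z) \<in> borel_measurable M"
    and "integrable M (\<lambda>y. norm (LINT z|N. K y z *\<^sub>R h y z) powr p)"
    and "(LINT y|M. norm (LINT z|N. K y z *\<^sub>R h y z) powr p) \<le> A powr (p - 1) * B"
proof -
  interpret N: sigma_finite_measure N by fact
  have fin: "AE y in M. (\<integral>\<^sup>+z. ennreal (\<bar>K y z\<bar> * norm (h y z) powr p) \<partial>N) \<noteq> \<infinity>"
    using B by (intro nn_integral_PInf_AE) (auto simp: top_unique)
  have int: "AE y in M. integrable N (\<lambda>z. \<bar>K y z\<bar> * norm (h y z) powr p)"
    using fin AE_space
  proof eventually_elim
    case (elim y)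
    have [measurable]: "K y \<in> borel_measurable N" "h y \<in> borel_measurable N"
      using elim(2) K h by simp_all
    show ?case using elim(1) by (intro integrableI_bounded) (auto simp: less_top)
  qed
  have both: "AE y in M. integrable N (\<lambda>z. K y z *\<^sub>R h y z) \<and>
      ennreal (norm (LINT z|N. K y z *\<^sub>R h y z) powr p)
       \<le> ennreal (A powr (p-1)) * (\<integral>\<^sup>+z. ennreal (\<bar>K y z\<bar> * norm (h y z) powr p) \<partial>N)"
    using int A(2) AE_space
  proof eventually_elim
    case (elim y)
    have [measurable]: "K y \<in> borel_measurable N" "h y \<in> borel_measurable N"
      using elim(3) K h by simp_all
    have "ennreal (norm (LINT z|N. K y z *\<^sub>R h y z) powr p)
       \<le> ennreal (A powr (p-1) * (LINT z|N. \<bar>K y z\<bar> * norm (h y z) powr p))"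
      using jensen_kernel(2)[OF p _ _ A(1) elim(2,1)] by (simp add: ennreal_leI)
    also have "\<dots> = ennreal (A powr (p-1)) * (\<integral>\<^sup>+z. ennreal (\<bar>K y z\<bar> * norm (h y z) powr p) \<partial>N)"
      using nn_integral_eq_integral[OF elim(1)] by (simp add: ennreal_mult)
    finally show ?case using jensen_kernel(1)[OF p _ _ A(1) elim(2,1)] by simp
  qed
  show "AE y in M. integrable N (\<lambda>z. K y z *\<^sub>R h y z)" using both by eventually_elim auto
  show m[measurable]: "(\<lambda>y. LINT z|N. K y z *\<^sub>R h y z) \<in> borel_measurable M"
    by measurable
  have "(\<integral>\<^sup>+y. ennreal (norm (LINT z|N. K y z *\<^sub>R h y z) powr p) \<partial>M)
     \<le> (\<integral>\<^sup>+y. ennreal (A powr (p-1)) * (\<integral>\<^sup>+z. ennreal (\<bar>K y z\<bar> * norm (h y z) powr p) \<partial>N) \<partial>M)"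
    using both by (intro nn_integral_mono_AE) (auto)
  also have "\<dots> = ennreal (A powr (p-1)) * (\<integral>\<^sup>+y. (\<integral>\<^sup>+z. ennreal (\<bar>K y z\<bar> * norm (h y z) powr p) \<partial>N) \<partial>M)"
    by (intro nn_integral_cmult) measurable
  also have "\<dots> \<le> ennreal (A powr (p-1) * B)"
    using B by (simp add: ennreal_mult mult_left_mono)
  finally have *: "(\<integral>\<^sup>+y. ennreal (norm (LINT z|N. K y z *\<^sub>R h y z) powr p) \<partial>M) \<le> ennreal (A powr (p-1) * B)" .
  show i: "integrable M (\<lambda>y. norm (LINT z|N. K y z *\<^sub>R h y z) powr p)"
    using * by (intro integrableI_bounded) (auto simp: le_less_trans)
  show "(LINT y|M. norm (LINT z|N. K y z *\<^sub>R h y z) powr p) \<le> A powr (p - 1) * B"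
    using * B by (simp add: nn_integral_eq_integral[OF i])
qed

lemma Fubini_swap:
  fixes F :: "'a \<Rightarrow> 'b \<Rightarrow> 'c::{banach, second_countable_topology}"
  assumes "sigma_finite_measure M" "sigma_finite_measure N"
    and [measurable]: "(\<lambda>(x,y). F x y) \<in> borel_measurable (M \<Otimes>\<^sub>M N)"
    and fin: "(\<integral>\<^sup>+x. \<integral>\<^sup>+y. ennreal (norm (F x y)) \<partial>N \<partial>M) < \<infinity>"
  shows "(LINT x|M. LINT y|N. F x y) = (LINT y|N. LINT x|M. F x y)"
    and "AE x in M. integrable N (F x)"
    and "integrable M (\<lambda>x. LINT y|N. F x y)"
proof -
  interpret M: sigma_finite_measure M by fact
  interpret N: sigma_finite_measure N by fact
  interpret pair_sigma_finite M N ..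
  have "(\<integral>\<^sup>+xy. ennreal (norm (case xy of (x,y) \<Rightarrow> F x y)) \<partial>(M \<Otimes>\<^sub>M N)) = (\<integral>\<^sup>+x. \<integral>\<^sup>+y. ennreal (norm (F x y)) \<partial>N \<partial>M)"
    by (subst N.nn_integral_fst[symmetric]) auto
  then have i: "integrable (M \<Otimes>\<^sub>M N) (\<lambda>(x,y). F x y)"
    using fin by (intro integrableI_bounded) auto
  show "(LINT x|M. LINT y|N. F x y) = (LINT y|N. LINT x|M. F x y)"
    using Fubini_integral[OF i] by simp
  show "AE x in M. integrable N (F x)" using AE_integrable_fst[OF i] by simp
  show "integrable M (\<lambda>x. LINT y|N. F x y)" using integrable_fst[OF i] by simp
qed

text \<open>Lebesgue measurability supplies continuous approximations without a bound. Composing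
  them with the nearest-point map onto the ball of radius B restores the bound, and the limit
  survives because that map is continuous and fixes the values of s.\<close>

lemma bounded_borel_AE_limit_continuous:
  fixes s :: "real \<Rightarrow> 'b::euclidean_space"
  assumes s: "s \<in> borel_measurable borel" and B: "\<And>x. norm (s x) \<le> B"
  obtains g where "\<And>n. continuous_on UNIV (g n)" "\<And>n x. norm (g n x) \<le> B"
    "AE x in lborel. (\<lambda>n::nat. g n x) \<longlonglongrightarrow> s x"
proof -
  have B0: "B \<ge> 0" using norm_ge_zero B order_trans by blast
  have "s measurable_on UNIV"
    using s by (intro lebesgue_measurable_imp_measurable_on) (auto intro: measurable_completion)
  then obtain Z g where Z: "negligible Z" and g: "\<And>n. continuous_on UNIV (g n)"
    and lim: "\<And>x. x \<notin> Z \<Longrightarrow> (\<lambda>n::nat. g n x) \<longlonglongrightarrow> s x"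
    unfolding measurable_on_def by auto
  define c where "c = closest_point (cball (0::'b) B)"
  have cc: "continuous_on UNIV c" unfolding c_def by (intro continuous_on_closest_point) (use B0 in auto)
  have cB: "norm (c x) \<le> B" for x
    using closest_point_in_set[of "cball (0::'b) B" x] B0 by (auto simp: c_def)
  have "AE x in lebesgue. x \<notin> Z"
    using Z by (intro AE_not_in) (simp add: negligible_iff_null_sets)
  then have AE: "AE x in lborel. x \<notin> Z"
    by (simp add: AE_completion_iff)
  show thesis
  proof (rule that[of "\<lambda>n x. c (g n x)"])
    show "continuous_on UNIV (\<lambda>x. c (g n x))" for n
      using continuous_on_compose2[OF cc g] by auto
    show "norm (c (g n x)) \<le> B" for n x by (rule cB)
    show "AE x in lborel. (\<lambda>n. c (g n x)) \<longlonglongrightarrow> s x"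
      using AE
    proof eventually_elim
      case (elim x)
      have "(\<lambda>n. c (g n x)) \<longlonglongrightarrow> c (s x)"
        using cc lim[OF elim] by (intro continuous_on_tendsto_compose[OF cc]) auto
      moreover have "c (s x) = s x"
        using B[of x] B0 by (simp add: c_def closest_point_self)
      ultimately show ?case by simp
    qed
  qed
qed

text \<open>Vanishing against powers is widened in stages: to polynomials, to bounded continuous
  factors by uniform approximation on the support, to bounded Borel factors by dominated
  convergence. The signs of Re h and Im h are such factors and return the L^1 norms of both
  parts.\<close>

lemma AE_zero_if_moments_zero:
  fixes h :: "real \<Rightarrow> complex"
  assumes ih: "integrable lborel h" and supp: "\<And>x. \<bar>x\<bar> > R \<Longrightarrow> h x = 0"
    and mom: "\<And>n::nat. (LINT x|lborel. h x * of_real (x ^ n)) = 0"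
  shows "AE x in lborel. h x = 0"
proof -
  have [measurable]: "h \<in> borel_measurable borel" using ih by auto
  have poly0: "integrable lborel (\<lambda>x. h x * of_real (P x)) \<and> (LINT x|lborel. h x * of_real (P x)) = 0"
    if "real_polynomial_function P" for P :: "real \<Rightarrow> real"
  proof -
    from that obtain a n where P: "P = (\<lambda>x. \<Sum>i\<le>n. a i * x^i)" by (auto simp: real_polynomial_function_iff_sum)
    have i: "integrable lborel (\<lambda>x. h x * of_real (x ^ m))" for m
    proof (rule Bochner_Integration.integrable_bound)
      show "integrable lborel (\<lambda>x. \<bar>R\<bar>^m * norm (h x))" using ih by auto
      have "norm (h x * of_real (x^m)) \<le> \<bar>R\<bar>^m * norm (h x)" for x
      proof (cases "\<bar>x\<bar> > R")
        case False
        then have "\<bar>x\<bar>^m \<le> \<bar>R\<bar>^m" by (intro power_mono) auto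
        then show ?thesis by (simp add: norm_mult norm_power mult.commute mult_left_mono)
      qed (simp add: supp)
      then show "AE x in lborel. norm (h x * of_real (x^m)) \<le> norm (\<bar>R\<bar>^m * norm (h x))"
        by (intro AE_I2) (auto simp: abs_mult)
    qed measurable
    have eq: "h x * of_real (P x) = (\<Sum>i\<le>n. of_real (a i) * (h x * of_real (x^i)))" for x
      by (simp add: P sum_distrib_left algebra_simps)
    have "integrable lborel (\<lambda>x. h x * of_real (P x))" unfolding eq
      using i by (intro Bochner_Integration.integrable_sum integrable_mult_right) auto
    moreover have "(LINT x|lborel. h x * of_real (P x)) = 0"
      unfolding eq using i mom by (subst Bochner_Integration.integral_sum) auto
    ultimately show ?thesis by blast
  qed
  have bdd: "integrable lborel (\<lambda>x. h x * of_real (s x))"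
    if "s \<in> borel_measurable borel" "\<And>x. \<bar>s x\<bar> \<le> B" for s :: "real \<Rightarrow> real" and B
  proof (rule Bochner_Integration.integrable_bound)
    show "integrable lborel (\<lambda>x. B * norm (h x))" using ih by auto
    show "AE x in lborel. norm (h x * of_real (s x)) \<le> norm (B * norm (h x))"
      using that(2) by (intro AE_I2)
        (auto simp: norm_mult abs_mult mult.commute intro!: mult_right_mono intro: order_trans[OF _ abs_ge_self])
  qed (use that in measurable)
  have cont0: "(LINT x|lborel. h x * of_real (s x)) = 0"
    if s: "continuous_on UNIV s" and sB: "\<And>x. \<bar>s x\<bar> \<le> B" for s :: "real \<Rightarrow> real" and B
  proof -
    have [measurable]: "s \<in> borel_measurable borel" using s by (rule borel_measurable_continuous_onI)
    have key: "norm (LINT x|lborel. h x * of_real (s x)) \<le> e * (LINT x|lborel. norm (h x))" if e: "e > 0" for e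
    proof -
      obtain P where P: "real_polynomial_function P" "\<And>x. x \<in> {-\<bar>R\<bar>..\<bar>R\<bar>} \<Longrightarrow> \<bar>s x - P x\<bar> < e"
        using Stone_Weierstrass_real_polynomial_function[of "{-\<bar>R\<bar>..\<bar>R\<bar>}" s e] e continuous_on_subset[OF s]
        by (metis compact_Icc subset_UNIV)
      have "(LINT x|lborel. h x * of_real (s x)) = (LINT x|lborel. h x * of_real (s x) - h x * of_real (P x))"
        using poly0[OF P(1)] bdd[of s B] sB by simp
      also have "norm \<dots> \<le> (LINT x|lborel. e * norm (h x))"
      proof (rule Bochner_Integration.integral_norm_bound_integral)
        show "integrable lborel (\<lambda>x. h x * of_real (s x) - h x * of_real (P x))"
          using poly0[OF P(1)] bdd[of s B] sB by simp
        show "norm (h x * of_real (s x) - h x * of_real (P x)) \<le> e * norm (h x)" for x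
        proof (cases "\<bar>x\<bar> > R")
          case False
          then have "\<bar>s x - P x\<bar> \<le> e" by (intro less_imp_le P(2)) auto
          moreover have "norm (h x * of_real (s x) - h x * of_real (P x)) = norm (h x) * \<bar>s x - P x\<bar>"
            by (simp add: right_diff_distrib[symmetric] norm_mult flip: of_real_diff)
          ultimately show ?thesis by (simp add: mult.commute[of e] mult_left_mono)
        qed (simp add: supp)
      qed (use ih in auto)
      finally show ?thesis by simp
    qed
    have "norm (LINT x|lborel. h x * of_real (s x)) \<le> 0"
    proof (rule field_le_epsilon)
      fix e :: real assume e: "e > 0"
      define I where "I = (LINT x|lborel. norm (h x))"
      have I: "I \<ge> 0" unfolding I_def by (intro integral_nonneg_AE) auto
      have pos: "e / (I + 1) > 0" using e I by simp
      have "norm (LINT x|lborel. h x * of_real (s x)) \<le> e / (I + 1) * I"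
        using key[OF pos] by (simp only: I_def)
      also have "\<dots> = e * I / (I + 1)" by simp
      also have "\<dots> \<le> e" using e I by (simp add: divide_le_eq distrib_left)
      finally show "norm (LINT x|lborel. h x * of_real (s x)) \<le> 0 + e" by simp
    qed
    then show ?thesis by simp
  qed
  have borel0: "(LINT x|lborel. h x * of_real (s x)) = 0"
    if sm[measurable]: "s \<in> borel_measurable borel" and sB: "\<And>x. norm (s x) \<le> 1" for s :: "real \<Rightarrow> real"
  proof -
    obtain g where g: "\<And>n. continuous_on UNIV (g n)" "\<And>n x. norm (g n x) \<le> 1"
      "AE x in lborel. (\<lambda>n::nat. g n x) \<longlonglongrightarrow> s x"
      by (rule bounded_borel_AE_limit_continuous[OF sm sB]) blast
    have [measurable]: "g n \<in> borel_measurable borel" for n using g(1) by (rule borel_measurable_continuous_onI)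
    have "(\<lambda>n. LINT x|lborel. h x * of_real (g n x)) \<longlonglongrightarrow> (LINT x|lborel. h x * of_real (s x))"
    proof (rule integral_dominated_convergence[where w = "\<lambda>x. norm (h x)"])
      show "AE x in lborel. (\<lambda>n. h x * of_real (g n x)) \<longlonglongrightarrow> h x * of_real (s x)"
        using g(3) by eventually_elim (intro tendsto_intros)
      show "AE x in lborel. norm (h x * of_real (g n x)) \<le> norm (h x)" for n
        using g(2) by (intro AE_I2) (simp add: norm_mult mult_left_le)
    qed (use ih in auto)
    moreover have "(LINT x|lborel. h x * of_real (g n x)) = 0" for n
      using cont0[OF g(1), of n 1] g(2) by simp
    ultimately show ?thesis by (simp add: LIMSEQ_const_iff)
  qed
  have re: "AE x in lborel. Re (h x) = 0"
  proof -
    have "(LINT x|lborel. Re (h x * of_real (sgn (Re (h x))))) = 0"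
      using borel0[of "\<lambda>x. sgn (Re (h x))"] bdd[of "\<lambda>x. sgn (Re (h x))" 1]
      by (subst integral_Re) (auto simp: sgn_real_def)
    then have "(LINT x|lborel. \<bar>Re (h x)\<bar>) = 0" by (simp add: abs_sgn)
    moreover have "integrable lborel (\<lambda>x. \<bar>Re (h x)\<bar>)" using ih by auto
    ultimately have "AE x in lborel. \<bar>Re (h x)\<bar> = 0"
      by (subst (asm) integral_nonneg_eq_0_iff_AE) auto
    then show ?thesis by simp
  qed
  have im: "AE x in lborel. Im (h x) = 0"
  proof -
    have "(LINT x|lborel. Im (h x * of_real (sgn (Im (h x))))) = 0"
      using borel0[of "\<lambda>x. sgn (Im (h x))"] bdd[of "\<lambda>x. sgn (Im (h x))" 1]
      by (subst integral_Im) (auto simp: sgn_real_def)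
    then have "(LINT x|lborel. \<bar>Im (h x)\<bar>) = 0" by (simp add: abs_sgn)
    moreover have "integrable lborel (\<lambda>x. \<bar>Im (h x)\<bar>)" using ih by auto
    ultimately have "AE x in lborel. \<bar>Im (h x)\<bar> = 0"
      by (subst (asm) integral_nonneg_eq_0_iff_AE) auto
    then show ?thesis by simp
  qed
  from re im show ?thesis by eventually_elim (simp add: complex_eq_iff)
qed

section \<open>The Dunkl measure and the Gegenbauer weight\<close>

lemma has_integral_zero_outside_unique:
  fixes f :: "real \<Rightarrow> 'a::euclidean_space"
  assumes "integrable lborel f" "(f has_integral I) {a..b}" "\<And>x. x \<notin> {a..b} \<Longrightarrow> f x = 0"
  shows "(LINT x|lborel. f x) = I"
proof -
  have "(f has_integral I) UNIV" using assms(2,3) by (rule has_integral_on_superset) auto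
  with has_integral_integral_lborel[OF assms(1)] show ?thesis by (rule has_integral_unique)
qed

text \<open>Folding pairs the values at z and -z, which the Dunkl operator couples, and leaves an
  integral over the half-line, where z is determined by z^2 and the density of the Dunkl measure is
  differentiable.\<close>

lemma lborel_fold:
  fixes h :: "real \<Rightarrow> 'a::{banach, second_countable_topology}"
  assumes h: "integrable lborel h"
  shows "integrable lborel (\<lambda>z. indicator {0<..} z *\<^sub>R (h z + h (- z)))"
    and "(LINT z|lborel. h z) = (LINT z|lborel. indicator {0<..} z *\<^sub>R (h z + h (- z)))"
proof -
  have i1: "integrable lborel (\<lambda>z. indicator {0<..} z *\<^sub>R h z)" and i2: "integrable lborel (\<lambda>z. indicator {..<0} z *\<^sub>R h z)"
    using h by (auto intro!: integrable_mult_indicator)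
  have i3: "integrable lborel (\<lambda>z. indicator {0<..} z *\<^sub>R h (-z))"
    using lborel_integrable_real_affine[OF i2, of "-1" 0]
    by (rule back_subst[of "integrable lborel"]) (auto simp: indicator_def fun_eq_iff)
  have e3: "(LINT z|lborel. indicator {..<0} z *\<^sub>R h z) = (LINT z|lborel. indicator {0<..} z *\<^sub>R h (-z))"
    by (subst lborel_integral_real_affine[of "-1" _ 0]) (auto intro!: Bochner_Integration.integral_cong simp: indicator_def)
  show "integrable lborel (\<lambda>z. indicator {0<..} z *\<^sub>R (h z + h (- z)))"
    using Bochner_Integration.integrable_add[OF i1 i3] by (simp add: scaleR_add_right)
  have "(LINT z|lborel. h z) = (LINT z|lborel. indicator {0<..} z *\<^sub>R h z + indicator {..<0} z *\<^sub>R h z)"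
    using h by (intro integral_cong_AE)
      (auto intro!: AE_I[of _ _ "{0}"] borel_measurable_add borel_measurable_scaleR simp: indicator_def)
  also have "\<dots> = (LINT z|lborel. indicator {0<..} z *\<^sub>R (h z + h (- z)))"
    using i1 i2 i3 by (simp add: e3 scaleR_add_right)
  finally show "(LINT z|lborel. h z) = (LINT z|lborel. indicator {0<..} z *\<^sub>R (h z + h (- z)))" .
qed

lemma nn_lborel_even:
  fixes h :: "real \<Rightarrow> ennreal"
  assumes [measurable]: "h \<in> borel_measurable borel" and even: "\<And>z. h (- z) = h z"
  shows "(\<integral>\<^sup>+z. h z \<partial>lborel) = 2 * (\<integral>\<^sup>+z. h z * indicator {0<..} z \<partial>lborel)"
proof -
  have "(\<integral>\<^sup>+z. h z \<partial>lborel) = (\<integral>\<^sup>+z. h z * indicator {0<..} z + h z * indicator {..<0} z \<partial>lborel)"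
    by (intro nn_integral_cong_AE AE_I[of _ _ "{0}"]) (auto simp: indicator_def)
  also have "\<dots> = (\<integral>\<^sup>+z. h z * indicator {0<..} z \<partial>lborel) + (\<integral>\<^sup>+z. h z * indicator {..<0} z \<partial>lborel)"
    by (intro nn_integral_add) auto
  also have "(\<integral>\<^sup>+z. h z * indicator {..<0} z \<partial>lborel) = (\<integral>\<^sup>+z. h z * indicator {0<..} z \<partial>lborel)"
    by (subst nn_integral_real_affine[of _ "-1" 0])
       (auto intro!: nn_integral_cong simp: indicator_def even)
  finally show ?thesis by (simp add: mult_2)
qed

(* The support condition of the translation kernel, in the cosine variable. *)
lemma abs_le_iff_triangle:
  fixes x y z :: real
  assumes "x \<noteq> 0" "y \<noteq> 0"
  shows "\<bar>z\<bar> \<in> {\<bar>\<bar>x\<bar> - \<bar>y\<bar>\<bar>..\<bar>x\<bar> + \<bar>y\<bar>} \<longleftrightarrow> \<bar>(z\<^sup>2 - x\<^sup>2 - y\<^sup>2) / (2 * x * y)\<bar> \<le> 1"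
proof -
  have p: "2 * \<bar>x\<bar> * \<bar>y\<bar> > 0" using assms by simp
  have "\<bar>z\<bar> \<in> {\<bar>\<bar>x\<bar> - \<bar>y\<bar>\<bar>..\<bar>x\<bar> + \<bar>y\<bar>} \<longleftrightarrow> (\<bar>x\<bar> - \<bar>y\<bar>)\<^sup>2 \<le> z\<^sup>2 \<and> z\<^sup>2 \<le> (\<bar>x\<bar> + \<bar>y\<bar>)\<^sup>2"
    by (auto simp: abs_le_square_iff[symmetric])
  also have "\<dots> \<longleftrightarrow> \<bar>z\<^sup>2 - x\<^sup>2 - y\<^sup>2\<bar> \<le> 2 * \<bar>x\<bar> * \<bar>y\<bar>"
    by (auto simp: power2_sum power2_diff abs_le_iff)
  also have "\<dots> \<longleftrightarrow> \<bar>(z\<^sup>2 - x\<^sup>2 - y\<^sup>2) / (2 * x * y)\<bar> \<le> 1"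
    using p by (simp add: abs_mult divide_le_eq)
  finally show ?thesis .
qed

text \<open>The law of cosines: z is a side of the triangle with further sides |x| and |y|, and v is
  up to sign the cosine of the angle opposite to z. The triangle inequalities for z > 0 become |v|
  <= 1, and z / |x * y| is the Jacobian.\<close>

lemma nn_integral_subst_cos:
  fixes F :: "real \<Rightarrow> real"
  assumes F[measurable]: "F \<in> borel_measurable borel" and nn: "\<And>v. F v \<ge> 0" and out: "\<And>v. \<bar>v\<bar> > 1 \<Longrightarrow> F v = 0"
    and xy: "x \<noteq> 0" "y \<noteq> 0"
  shows "(\<integral>\<^sup>+z. ennreal (F ((z\<^sup>2 - x\<^sup>2 - y\<^sup>2) / (2 * x * y)) * (z / \<bar>x * y\<bar>)) * indicator {0<..} z \<partial>lborel)
     = (\<integral>\<^sup>+v. ennreal (F v) \<partial>lborel)"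
proof -
  \<comment> \<open>With |x * y| in the denominator the substitution is increasing on z > 0. A
    negative product x * y only reflects v, which does not change the integral over all v; F is kept
    arbitrary so that the reflected function is covered.\<close>
  have pos: "(\<integral>\<^sup>+z. ennreal (F ((z\<^sup>2 - x\<^sup>2 - y\<^sup>2) / (2 * \<bar>x * y\<bar>)) * (z / \<bar>x * y\<bar>)) * indicator {0<..} z \<partial>lborel)
     = (\<integral>\<^sup>+v. ennreal (F v) \<partial>lborel)"
    if F[measurable]: "F \<in> borel_measurable borel" and nn: "\<And>v. F v \<ge> 0" and out: "\<And>v. \<bar>v\<bar> > 1 \<Longrightarrow> F v = 0" for F
  proof -
    define u where "u z = (z\<^sup>2 - x\<^sup>2 - y\<^sup>2) / (2 * \<bar>x * y\<bar>)" for z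
    define a where "a = \<bar>\<bar>x\<bar> - \<bar>y\<bar>\<bar>"
    define b where "b = \<bar>x\<bar> + \<bar>y\<bar>"
    have p: "2 * \<bar>x * y\<bar> > 0" using xy by simp
    have ab: "0 \<le> a" "a \<le> b" unfolding a_def b_def by auto
    have a2: "a\<^sup>2 - x\<^sup>2 - y\<^sup>2 = - (2 * \<bar>x * y\<bar>)" by (simp add: a_def power2_diff abs_mult)
    have b2: "b\<^sup>2 - x\<^sup>2 - y\<^sup>2 = 2 * \<bar>x * y\<bar>" by (simp add: b_def power2_sum abs_mult)
    have ua: "u a = -1" unfolding u_def a2 using p by simp
    have ub: "u b = 1" unfolding u_def b2 using p by simp
    have in_iff: "\<bar>u z\<bar> \<le> 1 \<longleftrightarrow> \<bar>z\<bar> \<in> {a..b}" for z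
      using abs_le_iff_triangle[of "\<bar>x\<bar>" "\<bar>y\<bar>" z] xy by (simp add: u_def a_def b_def abs_mult mult.assoc)
    have "(\<integral>\<^sup>+v. ennreal (F v) \<partial>lborel) = (\<integral>\<^sup>+v. ennreal (F v * indicator {u a..u b} v) \<partial>lborel)"
      using out by (intro nn_integral_cong) (auto simp: ua ub indicator_def abs_le_iff not_le[symmetric])
    also have "\<dots> = (\<integral>\<^sup>+z. ennreal (F (u z) * (z / \<bar>x * y\<bar>) * indicator {a..b} z) \<partial>lborel)"
    proof (rule nn_integral_substitution)
      show "(u has_real_derivative z / \<bar>x * y\<bar>) (at z)" for z
        unfolding u_def[abs_def] using xy by (auto intro!: derivative_eq_intros simp: field_simps)
      show "continuous_on {a..b} (\<lambda>z. z / \<bar>x * y\<bar>)" using xy by (auto intro!: continuous_intros)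
    qed (use ab in \<open>auto simp: set_borel_measurable_def\<close>)
    also have "\<dots> = (\<integral>\<^sup>+z. ennreal (F (u z) * (z / \<bar>x * y\<bar>)) * indicator {0<..} z \<partial>lborel)"
    proof (intro nn_integral_cong_AE AE_I[of _ _ "{0}"] subsetI)
      fix z assume "z \<in> {z \<in> space lborel. ennreal (F (u z) * (z / \<bar>x * y\<bar>) * indicator {a..b} z) \<noteq> ennreal (F (u z) * (z / \<bar>x * y\<bar>)) * indicator {0<..} z}"
      moreover have "ennreal (F (u z) * (z / \<bar>x * y\<bar>) * indicator {a..b} z) = ennreal (F (u z) * (z / \<bar>x * y\<bar>)) * indicator {0<..} z" if "z \<noteq> 0"
        using in_iff[of z] out[of "u z"] that ab by (auto simp: indicator_def)
      ultimately show "z \<in> {0}" by auto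
    qed auto
    finally show ?thesis by (simp add: u_def)
  qed
  show ?thesis
  proof (cases "x * y > 0")
    case True
    then show ?thesis using pos[OF F nn out] by (simp add: mult.assoc)
  next
    case False
    then have s: "\<bar>x * y\<bar> = - (x * y)" by simp
    have e: "(z\<^sup>2 - x\<^sup>2 - y\<^sup>2) / (2 * x * y) = - ((z\<^sup>2 - x\<^sup>2 - y\<^sup>2) / (2 * \<bar>x * y\<bar>))" for z
      unfolding s by (simp add: mult.assoc)
    have "(\<integral>\<^sup>+z. ennreal (F (- ((z\<^sup>2 - x\<^sup>2 - y\<^sup>2) / (2 * \<bar>x * y\<bar>))) * (z / \<bar>x * y\<bar>)) * indicator {0<..} z \<partial>lborel)
      = (\<integral>\<^sup>+v. ennreal (F (-v)) \<partial>lborel)"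
      by (rule pos[of "\<lambda>v. F (-v)"]) (use nn out in auto)
    also have "\<dots> = (\<integral>\<^sup>+v. ennreal (F v) \<partial>lborel)"
      by (subst (2) nn_integral_real_affine[of _ "-1" 0]) auto
    finally show ?thesis unfolding e .
  qed
qed

lemma integral_subst_cos:
  fixes F :: "real \<Rightarrow> real"
  assumes F: "integrable lborel F" and out: "\<And>v. \<bar>v\<bar> > 1 \<Longrightarrow> F v = 0"
    and xy: "x \<noteq> 0" "y \<noteq> 0"
  shows "(LINT z|lborel. indicator {0<..} z *\<^sub>R (F ((z\<^sup>2 - x\<^sup>2 - y\<^sup>2) / (2 * x * y)) * (z / \<bar>x * y\<bar>))) = (LINT v|lborel. F v)"
proof -
  have [measurable]: "F \<in> borel_measurable borel" using F by auto
  define P where "P v = max 0 (F v)" for v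
  define Q where "Q v = max 0 (- F v)" for v
  have main: "integrable lborel (\<lambda>z. indicator {0<..} z *\<^sub>R (G ((z\<^sup>2 - x\<^sup>2 - y\<^sup>2) / (2 * x * y)) * (z / \<bar>x * y\<bar>))) \<and>
    (LINT z|lborel. indicator {0<..} z *\<^sub>R (G ((z\<^sup>2 - x\<^sup>2 - y\<^sup>2) / (2 * x * y)) * (z / \<bar>x * y\<bar>))) = (LINT v|lborel. G v)"
    if G: "integrable lborel G" "\<And>v. G v \<ge> 0" "\<And>v. \<bar>v\<bar> > 1 \<Longrightarrow> G v = 0" for G
  proof -
    have [measurable]: "G \<in> borel_measurable borel" using G by auto
    have "(\<integral>\<^sup>+z. ennreal (indicator {0<..} z *\<^sub>R (G ((z\<^sup>2 - x\<^sup>2 - y\<^sup>2) / (2 * x * y)) * (z / \<bar>x * y\<bar>))) \<partial>lborel)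
      = (\<integral>\<^sup>+z. ennreal (G ((z\<^sup>2 - x\<^sup>2 - y\<^sup>2) / (2 * x * y)) * (z / \<bar>x * y\<bar>)) * indicator {0<..} z \<partial>lborel)"
      by (intro nn_integral_cong) (auto simp: indicator_def)
    also have "\<dots> = (\<integral>\<^sup>+v. ennreal (G v) \<partial>lborel)"
      by (rule nn_integral_subst_cos) (use G xy in auto)
    also have "\<dots> = ennreal (LINT v|lborel. G v)"
      using G by (intro nn_integral_eq_integral) auto
    finally have *: "(\<integral>\<^sup>+z. ennreal (indicator {0<..} z *\<^sub>R (G ((z\<^sup>2 - x\<^sup>2 - y\<^sup>2) / (2 * x * y)) * (z / \<bar>x * y\<bar>))) \<partial>lborel)
      = ennreal (LINT v|lborel. G v)" .
    have nn: "AE z in lborel. 0 \<le> indicator {0<..} z *\<^sub>R (G ((z\<^sup>2 - x\<^sup>2 - y\<^sup>2) / (2 * x * y)) * (z / \<bar>x * y\<bar>))"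
      using G(2) by (intro AE_I2) (auto simp: indicator_def)
    have i: "integrable lborel (\<lambda>z. indicator {0<..} z *\<^sub>R (G ((z\<^sup>2 - x\<^sup>2 - y\<^sup>2) / (2 * x * y)) * (z / \<bar>x * y\<bar>)))"
      by (rule integrableI_nonneg[OF _ nn]) (measurable, simp only: * ennreal_less_top infinity_ennreal_def)
    moreover have "ennreal (LINT z|lborel. indicator {0<..} z *\<^sub>R (G ((z\<^sup>2 - x\<^sup>2 - y\<^sup>2) / (2 * x * y)) * (z / \<bar>x * y\<bar>))) = ennreal (LINT v|lborel. G v)"
      using nn_integral_eq_integral[OF i nn] * by simp
    then have "(LINT z|lborel. indicator {0<..} z *\<^sub>R (G ((z\<^sup>2 - x\<^sup>2 - y\<^sup>2) / (2 * x * y)) * (z / \<bar>x * y\<bar>))) = (LINT v|lborel. G v)"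
      using G(2) nn by (subst (asm) ennreal_inj) (auto intro!: integral_nonneg_AE)
    ultimately show ?thesis by blast
  qed
  have iP: "integrable lborel P" and iQ: "integrable lborel Q" using F by (auto simp: P_def[abs_def] Q_def[abs_def])
  have FPQ: "F v = P v - Q v" for v by (simp add: P_def Q_def)
  have mP: "integrable lborel (\<lambda>z. indicator {0<..} z *\<^sub>R (P ((z\<^sup>2 - x\<^sup>2 - y\<^sup>2) / (2 * x * y)) * (z / \<bar>x * y\<bar>)))"
    "(LINT z|lborel. indicator {0<..} z *\<^sub>R (P ((z\<^sup>2 - x\<^sup>2 - y\<^sup>2) / (2 * x * y)) * (z / \<bar>x * y\<bar>))) = (LINT v|lborel. P v)"
    using main[OF iP] out by (auto simp: P_def)
  have mQ: "integrable lborel (\<lambda>z. indicator {0<..} z *\<^sub>R (Q ((z\<^sup>2 - x\<^sup>2 - y\<^sup>2) / (2 * x * y)) * (z / \<bar>x * y\<bar>)))"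
    "(LINT z|lborel. indicator {0<..} z *\<^sub>R (Q ((z\<^sup>2 - x\<^sup>2 - y\<^sup>2) / (2 * x * y)) * (z / \<bar>x * y\<bar>))) = (LINT v|lborel. Q v)"
    using main[OF iQ] out by (auto simp: Q_def)
  have "(LINT z|lborel. indicator {0<..} z *\<^sub>R (F ((z\<^sup>2 - x\<^sup>2 - y\<^sup>2) / (2 * x * y)) * (z / \<bar>x * y\<bar>)))
    = (LINT z|lborel. indicator {0<..} z *\<^sub>R (P ((z\<^sup>2 - x\<^sup>2 - y\<^sup>2) / (2 * x * y)) * (z / \<bar>x * y\<bar>)) - indicator {0<..} z *\<^sub>R (Q ((z\<^sup>2 - x\<^sup>2 - y\<^sup>2) / (2 * x * y)) * (z / \<bar>x * y\<bar>)))"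
    by (simp add: FPQ algebra_simps diff_divide_distrib)
  also have "\<dots> = (LINT v|lborel. P v) - (LINT v|lborel. Q v)"
    by (simp only: Bochner_Integration.integral_diff[OF mP(1) mQ(1)] mP(2) mQ(2))
  also have "\<dots> = (LINT v|lborel. F v)"
    unfolding FPQ using iP iQ by simp
  finally show ?thesis .
qed

section \<open>The Dunkl measure and the Gegenbauer probability measure J\<close>

locale dunkl =
  fixes \<alpha> :: real
  assumes \<alpha>: "\<alpha> > - (1/2)"
begin

abbreviation \<mu> :: "real measure" where "\<mu> \<equiv> dunkl_measure \<alpha>"
abbreviation \<kappa> :: real where "\<kappa> \<equiv> 2 * \<alpha> + 1"
abbreviation W :: "real \<Rightarrow> real \<Rightarrow> real \<Rightarrow> real" where "W \<equiv> dunkl_W \<alpha>"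

definition dens :: "real \<Rightarrow> real" where
  "dens x = \<bar>x\<bar> powr \<kappa> / (2 powr (\<alpha> + 1) * Gamma (\<alpha> + 1))"

text \<open>The normalised Gegenbauer weight: the constant is 1 / Beta(1/2, alpha + 1/2). It is
  integrable for alpha > -1/2, but unbounded near the endpoints for alpha < 1/2.\<close>

definition gegen :: "real \<Rightarrow> real" where
  "gegen v = (if \<bar>v\<bar> \<le> 1 then Gamma (\<alpha> + 1) / (sqrt pi * Gamma (\<alpha> + 1/2)) * (1 - v\<^sup>2) powr (\<alpha> - 1/2) else 0)"

definition J :: "real measure" where "J = density lborel (\<lambda>v. ennreal (gegen v))"

lemma \<kappa>_pos: "\<kappa> > 0" using \<alpha> by simp
lemma Gamma_pos': "Gamma (\<alpha> + 1) > 0" "Gamma (\<alpha> + 1/2) > 0" using \<alpha> by (auto intro!: Gamma_real_pos)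

lemma dens_measurable[measurable]: "dens \<in> borel_measurable borel" unfolding dens_def[abs_def] by measurable
lemma dens_nonneg[simp]: "dens x \<ge> 0" using Gamma_pos' by (simp add: dens_def)
lemma dens_pos: "x \<noteq> 0 \<Longrightarrow> dens x > 0" using Gamma_pos' by (simp add: dens_def)
lemma dens_minus[simp]: "dens (- x) = dens x" by (simp add: dens_def)

lemma mu_eq: "\<mu> = density lborel (\<lambda>x. ennreal (dens x))" unfolding dunkl_measure_def dens_def ..

lemma sets_mu[measurable_cong, simp]: "sets \<mu> = sets borel" by (simp add: mu_eq)
lemma space_mu[simp]: "space \<mu> = UNIV" by (simp add: mu_eq)

lemma sigma_finite_mu: "sigma_finite_measure \<mu>"
  unfolding mu_eq by (subst sigma_finite_measure.sigma_finite_iff_density_finite[OF sigma_finite_lborel]) auto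

text \<open>The density vanishes at the origin alone, so \<open>\<mu>\<close> and Lebesgue measure
  have the same null sets.\<close>

lemma AE_mu_iff: "(AE x in \<mu>. P x) \<longleftrightarrow> (AE x in lborel. P x)"
proof -
  have "(AE x in \<mu>. P x) \<longleftrightarrow> (AE x in lborel. x \<noteq> 0 \<longrightarrow> P x)"
    unfolding mu_eq by (subst AE_density) (auto simp: dens_def[of 0] dest: dens_pos intro!: AE_cong)
  also have "\<dots> \<longleftrightarrow> (AE x in lborel. P x)"
    using AE_lborel_singleton[of "0::real"] by (auto elim!: eventually_elim2[rotated] AE_mp)
  finally show ?thesis .
qed

lemma AE_mu_nonzero: "AE x in \<mu>. x \<noteq> 0" using AE_lborel_singleton[of "0::real"] by (simp add: AE_mu_iff)

lemma integral_mu: "g \<in> borel_measurable borel \<Longrightarrow> (LINT x|\<mu>. g x) = (LINT x|lborel. dens x *\<^sub>R g x)"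
  for g :: "real \<Rightarrow> 'a::{banach, second_countable_topology}"
  unfolding mu_eq by (subst integral_density) auto

lemma integrable_mu: "g \<in> borel_measurable borel \<Longrightarrow> integrable \<mu> g \<longleftrightarrow> integrable lborel (\<lambda>x. dens x *\<^sub>R g x)"
  for g :: "real \<Rightarrow> 'a::{banach, second_countable_topology}"
  unfolding mu_eq by (subst integrable_density) auto

lemma nn_integral_mu: "g \<in> borel_measurable borel \<Longrightarrow> (\<integral>\<^sup>+x. g x \<partial>\<mu>) = (\<integral>\<^sup>+x. ennreal (dens x) * g x \<partial>lborel)"
  unfolding mu_eq by (subst nn_integral_density) auto

lemma gegen_measurable[measurable]: "gegen \<in> borel_measurable borel" unfolding gegen_def[abs_def] by measurable
lemma gegen_nonneg[simp]: "gegen v \<ge> 0" using Gamma_pos' by (simp add: gegen_def)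
lemma gegen_minus[simp]: "gegen (- v) = gegen v" by (simp add: gegen_def)
lemma gegen_outside: "\<bar>v\<bar> > 1 \<Longrightarrow> gegen v = 0" by (simp add: gegen_def)

text \<open>The substitution t = v^2 turns Euler's Beta integral with parameters 1/2 and alpha + 1/2
  into twice the integral of (1 - v^2)^(alpha - 1/2) over [0, 1].\<close>

lemma nn_integral_gegen: "(\<integral>\<^sup>+v. ennreal (gegen v) \<partial>lborel) = 1"
proof -
  define C where "C = Gamma (\<alpha> + 1) / (sqrt pi * Gamma (\<alpha> + 1/2))"
  define Bt where "Bt = Beta (1/2) (\<alpha> + 1/2)"
  have C0: "C > 0" using Gamma_pos' by (simp add: C_def)
  have CB: "C * Bt = 1" using Gamma_pos' by (simp add: C_def Bt_def Beta_def Gamma_one_half_real add.commute)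
  have "((\<lambda>t. t powr (-1 / 2) * (1 - t) powr (\<alpha> - 1/2)) has_integral Bt) {0..1}"
    using has_integral_Beta_real[of "1/2" "\<alpha> + 1/2"] \<alpha> by (simp add: Bt_def)
  from nn_integral_has_integral_lebesgue[OF _ this] have
     "ennreal Bt = nn_integral lborel (\<lambda>t. ennreal (t powr (-1 / 2) * (1 - t) powr (\<alpha> - 1/2) * indicator {0^2..1^2} t))"
    by (simp add: mult_ac ennreal_mult' ennreal_indicator)
  also have "\<dots> = (\<integral>\<^sup>+ x. ennreal (x\<^sup>2 powr (-1 / 2) * (1 - x\<^sup>2) powr (\<alpha> - 1/2) * (2 * x) * indicator {0..1} x) \<partial>lborel)"
    by (subst nn_integral_substitution[where g = "\<lambda>x. x ^ 2" and g' = "\<lambda>x. 2 * x"])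
       (auto intro!: derivative_eq_intros continuous_intros simp: set_borel_measurable_def)
  also have "\<dots> = (\<integral>\<^sup>+ x. 2 * ennreal ((1 - x\<^sup>2) powr (\<alpha> - 1/2) * indicator {0..1} x) \<partial>lborel)"
    by (intro nn_integral_cong_AE AE_I[of _ _ "{0}"])
       (auto simp: indicator_def powr_minus powr_half_sqrt field_split_simps ennreal_mult')
  also have "\<dots> = 2 * (\<integral>\<^sup>+ x. ennreal ((1 - x\<^sup>2) powr (\<alpha> - 1/2) * indicator {0..1} x) \<partial>lborel)"
    by (intro nn_integral_cmult) auto
  finally have B: "ennreal Bt = 2 * (\<integral>\<^sup>+ x. ennreal ((1 - x\<^sup>2) powr (\<alpha> - 1/2) * indicator {0..1} x) \<partial>lborel)" .
  have "(\<integral>\<^sup>+v. ennreal (gegen v) \<partial>lborel) = 2 * (\<integral>\<^sup>+v. ennreal (gegen v) * indicator {0<..} v \<partial>lborel)"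
    by (rule nn_lborel_even) auto
  also have "(\<integral>\<^sup>+v. ennreal (gegen v) * indicator {0<..} v \<partial>lborel)
     = (\<integral>\<^sup>+v. ennreal C * ennreal ((1 - v\<^sup>2) powr (\<alpha> - 1/2) * indicator {0..1} v) \<partial>lborel)"
    using C0 by (intro nn_integral_cong_AE AE_I[of _ _ "{0}"])
      (auto simp: indicator_def gegen_def C_def[symmetric] ennreal_mult')
  also have "\<dots> = ennreal C * (\<integral>\<^sup>+v. ennreal ((1 - v\<^sup>2) powr (\<alpha> - 1/2) * indicator {0..1} v) \<partial>lborel)"
    by (intro nn_integral_cmult) auto
  also have "2 * \<dots> = ennreal C * ennreal Bt" by (simp add: B mult_ac)
  also have "\<dots> = 1" using C0 CB by (simp add: ennreal_mult'[symmetric])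
  finally show ?thesis .
qed

lemma sets_J[measurable_cong, simp]: "sets J = sets borel" by (simp add: J_def)
lemma space_J[simp]: "space J = UNIV" by (simp add: J_def)

lemma emeasure_J: "emeasure J UNIV = 1"
  unfolding J_def by (subst emeasure_density) (auto simp: nn_integral_gegen)

lemma finite_J: "finite_measure J"
  by (rule finite_measureI) (simp add: emeasure_J)

lemma sigma_finite_J: "sigma_finite_measure J"
  using finite_J finite_measure_def by blast

lemma AE_J: "AE v in J. \<bar>v\<bar> \<le> 1"
  unfolding J_def by (subst AE_density) (auto simp: gegen_def split: if_splits)

lemma integral_J: "g \<in> borel_measurable borel \<Longrightarrow> (LINT v|J. g v) = (LINT v|lborel. gegen v *\<^sub>R g v)"
  for g :: "real \<Rightarrow> 'a::{banach, second_countable_topology}"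
  unfolding J_def by (subst integral_density) auto

lemma integrable_J: "g \<in> borel_measurable borel \<Longrightarrow> integrable J g \<longleftrightarrow> integrable lborel (\<lambda>v. gegen v *\<^sub>R g v)"
  for g :: "real \<Rightarrow> 'a::{banach, second_countable_topology}"
  unfolding J_def by (subst integrable_density) auto

lemma integrable_J_bounded:
  fixes g :: "real \<Rightarrow> 'a::{banach, second_countable_topology}"
  assumes "g \<in> borel_measurable borel" "\<And>v. \<bar>v\<bar> \<le> 1 \<Longrightarrow> norm (g v) \<le> B"
  shows "integrable J g"
proof -
  interpret finite_measure J by (rule finite_J)
  show ?thesis by (rule integrable_const_bound[of _ B]) (use AE_J assms in auto)
qed

lemma integrable_J_cont:
  fixes g :: "real \<Rightarrow> 'a::euclidean_space"
  assumes "continuous_on UNIV g"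
  shows "integrable J g"
proof -
  have "compact (g ` {-1..1})" using assms by (intro compact_continuous_image continuous_on_subset[OF assms]) auto
  then obtain B where "\<And>x. x \<in> g ` {-1..1} \<Longrightarrow> norm x \<le> B" using compact_imp_bounded bounded_iff by metis
  then show ?thesis using assms by (intro integrable_J_bounded[where B=B] borel_measurable_continuous_onI) (auto simp: abs_le_iff)
qed

lemma J_reflect:
  fixes g :: "real \<Rightarrow> 'a::{banach, second_countable_topology}"
  assumes [measurable]: "g \<in> borel_measurable borel"
  shows "(LINT v|J. g (- v)) = (LINT v|J. g v)"
  unfolding integral_J[OF assms]
  by (subst lborel_integral_real_affine[of "-1" _ 0], simp, subst integral_J) auto

lemma J_one: "(LINT v|J. 1) = (1::real)" by (simp add: measure_def emeasure_J)

text \<open>J is symmetric, so the linear term in v has mean zero. Averaging with weight 1 + v thus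
  reproduces constants, which is how a profile is recovered from its translate by 0.\<close>

lemma J_weight_one: "(LINT v|J. (1 + v) * a) = (a::real)"
proof -
  have i: "integrable J (\<lambda>v. v)" by (rule integrable_J_cont) (auto intro!: continuous_intros)
  have "(LINT v|J. - v) = (LINT v|J. v)" by (rule J_reflect[of "\<lambda>v. v"]) auto
  then have "(LINT v|J. v) = 0" by simp
  then show ?thesis using i J_one by (simp add: distrib_right integrable_J_cont)
qed

text \<open>The function (1 - v^2)^(alpha + 1/2) has derivative \<open>- \<kappa> * v\<close> times
  (1 - v^2)^(alpha - 1/2) and vanishes at both endpoints, so no boundary terms appear.\<close>

lemma J_by_parts:
  fixes E E' :: "real \<Rightarrow> real"
  assumes dE: "\<And>v. (E has_real_derivative E' v) (at v)" and cE': "continuous_on UNIV E'"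
  shows "\<kappa> * (LINT v|J. v * E v) = (LINT v|J. (1 - v\<^sup>2) * E' v)"
proof -
  define C where "C = Gamma (\<alpha> + 1) / (sqrt pi * Gamma (\<alpha> + 1/2))"
  have cE: "continuous_on UNIV E" using dE by (meson DERIV_continuous_on DERIV_subset subset_UNIV)
  have [measurable]: "E \<in> borel_measurable borel" "E' \<in> borel_measurable borel"
    using cE cE' by (auto intro: borel_measurable_continuous_onI)
  have i1: "integrable J (\<lambda>v. v * E v)" and i2: "integrable J (\<lambda>v. (1 - v\<^sup>2) * E' v)"
    using cE cE' by (auto intro!: integrable_J_cont continuous_intros)
  define F where "F v = C * ((1 - v\<^sup>2) powr (\<alpha> + 1/2) * E v)" for v
  define f where "f v = gegen v * ((1 - v\<^sup>2) * E' v - \<kappa> * (v * E v))" for v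
  have "(f has_integral (F 1 - F (-1))) {-1..1}"
  \<comment> \<open>For alpha < 1/2 the integrand f may blow up at the endpoints, while F stays
    continuous there because alpha + 1/2 > 0.\<close>
  proof (rule fundamental_theorem_of_calculus_interior)
    show "continuous_on {-1..1} F" unfolding F_def
      using \<alpha> by (auto intro!: continuous_intros continuous_on_powr' continuous_on_subset[OF cE] simp: abs_square_le_1 abs_le_iff)
    fix v :: real assume v: "v \<in> {-1<..<1}"
    then have v2: "1 - v\<^sup>2 > 0" using abs_square_less_1[of v] by (auto simp: abs_less_iff)
    have pw: "(1 - v\<^sup>2) powr (\<alpha> + 1/2) = (1 - v\<^sup>2) * (1 - v\<^sup>2) powr (\<alpha> - 1/2)"
      using v2 powr_add[of "1 - v\<^sup>2" 1 "\<alpha> - 1/2"] by (simp add: add.commute)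
    have "(F has_real_derivative C * ((\<alpha> + 1/2) * (1 - v\<^sup>2) powr (\<alpha> - 1/2) * (- 2 * v) * E v + (1 - v\<^sup>2) powr (\<alpha> + 1/2) * E' v)) (at v)"
      unfolding F_def[abs_def] using v2
      by (auto intro!: derivative_eq_intros dE simp: powr_diff field_simps powr_add)
    moreover have "C * ((\<alpha> + 1/2) * (1 - v\<^sup>2) powr (\<alpha> - 1/2) * (- 2 * v) * E v + (1 - v\<^sup>2) powr (\<alpha> + 1/2) * E' v) = f v"
      proof -
      have gv: "gegen v = C * (1 - v\<^sup>2) powr (\<alpha> - 1/2)" using v by (auto simp: gegen_def C_def abs_le_iff)
      show ?thesis unfolding f_def gv pw by (simp add: algebra_simps)
    qed
    ultimately show "(F has_vector_derivative f v) (at v)"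
      by (simp add: has_real_derivative_iff_has_vector_derivative)
  qed simp
  moreover have "F 1 - F (-1) = 0" by (simp add: F_def)
  moreover have if': "integrable lborel f"
  proof -
    have "integrable J (\<lambda>v. (1 - v\<^sup>2) * E' v - \<kappa> * (v * E v))" using i1 i2 by auto
    then show ?thesis by (subst (asm) integrable_J) (auto simp: f_def[abs_def])
  qed
  ultimately have "(LINT v|lborel. f v) = 0"
    by (intro has_integral_zero_outside_unique[of f 0 "-1" 1]) (auto simp: f_def gegen_def abs_le_iff)
  moreover have "(LINT v|lborel. f v) = (LINT v|J. (1 - v\<^sup>2) * E' v - \<kappa> * (v * E v))"
    by (subst integral_J) (auto simp: f_def[abs_def])
  ultimately show ?thesis using i1 i2 by simp
qed

end

section \<open>The translation kernel\<close>

context dunkl begin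

lemma W_measurable[measurable (raw)]:
  assumes [measurable]: "f \<in> borel_measurable M" "g \<in> borel_measurable M" "h \<in> borel_measurable M"
  shows "(\<lambda>t. W (f t) (g t) (h t)) \<in> borel_measurable M"
  unfolding dunkl_W_def dunkl_b_def dunkl_Delta_def atLeastAtMost_iff by measurable

lemma W_support: "\<bar>z\<bar> > \<bar>x\<bar> + \<bar>y\<bar> \<Longrightarrow> W x y z = 0"
  by (simp add: dunkl_W_def dunkl_Delta_def)

text \<open>The product under the power is Heron's: 16 times the squared area of the triangle with
  sides |x|, |y|, |z|. It is symmetric in the sides, and so is the support condition, which is the
  triangle inequality.\<close>

lemma Delta_swap: "dunkl_Delta \<alpha> x y z = dunkl_Delta \<alpha> (- x) z y"
proof -
  have c: "\<bar>z\<bar> \<in> {\<bar>\<bar>x\<bar> - \<bar>y\<bar>\<bar> .. \<bar>x\<bar> + \<bar>y\<bar>} \<longleftrightarrow> \<bar>y\<bar> \<in> {\<bar>\<bar>-x\<bar> - \<bar>z\<bar>\<bar> .. \<bar>-x\<bar> + \<bar>z\<bar>}"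
    unfolding atLeastAtMost_iff by linarith
  have y2: "y\<^sup>2 = \<bar>y\<bar>\<^sup>2" and z2: "z\<^sup>2 = \<bar>z\<bar>\<^sup>2" by simp_all
  have p: "((\<bar>x\<bar> + \<bar>y\<bar>)\<^sup>2 - z\<^sup>2) * (z\<^sup>2 - (\<bar>x\<bar> - \<bar>y\<bar>)\<^sup>2) = ((\<bar>-x\<bar> + \<bar>z\<bar>)\<^sup>2 - y\<^sup>2) * (y\<^sup>2 - (\<bar>-x\<bar> - \<bar>z\<bar>)\<^sup>2)"
    unfolding y2 z2 abs_minus_cancel by (simp only: power2_eq_square) algebra
  have a: "\<bar>x * y * z\<bar> = \<bar>(-x) * z * y\<bar>" by (simp add: abs_mult)
  show ?thesis unfolding dunkl_Delta_def c p a ..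
qed

text \<open>Changing the sign of x and exchanging y and z permutes the three terms
  \<open>- dunkl_b x y z\<close>, \<open>dunkl_b z x y\<close>, \<open>dunkl_b z y x\<close> among
  themselves, signs included.\<close>

lemma W_swap:
  assumes "x \<noteq> 0" "y \<noteq> 0" "z \<noteq> 0"
  shows "W x y z = W (- x) z y"
proof -
  have "1 - dunkl_b x y z + dunkl_b z x y + dunkl_b z y x = 1 - dunkl_b (-x) z y + dunkl_b y (-x) z + dunkl_b y z (-x)"
    using assms by (simp add: dunkl_b_def field_simps)
  then show ?thesis by (simp add: dunkl_W_def Delta_swap[of x y z])
qed

lemma W_commute: "W x y z = W y x z"
  by (simp add: dunkl_W_def dunkl_Delta_def dunkl_b_def add_ac mult_ac abs_minus_commute power2_commute)

lemma W_rot: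
  assumes "x \<noteq> 0" "y \<noteq> 0" "z \<noteq> 0"
  shows "W x y z = W (- y) z x"
  using W_swap[of y x z] assms W_commute by simp

text \<open>The bracket in W factors as (1 + v) * (1 + (x + y) / z), and Heron's product is (2xy)^2
  * (1 - v^2). All remaining powers of |z| and |x * y| cancel down to |z| / |x * y|, the Jacobian of
  the cosine substitution. The factor 1/2 reflects that z and -z share the same v.\<close>

lemma W_dens:
  assumes x: "x \<noteq> 0" and y: "y \<noteq> 0" and z: "z \<noteq> 0"
  defines "v \<equiv> (z\<^sup>2 - x\<^sup>2 - y\<^sup>2) / (2 * x * y)"
  shows "W x y z * dens z = 1/2 * gegen v * (1 + v) * (1 + (x + y) / z) * (\<bar>z\<bar> / \<bar>x * y\<bar>)"
proof (cases "\<bar>v\<bar> \<le> 1")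
  case False
  then have "\<not> \<bar>z\<bar> \<in> {\<bar>\<bar>x\<bar> - \<bar>y\<bar>\<bar>..\<bar>x\<bar> + \<bar>y\<bar>}" unfolding abs_le_iff_triangle[OF x y, of z] v_def .
  then have "dunkl_Delta \<alpha> x y z = 0" by (simp only: dunkl_Delta_def if_False)
  with False show ?thesis by (simp add: dunkl_W_def gegen_def)
next
  case True
  have in_range: "\<bar>z\<bar> \<in> {\<bar>\<bar>x\<bar> - \<bar>y\<bar>\<bar>..\<bar>x\<bar> + \<bar>y\<bar>}" using abs_le_iff_triangle[OF x y, of z] True by (simp add: v_def)
  have vv: "2 * x * y * v = z\<^sup>2 - x\<^sup>2 - y\<^sup>2" using x y by (simp add: v_def)
  have br: "1 - dunkl_b x y z + dunkl_b z x y + dunkl_b z y x = (1 + v) * (1 + (x + y) / z)"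
    using x y z unfolding dunkl_b_def v_def by (simp add: field_simps power2_eq_square)
  have v2: "0 \<le> 1 - v\<^sup>2" using True by (simp add: abs_square_le_1)
  define a where "a = \<alpha> - 1/2"
  define X where "X = \<bar>x * y\<bar>"
  define Y where "Y = \<bar>z\<bar>"
  have X: "X > 0" and Y: "Y > 0" using x y z by (simp_all add: X_def Y_def)
  have prod: "((\<bar>x\<bar> + \<bar>y\<bar>)\<^sup>2 - z\<^sup>2) * (z\<^sup>2 - (\<bar>x\<bar> - \<bar>y\<bar>)\<^sup>2) = (2 * X) powr 2 * (1 - v\<^sup>2)"
  proof -
    have "((\<bar>x\<bar> + \<bar>y\<bar>)\<^sup>2 - z\<^sup>2) * (z\<^sup>2 - (\<bar>x\<bar> - \<bar>y\<bar>)\<^sup>2) = (2*\<bar>x\<bar>*\<bar>y\<bar>)\<^sup>2 - (z\<^sup>2 - x\<^sup>2 - y\<^sup>2)\<^sup>2"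
      by (simp add: power2_eq_square algebra_simps)
    also have "\<dots> = (2 * X)\<^sup>2 * (1 - v\<^sup>2)"
      unfolding vv[symmetric] X_def by (simp add: power_mult_distrib abs_mult algebra_simps)
    finally show ?thesis using X by simp
  qed
  have Delta: "dunkl_Delta \<alpha> x y z = (2 * X) powr (2 * a) * (1 - v\<^sup>2) powr a / (X powr (2*\<alpha>) * Y powr (2*\<alpha>))"
  proof -
    have "((2 * X) powr 2 * (1 - v\<^sup>2)) powr a = (2 * X) powr (2 * a) * (1 - v\<^sup>2) powr a"
      using powr_mult[of "(2 * X) powr 2" "1 - v\<^sup>2" a] v2 by (simp only: powr_powr powr_ge_zero simp_thms)
    moreover have "\<bar>x * y * z\<bar> powr (2*\<alpha>) = X powr (2*\<alpha>) * Y powr (2*\<alpha>)"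
      using X Y by (simp add: abs_mult X_def Y_def powr_mult)
    ultimately show ?thesis using in_range by (simp add: dunkl_Delta_def prod a_def)
  qed
  define G1 where "G1 = Gamma (\<alpha> + 1)"
  define G2 where "G2 = sqrt pi * Gamma (\<alpha> + 1/2)"
  have G: "G1 > 0" "G2 > 0" using Gamma_pos' by (simp_all add: G1_def G2_def)
  \<comment> \<open>The power 2^(2 alpha - 1) is split into the two powers of 2 in the constants of
    W and of the density; the leftover 1/2 is the one in the claim.\<close>
  have c1: "(2 * X) powr (2*a) = 2 powr (\<alpha> - 1) * 2 powr (\<alpha> + 1) / 2 * (X powr (2 * \<alpha>) / X)"
  proof -
    have "(2 * X) powr (2*a) = 2 powr (2*\<alpha> - 1) * X powr (2*\<alpha> - 1)"
      using X by (simp add: powr_mult a_def algebra_simps)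
    also have "2 powr (2*\<alpha> - 1) = 2 powr (\<alpha> - 1) * 2 powr (\<alpha> + 1) / (2::real)"
    proof -
      have "2 powr (\<alpha> - 1) * 2 powr (\<alpha> + 1) = (2::real) powr (2 * \<alpha>)" by (simp add: powr_add[symmetric])
      moreover have "2 powr (2 * \<alpha> - 1) = (2::real) powr (2 * \<alpha>) / 2" by (simp add: powr_diff)
      ultimately show ?thesis by (simp only:)
    qed
    also have "X powr (2*\<alpha> - 1) = X powr (2*\<alpha>) / X" using X by (simp add: powr_diff)
    finally show ?thesis .
  qed
  have c2: "Y powr \<kappa> = Y powr (2*\<alpha>) * Y" using Y by (simp add: powr_add)
  have "W x y z * dens z = (G1\<^sup>2 / (2 powr (\<alpha> - 1) * G2)) * ((1 + v) * (1 + (x + y) / z))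
     * ((2 * X) powr (2 * a) * (1 - v\<^sup>2) powr a / (X powr (2*\<alpha>) * Y powr (2*\<alpha>)))
     * (Y powr \<kappa> / (2 powr (\<alpha> + 1) * G1))"
    unfolding dunkl_W_def br Delta dens_def G1_def G2_def Y_def by (simp add: mult.assoc)
  also have "\<dots> = 1/2 * (G1 / G2 * (1 - v\<^sup>2) powr a) * (1 + v) * (1 + (x + y) / z) * (Y / X)"
    unfolding c1 c2 using X Y G by (simp add: power2_eq_square divide_simps)
  finally show ?thesis using True by (simp add: gegen_def G1_def G2_def a_def X_def Y_def)
qed

text \<open>The quotient (x + y) / z is unbounded as z tends to 0, but z^2 is the mean of (x + y)^2
  and (x - y)^2 with weights (1 + v) / 2 and (1 - v) / 2. So a small z forces a small 1 + v or a
  small x + y, and the product stays bounded.\<close>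

lemma sum_weight_le:
  fixes x y z v :: real
  assumes "z\<^sup>2 = x\<^sup>2 + y\<^sup>2 + 2 * x * y * v" "\<bar>v\<bar> \<le> 1"
  shows "\<bar>(1 + v) * (x + y)\<bar> \<le> 2 * \<bar>z\<bar>"
proof -
  have "(x + y)\<^sup>2 * (1 + v) \<le> 2 * z\<^sup>2"
  proof -
    have "2 * z\<^sup>2 - (x + y)\<^sup>2 * (1 + v) = (x - y)\<^sup>2 * (1 - v)"
      unfolding assms(1) by (simp add: power2_eq_square algebra_simps)
    moreover have "(x - y)\<^sup>2 * (1 - v) \<ge> 0" using assms(2) by auto
    ultimately show ?thesis by linarith
  qed
  then have "(1 + v) * ((x + y)\<^sup>2 * (1 + v)) \<le> 2 * (2 * z\<^sup>2)"
    using assms(2) by (intro mult_mono[of "1 + v" 2]) auto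
  then have "((1 + v) * (x + y))\<^sup>2 \<le> (2 * z)\<^sup>2" by (simp add: power2_eq_square algebra_simps)
  then have "\<bar>(1 + v) * (x + y)\<bar> \<le> \<bar>2 * z\<bar>" by (simp only: abs_le_square_iff)
  then show ?thesis by (simp add: abs_mult)
qed

lemma W_dens_bound:
  assumes x: "x \<noteq> 0" and y: "y \<noteq> 0" and z: "z \<noteq> 0"
  shows "\<bar>W x y z\<bar> * dens z \<le> 2 * (gegen ((z\<^sup>2 - x\<^sup>2 - y\<^sup>2) / (2 * x * y)) * (\<bar>z\<bar> / \<bar>x * y\<bar>))"
proof -
  define v where "v = (z\<^sup>2 - x\<^sup>2 - y\<^sup>2) / (2 * x * y)"
  have "\<bar>W x y z\<bar> * dens z = \<bar>W x y z * dens z\<bar>" by (simp add: abs_mult)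
  also have "\<dots> = 1/2 * gegen v * \<bar>(1 + v) * (1 + (x + y) / z)\<bar> * (\<bar>z\<bar> / \<bar>x * y\<bar>)"
    unfolding W_dens[OF assms] by (simp add: abs_mult v_def mult_ac)
  also have "\<dots> \<le> 1/2 * gegen v * 4 * (\<bar>z\<bar> / \<bar>x * y\<bar>)"
  proof (cases "\<bar>v\<bar> \<le> 1")
    case True
    have "\<bar>(1 + v) * (x + y)\<bar> \<le> 2 * \<bar>z\<bar>"
      by (rule sum_weight_le[OF _ True]) (use x y in \<open>simp add: v_def\<close>)
    then have "\<bar>(1 + v) * (x + y) / z\<bar> \<le> 2" using z by (simp add: divide_le_eq)
    then have "\<bar>(1 + v) * (1 + (x + y) / z)\<bar> \<le> 4"
      using True abs_triangle_ineq[of "1 + v" "(1 + v) * (x + y) / z"] by (simp only: distrib_left[of "1 + v" 1] mult_1_right times_divide_eq_right)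
    then show ?thesis by (intro mult_right_mono mult_left_mono) auto
  qed (simp add: gegen_outside)
  finally show ?thesis by (simp add: v_def)
qed

text \<open>The 4 is 2 * 2: one factor from \<open>W_dens_bound\<close>, one from folding the two
  half-lines; the Gegenbauer weight has mass 1.\<close>

lemma W_bound:
  assumes x: "x \<noteq> 0" and y: "y \<noteq> 0"
  shows "(\<integral>\<^sup>+z. ennreal \<bar>W x y z\<bar> \<partial>\<mu>) \<le> 4"
proof -
  define h where "h z = ennreal (gegen ((z\<^sup>2 - x\<^sup>2 - y\<^sup>2) / (2 * x * y)) * (\<bar>z\<bar> / \<bar>x * y\<bar>))" for z
  have [measurable]: "h \<in> borel_measurable borel" unfolding h_def[abs_def] by measurable
  have "(\<integral>\<^sup>+z. ennreal \<bar>W x y z\<bar> \<partial>\<mu>) = (\<integral>\<^sup>+z. ennreal (\<bar>W x y z\<bar> * dens z) \<partial>lborel)"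
    by (subst nn_integral_mu) (auto simp: ennreal_mult mult.commute)
  also have "\<dots> \<le> (\<integral>\<^sup>+z. 2 * h z \<partial>lborel)"
  proof (rule nn_integral_mono_AE)
    show "AE z in lborel. ennreal (\<bar>W x y z\<bar> * dens z) \<le> 2 * h z"
      using AE_lborel_singleton[of "0::real"]
    proof eventually_elim
      case (elim z)
      have "2 * h z = ennreal (2 * (gegen ((z\<^sup>2 - x\<^sup>2 - y\<^sup>2) / (2 * x * y)) * (\<bar>z\<bar> / \<bar>x * y\<bar>)))"
        unfolding h_def by (subst ennreal_mult) auto
      then show ?case using W_dens_bound[OF x y elim] by (simp add: ennreal_leI)
    qed
  qed
  also have "\<dots> = 2 * (\<integral>\<^sup>+z. h z \<partial>lborel)" by (intro nn_integral_cmult) auto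
  also have "(\<integral>\<^sup>+z. h z \<partial>lborel) = 2 * (\<integral>\<^sup>+z. h z * indicator {0<..} z \<partial>lborel)"
    by (rule nn_lborel_even) (auto simp: h_def)
  also have "(\<integral>\<^sup>+z. h z * indicator {0<..} z \<partial>lborel) =
     (\<integral>\<^sup>+z. ennreal (gegen ((z\<^sup>2 - x\<^sup>2 - y\<^sup>2) / (2 * x * y)) * (z / \<bar>x * y\<bar>)) * indicator {0<..} z \<partial>lborel)"
    by (intro nn_integral_cong) (auto simp: h_def indicator_def)
  also have "\<dots> = 1"
    by (subst nn_integral_subst_cos) (auto simp: x y gegen_outside nn_integral_gegen)
  finally show ?thesis by (simp add: mult.assoc[symmetric])
qed

text \<open>By \<open>W_swap\<close> the column integrals are row integrals for -x; this is the
  second bound in Schur's test.\<close>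

lemma W_bound':
  assumes x: "x \<noteq> 0" and z: "z \<noteq> 0"
  shows "(\<integral>\<^sup>+y. ennreal \<bar>W x y z\<bar> \<partial>\<mu>) \<le> 4"
proof -
  have "(\<integral>\<^sup>+y. ennreal \<bar>W x y z\<bar> \<partial>\<mu>) = (\<integral>\<^sup>+y. ennreal \<bar>W (-x) z y\<bar> \<partial>\<mu>)"
  proof (rule nn_integral_cong_AE)
    show "AE y in \<mu>. ennreal \<bar>W x y z\<bar> = ennreal \<bar>W (-x) z y\<bar>"
      using AE_mu_nonzero by eventually_elim (simp add: W_swap[OF x _ z])
  qed
  also have "\<dots> \<le> 4" using x z by (intro W_bound) auto
  finally show ?thesis .
qed

lemma integrable_W_bounded:
  fixes \<psi> :: "real \<Rightarrow> real"
  assumes x: "x \<noteq> 0" and y: "y \<noteq> 0" and [measurable]: "\<psi> \<in> borel_measurable borel"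
    and B: "\<And>z. \<bar>z\<bar> \<le> \<bar>x\<bar> + \<bar>y\<bar> \<Longrightarrow> \<bar>\<psi> z\<bar> \<le> B"
  shows "integrable \<mu> (\<lambda>z. W x y z * \<psi> z)"
proof (rule Bochner_Integration.integrable_bound)
  have "integrable \<mu> (\<lambda>z. W x y z)"
    using W_bound[OF x y] by (intro integrableI_bounded) (auto simp: le_less_trans)
  then show "integrable \<mu> (\<lambda>z. B * W x y z)" by auto
  show "AE z in \<mu>. norm (W x y z * \<psi> z) \<le> norm (B * W x y z)"
  proof (rule AE_I2)
    fix z
    show "norm (W x y z * \<psi> z) \<le> norm (B * W x y z)"
    proof (cases "\<bar>z\<bar> > \<bar>x\<bar> + \<bar>y\<bar>")
      case False
      then have "\<bar>\<psi> z\<bar> \<le> \<bar>B\<bar>" using B[of z] by auto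
      then show ?thesis by (simp add: abs_mult mult.commute mult_right_mono)
    qed (simp add: W_support)
  qed
qed measurable

text \<open>Adding the contributions of z and -z combines the factors 1 + (x + y) / z and 1 - (x +
  y) / z. The even part becomes 2 * E(z^2) and the odd part 2 * (x + y) * G(z^2): the singular 1 / z
  is consumed by the factor z of the odd part.\<close>

lemma W_even_odd:
  fixes E G :: "real \<Rightarrow> real"
  assumes x: "x \<noteq> 0" and y: "y \<noteq> 0" and cE: "continuous_on UNIV E" and cG: "continuous_on UNIV G"
  shows "(LINT z|\<mu>. W x y z * (E (z\<^sup>2) + z * G (z\<^sup>2)))
    = (LINT v|J. (1 + v) * (E (x\<^sup>2 + y\<^sup>2 + 2 * x * y * v) + (x + y) * G (x\<^sup>2 + y\<^sup>2 + 2 * x * y * v)))"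
proof -
  have [measurable]: "E \<in> borel_measurable borel" "G \<in> borel_measurable borel"
    using cE cG by (auto intro: borel_measurable_continuous_onI)
  define \<psi> where "\<psi> z = E (z\<^sup>2) + z * G (z\<^sup>2)" for z
  have c\<psi>: "continuous_on UNIV \<psi>" unfolding \<psi>_def
    by (auto intro!: continuous_intros continuous_on_compose2[OF cE] continuous_on_compose2[OF cG])
  have [measurable]: "\<psi> \<in> borel_measurable borel" using c\<psi> by (rule borel_measurable_continuous_onI)
  have "compact (\<psi> ` {-(\<bar>x\<bar>+\<bar>y\<bar>)..\<bar>x\<bar>+\<bar>y\<bar>})" by (intro compact_continuous_image continuous_on_subset[OF c\<psi>]) auto
  then obtain B where B: "\<And>t. t \<in> \<psi> ` {-(\<bar>x\<bar>+\<bar>y\<bar>)..\<bar>x\<bar>+\<bar>y\<bar>} \<Longrightarrow> norm t \<le> B"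
    using compact_imp_bounded bounded_iff by metis
  have i: "integrable \<mu> (\<lambda>z. W x y z * \<psi> z)"
    by (rule integrable_W_bounded[OF x y, of _ B]) (use B in \<open>auto simp: abs_le_iff\<close>)
  define h where "h z = W x y z * dens z * \<psi> z" for z
  have ih: "integrable lborel h" using i by (subst (asm) integrable_mu) (auto simp: h_def[abs_def] mult_ac)
  define F where "F v = gegen v * ((1 + v) * (E (x\<^sup>2 + y\<^sup>2 + 2 * x * y * v) + (x + y) * G (x\<^sup>2 + y\<^sup>2 + 2 * x * y * v)))" for v
  have cF: "continuous_on UNIV (\<lambda>v. (1 + v) * (E (x\<^sup>2 + y\<^sup>2 + 2 * x * y * v) + (x + y) * G (x\<^sup>2 + y\<^sup>2 + 2 * x * y * v)))"
    by (auto intro!: continuous_intros continuous_on_compose2[OF cE] continuous_on_compose2[OF cG])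
  have iF: "integrable lborel F"
    using integrable_J_cont[OF cF] by (subst (asm) integrable_J) (auto simp: F_def[abs_def])
  have fold: "h z + h (- z) = F ((z\<^sup>2 - x\<^sup>2 - y\<^sup>2) / (2 * x * y)) * (z / \<bar>x * y\<bar>)" if z: "z > 0" for z
  proof -
    define v where "v = (z\<^sup>2 - x\<^sup>2 - y\<^sup>2) / (2 * x * y)"
    have q: "x\<^sup>2 + y\<^sup>2 + 2 * x * y * v = z\<^sup>2" using x y by (simp add: v_def)
    have h1: "h z = 1/2 * gegen v * (1 + v) * (1 + (x + y) / z) * (z / \<bar>x * y\<bar>) * \<psi> z"
      using W_dens[OF x y, of z] z by (simp add: h_def v_def)
    have h2: "h (- z) = 1/2 * gegen v * (1 + v) * (1 - (x + y) / z) * (z / \<bar>x * y\<bar>) * \<psi> (-z)"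
      using W_dens[OF x y, of "-z"] z by (simp add: h_def v_def)
    have "h z + h (- z) = 1/2 * gegen v * (1 + v) * (z / \<bar>x * y\<bar>) * ((1 + (x + y) / z) * \<psi> z + (1 - (x + y) / z) * \<psi> (-z))"
      unfolding h1 h2 by (simp only: algebra_simps)
    also have "(1 + (x + y) / z) * \<psi> z + (1 - (x + y) / z) * \<psi> (-z) = 2 * (E (z\<^sup>2) + (x + y) * G (z\<^sup>2))"
      using z by (simp add: \<psi>_def field_simps)
    finally have "h z + h (- z) = 1/2 * gegen v * (1 + v) * (z / \<bar>x * y\<bar>) * (2 * (E (z\<^sup>2) + (x + y) * G (z\<^sup>2)))" .
    moreover have "1/2 * g * w * t * (2 * s) = g * (w * s) * t" for g w t s :: real by simp
    ultimately show ?thesis unfolding v_def[symmetric] F_def q by (simp only:)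
  qed
  have "(LINT z|\<mu>. W x y z * \<psi> z) = (LINT z|lborel. h z)"
    by (subst integral_mu) (auto simp: h_def[abs_def] mult_ac)
  also have "\<dots> = (LINT z|lborel. indicator {0<..} z *\<^sub>R (h z + h (- z)))" by (rule lborel_fold[OF ih])
  also have "\<dots> = (LINT z|lborel. indicator {0<..} z *\<^sub>R (F ((z\<^sup>2 - x\<^sup>2 - y\<^sup>2) / (2 * x * y)) * (z / \<bar>x * y\<bar>)))"
    using fold by (intro Bochner_Integration.integral_cong) (auto simp: indicator_def)
  also have "\<dots> = (LINT v|lborel. F v)"
    by (rule integral_subst_cos[OF iF]) (auto simp: F_def gegen_outside x y)
  also have "\<dots> = (LINT v|J. (1 + v) * (E (x\<^sup>2 + y\<^sup>2 + 2 * x * y * v) + (x + y) * G (x\<^sup>2 + y\<^sup>2 + 2 * x * y * v)))"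
    by (subst integral_J) (auto simp: F_def[abs_def])
  finally show ?thesis by (simp add: \<psi>_def)
qed

end

section \<open>Translations as bounded operators\<close>

context dunkl begin

lemma emeasure_mu_compact: "emeasure \<mu> {-R..R} < \<infinity>"
proof -
  have "emeasure \<mu> {-R..R} = (\<integral>\<^sup>+x. ennreal (dens x) * indicator {-R..R} x \<partial>lborel)"
    unfolding mu_eq by (subst emeasure_density) auto
  also have "\<dots> \<le> (\<integral>\<^sup>+x. ennreal (dens R) * indicator {-R..R} x \<partial>lborel)"
    using \<kappa>_pos Gamma_pos' by (intro nn_integral_mono)
      (auto simp: indicator_def dens_def intro!: ennreal_leI divide_right_mono powr_mono2)
  also have "\<dots> < \<infinity>" by (simp add: nn_integral_cmult_indicator ennreal_mult_less_top emeasure_lborel_Icc_eq)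
  finally show ?thesis .
qed

lemma integrable_mu_bounded:
  fixes g :: "real \<Rightarrow> 'a::{banach, second_countable_topology}"
  assumes [measurable]: "g \<in> borel_measurable borel" and B: "\<And>x. norm (g x) \<le> B" and R: "\<And>x. \<bar>x\<bar> > R \<Longrightarrow> g x = 0"
  shows "integrable \<mu> g"
proof (rule Bochner_Integration.integrable_bound)
  show "integrable \<mu> (\<lambda>x. B * indicator {-R..R} x)"
    using emeasure_mu_compact by (intro integrable_mult_right integrable_real_indicator) auto
  show "AE x in \<mu>. norm (g x) \<le> norm (B * indicator {-R..R} x :: real)"
  proof (rule AE_I2)
    fix x show "norm (g x) \<le> norm (B * indicator {-R..R} x :: real)"
      using B[of x] R[of x] by (cases "\<bar>x\<bar> > R") (auto simp: indicator_def abs_le_iff intro: order_trans[OF _ abs_ge_self])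
  qed
qed simp

end

section \<open>The spaces L^p and the density of continuous functions\<close>

locale dunkl_Lp = dunkl +
  fixes p :: real
  assumes p: "p \<ge> 1"
begin

abbreviation L :: "(real \<Rightarrow> complex) set" where "L \<equiv> Lp \<alpha> p"

text \<open>Jensen's inequality and dominated convergence speak about this p-th power; norms are
  recovered by taking roots at the end.\<close>

definition Ip :: "(real \<Rightarrow> complex) \<Rightarrow> real" where
  "Ip f = (LINT x|\<mu>. norm (f x) powr p)"

lemma Ip_nonneg[simp]: "Ip f \<ge> 0" unfolding Ip_def by (intro integral_nonneg_AE) auto

lemma Lp_norm_eq: "Lp_norm \<alpha> p f = Ip f powr (1/p)" by (simp add: Lp_norm_def Ip_def)
lemma Lp_norm_nonneg[simp]: "Lp_norm \<alpha> p f \<ge> 0" by (simp add: Lp_norm_eq)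
lemma Ip_eq: "Ip f = Lp_norm \<alpha> p f powr p" using p by (simp add: Lp_norm_eq powr_powr)

lemma Lp_norm_le: 
  assumes "Ip f \<le> C powr p * Ip g" "C \<ge> 0"
  shows "Lp_norm \<alpha> p f \<le> C * Lp_norm \<alpha> p g"
proof -
  have "Ip f powr (1/p) \<le> (C powr p * Ip g) powr (1/p)" using assms p by (intro powr_mono2) auto
  also have "\<dots> = C * Ip g powr (1/p)" using assms p by (simp add: powr_mult powr_powr)
  finally show ?thesis by (simp add: Lp_norm_eq)
qed

lemma Lp_memD: "f \<in> L \<Longrightarrow> f \<in> borel_measurable borel" "f \<in> L \<Longrightarrow> integrable \<mu> (\<lambda>x. norm (f x) powr p)"
  by (simp_all add: Lp_def measurable_cong_sets[OF sets_mu refl])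

lemma Lp_memI: "f \<in> borel_measurable borel \<Longrightarrow> integrable \<mu> (\<lambda>x. norm (f x) powr p) \<Longrightarrow> f \<in> L"
  by (simp add: Lp_def measurable_cong_sets[OF sets_mu refl])

lemma powr_sum_le: "(a + b) powr p \<le> 2 powr p * (a powr p + b powr p)" if "a \<ge> 0" "b \<ge> 0" for a b :: real
proof -
  have "(a + b) powr p \<le> (2 * max a b) powr p" using that p by (intro powr_mono2) auto
  also have "\<dots> = 2 powr p * (max a b) powr p" using that by (simp add: powr_mult)
  also have "(max a b) powr p \<le> a powr p + b powr p" by (simp add: max_def)
  finally show ?thesis by simp
qed

lemma L_add:
  assumes f: "f \<in> L" and g: "g \<in> L"
  shows "(\<lambda>x. f x + g x) \<in> L" and "Ip (\<lambda>x. f x + g x) \<le> 2 powr p * (Ip f + Ip g)"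
proof -
  note [measurable] = Lp_memD(1)[OF f] Lp_memD(1)[OF g]
  have le: "norm (f x + g x) powr p \<le> 2 powr p * (norm (f x) powr p + norm (g x) powr p)" for x
  proof -
    have "norm (f x + g x) powr p \<le> (norm (f x) + norm (g x)) powr p"
      using p by (intro powr_mono2 norm_triangle_ineq) auto
    also have "\<dots> \<le> 2 powr p * (norm (f x) powr p + norm (g x) powr p)" by (rule powr_sum_le) auto
    finally show ?thesis .
  qed
  have i: "integrable \<mu> (\<lambda>x. 2 powr p * (norm (f x) powr p + norm (g x) powr p))"
    using Lp_memD(2)[OF f] Lp_memD(2)[OF g] by auto
  have i2: "integrable \<mu> (\<lambda>x. norm (f x + g x) powr p)"
    by (rule Bochner_Integration.integrable_bound[OF i]) (use le in auto)
  then show "(\<lambda>x. f x + g x) \<in> L" by (intro Lp_memI) auto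
  have "Ip (\<lambda>x. f x + g x) \<le> (LINT x|\<mu>. 2 powr p * (norm (f x) powr p + norm (g x) powr p))"
    unfolding Ip_def using i2 i le by (rule integral_mono)
  also have "\<dots> = 2 powr p * (Ip f + Ip g)" unfolding Ip_def using Lp_memD(2)[OF f] Lp_memD(2)[OF g] by simp
  finally show "Ip (\<lambda>x. f x + g x) \<le> 2 powr p * (Ip f + Ip g)" .
qed

text \<open>The 4 collects the \<open>2 powr p\<close> of \<open>L_add\<close> and a second one from
  a^p + b^p <= 2 * (a + b)^p together with 2 <= 2^p.\<close>

lemma Lp_norm_add:
  assumes f: "f \<in> L" and g: "g \<in> L"
  shows "Lp_norm \<alpha> p (\<lambda>x. f x + g x) \<le> 4 * (Lp_norm \<alpha> p f + Lp_norm \<alpha> p g)"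
proof -
  define a where "a = Lp_norm \<alpha> p f"
  define b where "b = Lp_norm \<alpha> p g"
  have ab: "a \<ge> 0" "b \<ge> 0" by (simp_all add: a_def b_def)
  have "Ip f + Ip g \<le> 2 powr p * (a + b) powr p"
  proof -
    have "a powr p \<le> (a+b) powr p" "b powr p \<le> (a+b) powr p" using ab p by (auto intro!: powr_mono2)
    then have "Ip f + Ip g \<le> 2 * (a + b) powr p" by (simp add: Ip_eq a_def b_def)
    also have "2 \<le> 2 powr p" using powr_mono[of 1 p 2] p by simp
    finally show ?thesis by (simp add: mult_right_mono)
  qed
  then have "2 powr p * (Ip f + Ip g) \<le> 2 powr p * (2 powr p * (a + b) powr p)" by (intro mult_left_mono) auto
  also have "2 powr p * (2 powr p * X powr p) = (4 * X) powr p" if "X \<ge> 0" for X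
    using that powr_mult[of 2 2 p] by (simp add: powr_mult)
  then have "2 powr p * (2 powr p * (a + b) powr p) = (4 * (a + b)) powr p" using ab by simp
  finally have "Ip (\<lambda>x. f x + g x) \<le> (4 * (a + b)) powr p" using L_add(2)[OF f g] by simp
  then have "Ip (\<lambda>x. f x + g x) powr (1/p) \<le> ((4 * (a + b)) powr p) powr (1/p)"
    using p by (intro powr_mono2) auto
  then show ?thesis using ab p by (simp add: powr_powr Lp_norm_eq a_def b_def)
qed

lemma L_cmult:
  assumes f: "f \<in> L"
  shows "(\<lambda>x. c * f x) \<in> L" and "Ip (\<lambda>x. c * f x) = norm c powr p * Ip f"
    and "Lp_norm \<alpha> p (\<lambda>x. c * f x) = norm c * Lp_norm \<alpha> p f"
proof -
  note [measurable] = Lp_memD(1)[OF f]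
  show "(\<lambda>x. c * f x) \<in> L" using Lp_memD(2)[OF f] by (intro Lp_memI) (auto simp: norm_mult powr_mult)
  show *: "Ip (\<lambda>x. c * f x) = norm c powr p * Ip f" by (simp add: Ip_def norm_mult powr_mult)
  show "Lp_norm \<alpha> p (\<lambda>x. c * f x) = norm c * Lp_norm \<alpha> p f"
    using p by (simp add: Lp_norm_eq * powr_mult powr_powr)
qed

lemma L_diff:
  assumes f: "f \<in> L" and g: "g \<in> L"
  shows "(\<lambda>x. f x - g x) \<in> L" and "Ip (\<lambda>x. f x - g x) \<le> 2 powr p * (Ip f + Ip g)"
    and "Lp_norm \<alpha> p (\<lambda>x. f x - g x) \<le> 4 * (Lp_norm \<alpha> p f + Lp_norm \<alpha> p g)"
  using L_add[OF f L_cmult(1)[OF g, of "-1"]] L_cmult(2,3)[OF g, of "-1"] Lp_norm_add[OF f L_cmult(1)[OF g, of "-1"]] by auto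

lemma Ip_cong_AE:
  assumes "f \<in> borel_measurable borel" "g \<in> borel_measurable borel" "AE x in \<mu>. f x = g x"
  shows "Ip f = Ip g" "Lp_norm \<alpha> p f = Lp_norm \<alpha> p g"
proof -
  note [measurable] = assms(1,2)
  show "Ip f = Ip g" unfolding Ip_def by (intro integral_cong_AE) (use assms(3) in auto)
  then show "Lp_norm \<alpha> p f = Lp_norm \<alpha> p g" by (simp add: Lp_norm_eq)
qed

lemma L_bounded:
  assumes [measurable]: "g \<in> borel_measurable borel" and B: "\<And>x. norm (g x) \<le> B" and R: "\<And>x. \<bar>x\<bar> > R \<Longrightarrow> g x = 0"
  shows "g \<in> L"
proof (intro Lp_memI)
  show "integrable \<mu> (\<lambda>x. norm (g x) powr p)"
    by (rule integrable_mu_bounded[of _ "B powr p" R]) (use B R p in \<open>auto intro!: powr_mono2\<close>)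
qed simp

text \<open>Truncating f in argument and in value leaves a bounded function of bounded support. Such
  a function is an almost everywhere limit of continuous functions under a common bound, and a
  cut-off provides the integrable majorant.\<close>

lemma continuous_dense:
  assumes f: "f \<in> L" and e: "e > 0"
  obtains g where "g \<in> L" "continuous_on UNIV g" "Ip (\<lambda>x. f x - g x) < e"
proof -
  note [measurable] = Lp_memD(1)[OF f]
  define F where "F M x = (if \<bar>x\<bar> \<le> real M \<and> norm (f x) \<le> real M then f x else 0)" for M x
  have [measurable]: "F M \<in> borel_measurable borel" for M unfolding F_def[abs_def] by measurable
  \<comment> \<open>Two errors below d, added by \<open>L_add\<close>, give at most 2^p * (d + d) =
    e / 2.\<close>
  define d where "d = e / (4 * 2 powr p)"
  have d: "d > 0" using e by (simp add: d_def)
  have FL: "F M \<in> L" for M by (rule L_bounded[of _ "real M" "real M"]) (auto simp: F_def)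
  have "(\<lambda>M. Ip (\<lambda>x. f x - F M x)) \<longlonglongrightarrow> (LINT x|\<mu>. 0)"
    unfolding Ip_def
  proof (rule integral_dominated_convergence[where w = "\<lambda>x. norm (f x) powr p"])
    show "AE x in \<mu>. (\<lambda>M. norm (f x - F M x) powr p) \<longlonglongrightarrow> 0"
    proof (rule AE_I2)
      fix x
      obtain N :: nat where N: "max \<bar>x\<bar> (norm (f x)) \<le> real N" using real_arch_simple by blast
      have "\<forall>\<^sub>F M in sequentially. norm (f x - F M x) powr p = 0"
        using eventually_ge_at_top[of N]
      proof eventually_elim
        case (elim M)
        then have "real N \<le> real M" by simp
        then show ?case using N by (auto simp: F_def)
      qed
      then show "(\<lambda>M. norm (f x - F M x) powr p) \<longlonglongrightarrow> 0" by (rule tendsto_eventually)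
    qed
    show "AE x in \<mu>. norm (norm (f x - F M x) powr p) \<le> norm (f x) powr p" for M
      by (rule AE_I2) (auto simp: F_def)
  qed (use Lp_memD(2)[OF f] in auto)
  then have "\<forall>\<^sub>F M in sequentially. Ip (\<lambda>x. f x - F M x) < d" using d by (auto dest: order_tendstoD)
  then obtain M where M: "Ip (\<lambda>x. f x - F M x) < d" by (auto simp: eventually_sequentially)
  have FM: "norm (F M x) \<le> real M" for x by (auto simp: F_def)
  obtain g where g: "\<And>n. continuous_on UNIV (g n)" "\<And>n x. norm (g n x) \<le> real M"
    "AE x in lborel. (\<lambda>n::nat. g n x) \<longlonglongrightarrow> F M x"
    by (rule bounded_borel_AE_limit_continuous[of "F M" "real M"]) (use FM in auto)
  \<comment> \<open>A trapezoidal cut-off: it equals 1 wherever \<open>F M\<close> can be nonzero,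
    so the limit is kept, and it vanishes beyond M + 1, so all \<open>G n\<close> live on one
    bounded interval.\<close>
  define ch where "ch x = max 0 (min 1 (real M + 1 - \<bar>x\<bar>))" for x :: real
  have ch: "0 \<le> ch x" "ch x \<le> 1" "\<bar>x\<bar> \<le> real M \<Longrightarrow> ch x = 1" "\<bar>x\<bar> > real M + 1 \<Longrightarrow> ch x = 0" for x by (auto simp: ch_def)
  have cch: "continuous_on UNIV ch" unfolding ch_def by (auto intro!: continuous_intros)
  have [measurable]: "ch \<in> borel_measurable borel" using cch by (rule borel_measurable_continuous_onI)
  define G where "G n x = ch x *\<^sub>R g n x" for n x
  have cG: "continuous_on UNIV (G n)" for n unfolding G_def using cch g(1) by (intro continuous_intros)
  have [measurable]: "G n \<in> borel_measurable borel" for n using cG by (rule borel_measurable_continuous_onI)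
  have nG: "norm (G n x) \<le> real M" for n x
    using mult_mono[OF ch(2)[of x] g(2)[of n x]] ch(1)[of x] by (simp add: G_def)
  have GL: "G n \<in> L" for n
    by (rule L_bounded[of _ "real M" "real M + 1"]) (use nG ch(4) in \<open>auto simp: G_def\<close>)
  have "(\<lambda>n. Ip (\<lambda>x. F M x - G n x)) \<longlonglongrightarrow> (LINT x|\<mu>. 0)"
    unfolding Ip_def
  proof (rule integral_dominated_convergence[where w = "\<lambda>x. (2 * real M) powr p * indicator {-(real M + 1)..real M + 1} x"])
    show "AE x in \<mu>. (\<lambda>n. norm (F M x - G n x) powr p) \<longlonglongrightarrow> 0"
      using g(3) unfolding AE_mu_iff
    proof eventually_elim
      case (elim x)
      have "ch x *\<^sub>R F M x = F M x" using ch(3)[of x] by (auto simp: F_def)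
      then have "(\<lambda>n. F M x - G n x) \<longlonglongrightarrow> F M x - F M x"
        unfolding G_def using elim tendsto_scaleR[OF tendsto_const[of "ch x"] elim] by (intro tendsto_diff) auto
      then have "(\<lambda>n. norm (F M x - G n x)) \<longlonglongrightarrow> 0" by (simp add: tendsto_norm_zero)
      then show ?case using p tendsto_powr'[of _ 0 _ "\<lambda>_. p" p] by fastforce
    qed
    show "AE x in \<mu>. norm (norm (F M x - G n x) powr p) \<le> (2 * real M) powr p * indicator {-(real M + 1)..real M + 1} x" for n
    proof (rule AE_I2)
      fix x
      show "norm (norm (F M x - G n x) powr p) \<le> (2 * real M) powr p * indicator {-(real M + 1)..real M + 1} x"
      proof (cases "\<bar>x\<bar> \<le> real M + 1")
        case True
        have "norm (F M x - G n x) \<le> 2 * real M" using norm_triangle_ineq4[of "F M x" "G n x"] FM[of x] nG[of n x] by linarith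
        then show ?thesis using True p by (auto simp: indicator_def abs_le_iff intro!: powr_mono2)
      next
        case False
        then show ?thesis using ch(4)[of x] by (auto simp: F_def G_def indicator_def)
      qed
    qed
  qed (use emeasure_mu_compact[of "real M + 1"] in \<open>auto intro!: integrable_mult_right integrable_real_indicator\<close>)
  then have "\<forall>\<^sub>F n in sequentially. Ip (\<lambda>x. F M x - G n x) < d" using d by (auto dest: order_tendstoD)
  then obtain n where n: "Ip (\<lambda>x. F M x - G n x) < d" by (auto simp: eventually_sequentially)
  have "Ip (\<lambda>x. (f x - F M x) + (F M x - G n x)) \<le> 2 powr p * (Ip (\<lambda>x. f x - F M x) + Ip (\<lambda>x. F M x - G n x))"
    by (intro L_add L_diff f FL GL)
  also have "\<dots> \<le> 2 powr p * (d + d)" using M n by (intro mult_left_mono) auto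
  also have "\<dots> < e" using e by (simp add: d_def)
  finally have "Ip (\<lambda>x. f x - G n x) < e" by simp
  with GL cG that show thesis by blast
qed

text \<open>The translation as an explicit kernel operator on all of L^p. It differs from
  \<open>dunkl_translation_cont\<close> at y = 0 only, a null set.\<close>

definition T :: "real \<Rightarrow> (real \<Rightarrow> complex) \<Rightarrow> real \<Rightarrow> complex" where
  "T x f y = (if x = 0 then f y else LINT z|\<mu>. W x y z *\<^sub>R f z)"

lemma T_measurable_pair[measurable (raw)]:
  assumes f: "f \<in> borel_measurable borel" and [measurable]: "a \<in> borel_measurable M" "b \<in> borel_measurable M"
  shows "(\<lambda>t. T (a t) f (b t)) \<in> borel_measurable M"
proof -
  interpret sigma_finite_measure \<mu> by (rule sigma_finite_mu)
  note [measurable] = f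
  have [measurable]: "(\<lambda>t. LINT z|\<mu>. W (a t) (b t) z *\<^sub>R f z) \<in> borel_measurable M" by measurable
  show ?thesis unfolding T_def by measurable
qed

lemma nn_W_Ip:
  assumes x: "x \<noteq> 0" and g[measurable]: "g \<in> borel_measurable borel"
  shows "(\<integral>\<^sup>+y. \<integral>\<^sup>+z. ennreal \<bar>W x y z\<bar> * g z \<partial>\<mu> \<partial>\<mu>) \<le> 4 * (\<integral>\<^sup>+z. g z \<partial>\<mu>)"
proof -
  interpret sigma_finite_measure \<mu> by (rule sigma_finite_mu)
  interpret PP: pair_sigma_finite \<mu> \<mu> ..
  have "(\<integral>\<^sup>+y. \<integral>\<^sup>+z. ennreal \<bar>W x y z\<bar> * g z \<partial>\<mu> \<partial>\<mu>) = (\<integral>\<^sup>+z. \<integral>\<^sup>+y. ennreal \<bar>W x y z\<bar> * g z \<partial>\<mu> \<partial>\<mu>)"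
    by (rule PP.Fubini') measurable
  also have "\<dots> \<le> (\<integral>\<^sup>+z. 4 * g z \<partial>\<mu>)"
  proof (rule nn_integral_mono_AE)
    show "AE z in \<mu>. (\<integral>\<^sup>+y. ennreal \<bar>W x y z\<bar> * g z \<partial>\<mu>) \<le> 4 * g z"
      using AE_mu_nonzero
    proof eventually_elim
      case (elim z)
      have "(\<integral>\<^sup>+y. ennreal \<bar>W x y z\<bar> * g z \<partial>\<mu>) = (\<integral>\<^sup>+y. ennreal \<bar>W x y z\<bar> \<partial>\<mu>) * g z"
        by (rule nn_integral_multc) measurable
      also have "\<dots> \<le> 4 * g z" using W_bound'[OF x elim] by (rule mult_right_mono) simp
      finally show ?case .
    qed
  qed
  also have "\<dots> = 4 * (\<integral>\<^sup>+z. g z \<partial>\<mu>)" by (rule nn_integral_cmult) measurable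
  finally show ?thesis .
qed

text \<open>Schur's test with row and column bounds 4: the p-th powers gain 4^(p - 1) * 4 =
  4^p.\<close>

lemma T_L:
  assumes f: "f \<in> L"
  shows "T x f \<in> L" and "Ip (T x f) \<le> 4 powr p * Ip f"
    and "x \<noteq> 0 \<Longrightarrow> AE y in \<mu>. integrable \<mu> (\<lambda>z. W x y z *\<^sub>R f z)"
proof -
  note [measurable] = Lp_memD(1)[OF f]
  have main: "T x f \<in> L \<and> Ip (T x f) \<le> 4 powr p * Ip f \<and> (AE y in \<mu>. integrable \<mu> (\<lambda>z. W x y z *\<^sub>R f z))" if x: "x \<noteq> 0"
  proof -
    have A: "AE y in \<mu>. (\<integral>\<^sup>+z. ennreal \<bar>W x y z\<bar> \<partial>\<mu>) \<le> ennreal 4"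
      using AE_mu_nonzero by eventually_elim (use W_bound[OF x] in simp)
    have "(\<integral>\<^sup>+y. \<integral>\<^sup>+z. ennreal (\<bar>W x y z\<bar> * norm (f z) powr p) \<partial>\<mu> \<partial>\<mu>)
       = (\<integral>\<^sup>+y. \<integral>\<^sup>+z. ennreal \<bar>W x y z\<bar> * ennreal (norm (f z) powr p) \<partial>\<mu> \<partial>\<mu>)"
      by (simp add: ennreal_mult)
    also have "\<dots> \<le> 4 * (\<integral>\<^sup>+z. ennreal (norm (f z) powr p) \<partial>\<mu>)"
      by (rule nn_W_Ip[OF x]) measurable
    also have "\<dots> = ennreal (4 * Ip f)"
      unfolding Ip_def by (subst nn_integral_eq_integral[OF Lp_memD(2)[OF f]]) (auto simp: ennreal_mult)
    finally have B: "(\<integral>\<^sup>+y. \<integral>\<^sup>+z. ennreal (\<bar>W x y z\<bar> * norm (f z) powr p) \<partial>\<mu> \<partial>\<mu>) \<le> ennreal (4 * Ip f)" .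
    have mK: "(\<lambda>(y,z). W x y z) \<in> borel_measurable (\<mu> \<Otimes>\<^sub>M \<mu>)" by measurable
    have mh: "(\<lambda>(y,z). f z) \<in> borel_measurable (\<mu> \<Otimes>\<^sub>M \<mu>)" by measurable
    have B0: "0 \<le> 4 * Ip f" and A0: "(0::real) \<le> 4" by simp_all
    note S = schur_kernel[OF p sigma_finite_mu mK mh A0 A B0 B]
    have Tx: "T x f = (\<lambda>y. LINT z|\<mu>. W x y z *\<^sub>R f z)" using x by (simp add: T_def fun_eq_iff)
    have "4 powr (p - 1) * (4 * Ip f) = 4 powr p * Ip f" by (simp add: powr_diff)
    with S(4) have "Ip (\<lambda>y. LINT z|\<mu>. W x y z *\<^sub>R f z) \<le> 4 powr p * Ip f" by (simp only: Ip_def)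
    with S(1-3) show ?thesis unfolding Tx by (auto intro!: Lp_memI simp: Ip_def)
  qed
  have "1 \<le> 4 powr p" using powr_mono[of 0 p "4::real"] p by simp
  then have "1 * Ip f \<le> 4 powr p * Ip f" by (intro mult_right_mono) auto
  then show "T x f \<in> L" "Ip (T x f) \<le> 4 powr p * Ip f" using main f by (cases "x = 0"; simp add: T_def[abs_def])+
  show "x \<noteq> 0 \<Longrightarrow> AE y in \<mu>. integrable \<mu> (\<lambda>z. W x y z *\<^sub>R f z)" using main by blast
qed

lemma T_norm: "f \<in> L \<Longrightarrow> Lp_norm \<alpha> p (T x f) \<le> 4 * Lp_norm \<alpha> p f"
  by (rule Lp_norm_le) (use T_L in auto)

lemma T_add:
  assumes f: "f \<in> L" and g: "g \<in> L"
  shows "AE y in \<mu>. T x (\<lambda>z. f z + g z) y = T x f y + T x g y"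
proof (cases "x = 0")
  case False
  show ?thesis using T_L(3)[OF f False] T_L(3)[OF g False]
    by eventually_elim (simp add: T_def False scaleR_add_right)
qed (simp add: T_def)

lemma T_cmult: "T x (\<lambda>z. c * f z) y = c * T x f y"
proof -
  have "W x y z *\<^sub>R (c * f z) = c * (W x y z *\<^sub>R f z)" for z by simp
  then have "(LINT z|\<mu>. W x y z *\<^sub>R (c * f z)) = c * (LINT z|\<mu>. W x y z *\<^sub>R f z)"
    by (simp only: integral_mult_right_zero)
  then show ?thesis by (simp only: T_def split: if_split) auto
qed

lemma T_cong_AE:
  assumes "f \<in> borel_measurable borel" "g \<in> borel_measurable borel" "AE z in \<mu>. f z = g z"
  shows "AE y in \<mu>. T x f y = T x g y"
proof (cases "x = 0")
  case False
  note [measurable] = assms(1,2)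
  have "(LINT z|\<mu>. W x y z *\<^sub>R f z) = (LINT z|\<mu>. W x y z *\<^sub>R g z)" for y
    by (rule integral_cong_AE) (use assms(3) in auto)
  then show ?thesis by (simp add: T_def False)
qed (use assms(3) in \<open>simp add: T_def\<close>)

text \<open>\<open>T x\<close> has the defining property, so the choice operator yields some S that
  has it as well. S and \<open>T x\<close> agree on the continuous functions in L^p, both are
  additive and bounded, and these functions are dense; hence they agree almost everywhere on every
  f.\<close>

lemma dunkl_translation_AE:
  assumes f: "f \<in> L"
  shows "AE y in \<mu>. dunkl_translation \<alpha> p x f y = T x f y"
    and "dunkl_translation \<alpha> p x f \<in> L"
proof -
  define P where "P S \<longleftrightarrow> Lp_bounded_operator \<alpha> p S \<and>
     (\<forall>f\<in>L. continuous_on UNIV f \<longrightarrow> (AE y in \<mu>. S f y = dunkl_translation_cont \<alpha> x f y))" for S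
  have PT: "P (T x)"
    unfolding P_def Lp_bounded_operator_def
  proof (intro conjI ballI allI impI)
    fix g assume "g \<in> L" "continuous_on UNIV g"
    show "AE y in \<mu>. T x g y = dunkl_translation_cont \<alpha> x g y"
      using AE_mu_nonzero by eventually_elim (simp add: T_def dunkl_translation_cont_def)
  next
    show "\<exists>C. \<forall>f\<in>L. Lp_norm \<alpha> p (T x f) \<le> C * Lp_norm \<alpha> p f" using T_norm by blast
  qed (use T_L T_add in \<open>auto simp: T_cmult\<close>)
  have "dunkl_translation \<alpha> p x = (SOME S. P S)" by (simp only: dunkl_translation_def P_def)
  then have "P (dunkl_translation \<alpha> p x)" using someI[of P, OF PT] by simp
  then obtain S where S: "S = dunkl_translation \<alpha> p x" and PS: "P S" by blast
  have SL: "\<And>g. g \<in> L \<Longrightarrow> S g \<in> L" and Sadd: "\<And>g h. g \<in> L \<Longrightarrow> h \<in> L \<Longrightarrow> AE y in \<mu>. S (\<lambda>z. g z + h z) y = S g y + S h y"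
    and Scont: "\<And>g. g \<in> L \<Longrightarrow> continuous_on UNIV g \<Longrightarrow> AE y in \<mu>. S g y = dunkl_translation_cont \<alpha> x g y"
    using PS by (auto simp: P_def Lp_bounded_operator_def)
  have "\<exists>C. \<forall>g\<in>L. Lp_norm \<alpha> p (S g) \<le> C * Lp_norm \<alpha> p g"
    using PS by (simp add: P_def Lp_bounded_operator_def)
  then obtain C where "\<forall>g\<in>L. Lp_norm \<alpha> p (S g) \<le> C * Lp_norm \<alpha> p g" ..
  then have C: "\<And>g. g \<in> L \<Longrightarrow> Lp_norm \<alpha> p (S g) \<le> C * Lp_norm \<alpha> p g" by blast
  \<comment> \<open>The constant of a bounded operator carries no sign condition, hence |C|.\<close>
  have SC: "Ip (S g) \<le> \<bar>C\<bar> powr p * Ip g" if g: "g \<in> L" for g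
  proof -
    have "Lp_norm \<alpha> p (S g) \<le> \<bar>C\<bar> * Lp_norm \<alpha> p g"
      using C[OF g] by (rule order_trans) (auto intro!: mult_right_mono)
    then have "Lp_norm \<alpha> p (S g) powr p \<le> (\<bar>C\<bar> * Lp_norm \<alpha> p g) powr p" using p by (intro powr_mono2) auto
    then show ?thesis by (simp add: Ip_eq powr_mult)
  qed
  define D where "D = 2 powr p * (\<bar>C\<bar> powr p + 4 powr p)"
  have D: "D > 0" unfolding D_def by (intro mult_pos_pos add_nonneg_pos) auto
  have small: "Ip (\<lambda>y. S f y - T x f y) \<le> e" if e: "e > 0" for e
  proof -
    obtain g where g: "g \<in> L" "continuous_on UNIV g" "Ip (\<lambda>x. f x - g x) < e / D"
      using continuous_dense[OF f, of "e / D"] e D by auto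
    define r where "r z = f z - g z" for z
    have r: "r \<in> L" unfolding r_def using f g by (intro L_diff)
    have fr: "f = (\<lambda>z. r z + g z)" by (simp add: r_def)
    have "AE y in \<mu>. S f y - T x f y = S r y - T x r y"
      using Sadd[OF r g(1)] T_add[OF r g(1), of x] Scont[OF g(1,2)] AE_mu_nonzero
      unfolding fr[symmetric]
      by eventually_elim (simp add: T_def dunkl_translation_cont_def)
    then have "Ip (\<lambda>y. S f y - T x f y) = Ip (\<lambda>y. S r y - T x r y)"
      using f r by (intro Ip_cong_AE Lp_memD L_diff SL T_L)
    also have "\<dots> \<le> 2 powr p * (Ip (S r) + Ip (T x r))" using r by (intro L_diff SL T_L)
    also have "\<dots> \<le> 2 powr p * (\<bar>C\<bar> powr p * Ip r + 4 powr p * Ip r)"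
      using SC[OF r] T_L(2)[OF r, of x] by (intro mult_left_mono add_mono) auto
    also have "\<dots> = D * Ip r" by (simp add: D_def algebra_simps)
    also have "\<dots> \<le> e" using g(3) D unfolding r_def[symmetric] by (simp add: field_simps)
    finally show ?thesis .
  qed
  have "Ip (\<lambda>y. S f y - T x f y) \<le> 0" by (rule field_le_epsilon) (use small in auto)
  then have "(LINT y|\<mu>. norm (S f y - T x f y) powr p) = 0"
    using Ip_nonneg[of "\<lambda>y. S f y - T x f y"] unfolding Ip_def by linarith
  moreover have "integrable \<mu> (\<lambda>y. norm (S f y - T x f y) powr p)"
    using f by (intro Lp_memD L_diff SL T_L)
  ultimately have "AE y in \<mu>. norm (S f y - T x f y) powr p = 0"
    by (subst (asm) integral_nonneg_eq_0_iff_AE) auto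
  then show "AE y in \<mu>. dunkl_translation \<alpha> p x f y = T x f y" unfolding S[symmetric] by eventually_elim auto
  show "dunkl_translation \<alpha> p x f \<in> L" unfolding S[symmetric] by (rule SL[OF f])
qed

end

section \<open>Calculus of the Dunkl operator\<close>

lemma norm_diff_le_derivative:
  fixes f :: "real \<Rightarrow> 'a::real_inner"
  assumes d: "\<And>x. (f has_vector_derivative f' x) (at x)" and B: "\<And>x. \<bar>x\<bar> \<le> r \<Longrightarrow> norm (f' x) \<le> B" and z: "\<bar>z\<bar> \<le> r"
  shows "norm (f z - f (- z)) \<le> 2 * B * \<bar>z\<bar>"
proof -
  have pos: "norm (f z - f (- z)) \<le> 2 * B * \<bar>z\<bar>" if z: "\<bar>z\<bar> \<le> r" "z > 0" for z
  proof -
    have "\<exists>x\<in>{-z<..<z}. norm (f z - f (- z)) \<le> norm ((z - (- z)) *\<^sub>R f' x)"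
    proof (rule mvt_general)
      show "continuous_on {-z..z} f" using d by (auto intro!: continuous_at_imp_continuous_on has_vector_derivative_continuous)
    qed (use d z in \<open>auto simp: has_vector_derivative_def\<close>)
    then obtain x where x: "x \<in> {-z<..<z}" "norm (f z - f (- z)) \<le> norm ((z - (- z)) *\<^sub>R f' x)" by blast
    then have "norm (f' x) \<le> B" using z by (intro B) auto
    have "norm (f z - f (- z)) \<le> 2 * z * norm (f' x)" using x z by simp
    also have "\<dots> \<le> 2 * z * B" using z \<open>norm (f' x) \<le> B\<close> by (intro mult_left_mono) auto
    finally show ?thesis using z by (simp add: mult_ac)
  qed
  show ?thesis
  proof (cases "z = 0")
    case False
    then show ?thesis using pos[of z] pos[of "-z"] z by (cases "z > 0") (auto simp: norm_minus_commute)
  qed simp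
qed

lemma continuous_on_bounded_interval:
  fixes f :: "real \<Rightarrow> 'a::real_normed_vector"
  assumes "continuous_on UNIV f"
  obtains B where "B \<ge> 0" "\<And>x. \<bar>x\<bar> \<le> r \<Longrightarrow> norm (f x) \<le> B"
proof -
  have "compact (f ` {-r..r})" by (intro compact_continuous_image continuous_on_subset[OF assms]) auto
  then obtain B where B: "\<And>x. x \<in> f ` {-r..r} \<Longrightarrow> norm x \<le> B" using compact_imp_bounded bounded_iff by metis
  show thesis by (rule that[of "max 0 B"]) (use B in \<open>force simp: abs_le_iff le_max_iff_disj\<close>)+
qed

lemma has_real_derivative_scaled_powr:
  fixes k c d s :: real
  assumes "s > 0" "d > 0" "c \<noteq> 0"
  shows "((\<lambda>x. (x / d) powr k / c) has_real_derivative k / s * ((s / d) powr k / c)) (at s)"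
  using assms by (auto intro!: derivative_eq_intros simp: powr_diff field_simps)

context dunkl begin

text \<open>The Dunkl operator with the derivative supplied as a separate argument. It is stated
  over a general field, as it is applied to real profiles and to complex test functions.\<close>

definition dunkl_deriv :: "(real \<Rightarrow> 'a::real_normed_field) \<Rightarrow> (real \<Rightarrow> 'a) \<Rightarrow> real \<Rightarrow> 'a" where
  "dunkl_deriv f f' z = f' z + (\<kappa> / z) *\<^sub>R ((f z - f (- z)) / 2)"

lemma dunkl_op_eq: "(f has_vector_derivative f' z) (at z) \<Longrightarrow> dunkl_op \<alpha> f z = dunkl_deriv f f' z"
  by (simp add: dunkl_op_def dunkl_deriv_def vector_derivative_at)

lemma dunkl_deriv_of_real: "dunkl_deriv (\<lambda>x. of_real (f x)) (\<lambda>x. of_real (f' x)) z = (of_real (dunkl_deriv f f' z) :: complex)"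
  by (simp add: dunkl_deriv_def scaleR_conv_of_real)

lemma dunkl_deriv_measurable[measurable (raw)]:
  fixes f f' :: "real \<Rightarrow> 'a::{real_normed_field, second_countable_topology}"
  assumes [measurable]: "f \<in> borel_measurable borel" "f' \<in> borel_measurable borel" "h \<in> borel_measurable M"
  shows "(\<lambda>t. dunkl_deriv f f' (h t)) \<in> borel_measurable M"
  unfolding dunkl_deriv_def by measurable

text \<open>The mean value inequality between -z and z bounds the difference quotient by the
  derivative, so the factor 1 / z produces no singularity at the origin.\<close>

lemma dunkl_deriv_bound:
  fixes f f' :: "real \<Rightarrow> 'a::{real_normed_field,real_inner}"
  assumes d: "\<And>x. (f has_vector_derivative f' x) (at x)" and B: "\<And>x. \<bar>x\<bar> \<le> r \<Longrightarrow> norm (f' x) \<le> B" and z: "\<bar>z\<bar> \<le> r"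
  shows "norm (dunkl_deriv f f' z) \<le> (1 + \<kappa>) * B"
proof -
  have "norm ((\<kappa> / z) *\<^sub>R ((f z - f (- z)) / 2)) \<le> \<kappa> * B"
  proof (cases "z = 0")
    case True
    have "0 \<le> B" using B[OF z] norm_ge_zero order_trans by blast
    then show ?thesis using True \<kappa>_pos by simp
  next
    case False
    have "norm ((\<kappa> / z) *\<^sub>R ((f z - f (- z)) / 2)) = \<kappa> / \<bar>z\<bar> * (norm (f z - f (- z)) / 2)"
      using \<kappa>_pos by (simp add: norm_divide)
    also have "\<dots> \<le> \<kappa> / \<bar>z\<bar> * ((2 * B * \<bar>z\<bar>) / 2)"
      using \<kappa>_pos norm_diff_le_derivative[OF d B z] by (intro mult_left_mono divide_right_mono) auto
    also have "\<dots> = \<kappa> * B" using False by simp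
    finally show ?thesis .
  qed
  moreover have "norm (f' z) \<le> B" by (rule B[OF z])
  ultimately show ?thesis unfolding dunkl_deriv_def
    using norm_triangle_ineq[of "f' z" "(\<kappa> / z) *\<^sub>R ((f z - f (- z)) / 2)"] by (simp add: algebra_simps)
qed

lemma has_vd_continuous: "(\<And>x. (f has_vector_derivative f' x) (at x)) \<Longrightarrow> continuous_on UNIV f"
  by (meson continuous_at_imp_continuous_on has_vector_derivative_continuous)

lemma dens_has_derivative:
  assumes "s > 0" 
  shows "(dens has_real_derivative \<kappa> / s * dens s) (at s)"
proof -
  have "((\<lambda>x. x powr \<kappa> / (2 powr (\<alpha> + 1) * Gamma (\<alpha> + 1))) has_real_derivative \<kappa> / s * dens s) (at s)"
    using has_real_derivative_scaled_powr[OF assms zero_less_one, of "2 powr (\<alpha> + 1) * Gamma (\<alpha> + 1)" \<kappa>] assms Gamma_pos'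
    by (simp add: dens_def)
  moreover have "eventually (\<lambda>x. x powr \<kappa> / (2 powr (\<alpha> + 1) * Gamma (\<alpha> + 1)) = dens x) (nhds s)"
    by (rule eventually_mono[OF eventually_nhds_in_open[of "{0<..}" s]]) (use assms in \<open>auto simp: dens_def\<close>)
  ultimately show ?thesis by (subst (asm) DERIV_cong_ev[OF refl _ refl]) auto
qed

lemma dens_continuous: "continuous_on UNIV dens"
proof -
  have "2 powr (\<alpha> + 1) * Gamma (\<alpha> + 1) \<noteq> 0" using Gamma_pos' by simp
  then show ?thesis unfolding dens_def using \<kappa>_pos by (intro continuous_intros continuous_on_powr') auto
qed

text \<open>Upon adding the integrands at y and -y, the mixed terms f(y) g(-y) and f(-y) g(y)
  cancel. What remains depends on the product f g alone and, multiplied by the density, is an exact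
  derivative on the half-line.\<close>

lemma dunkl_deriv_antisymmetric:
  fixes f f' g g' :: "real \<Rightarrow> complex"
  assumes df: "\<And>x. (f has_vector_derivative f' x) (at x)" and cf': "continuous_on UNIV f'"
    and dg: "\<And>x. (g has_vector_derivative g' x) (at x)" and cg': "continuous_on UNIV g'"
    and R: "\<And>x. \<bar>x\<bar> > R \<Longrightarrow> g x = 0" "\<And>x. \<bar>x\<bar> > R \<Longrightarrow> g' x = 0"
  shows "(LINT y|\<mu>. f y * dunkl_deriv g g' y) = - (LINT y|\<mu>. dunkl_deriv f f' y * g y)"
    and "integrable \<mu> (\<lambda>y. f y * dunkl_deriv g g' y)" and "integrable \<mu> (\<lambda>y. dunkl_deriv f f' y * g y)"
proof -
  note cf = has_vd_continuous[OF df] and cg = has_vd_continuous[OF dg]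
  have [measurable]: "f \<in> borel_measurable borel" "f' \<in> borel_measurable borel" "g \<in> borel_measurable borel" "g' \<in> borel_measurable borel"
    using cf cf' cg cg' by (auto intro: borel_measurable_continuous_onI)
  define r where "r = \<bar>R\<bar> + 1"
  have r: "r > 0" "r > R" by (auto simp: r_def)
  obtain Bf where Bf: "Bf \<ge> 0" "\<And>x. \<bar>x\<bar> \<le> r \<Longrightarrow> norm (f x) \<le> Bf" by (rule continuous_on_bounded_interval[OF cf, of r]) blast
  obtain Bf' where Bf': "Bf' \<ge> 0" "\<And>x. \<bar>x\<bar> \<le> r \<Longrightarrow> norm (f' x) \<le> Bf'" by (rule continuous_on_bounded_interval[OF cf', of r]) blast
  obtain Bg where Bg: "Bg \<ge> 0" "\<And>x. \<bar>x\<bar> \<le> r \<Longrightarrow> norm (g x) \<le> Bg" by (rule continuous_on_bounded_interval[OF cg, of r]) blast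
  obtain Bg' where Bg': "Bg' \<ge> 0" "\<And>x. \<bar>x\<bar> \<le> r \<Longrightarrow> norm (g' x) \<le> Bg'" by (rule continuous_on_bounded_interval[OF cg', of r]) blast
  have dop0: "dunkl_deriv g g' x = 0" if "\<bar>x\<bar> > r" for x using that r R by (simp add: dunkl_deriv_def)
  show i1: "integrable \<mu> (\<lambda>y. f y * dunkl_deriv g g' y)"
  proof (rule integrable_mu_bounded[of _ "Bf * ((1 + \<kappa>) * Bg')" r])
    show "norm (f y * dunkl_deriv g g' y) \<le> Bf * ((1 + \<kappa>) * Bg')" for y
    proof (cases "\<bar>y\<bar> > r")
      case True then show ?thesis using dop0 Bf Bg' \<kappa>_pos by simp
    next
      case False
      then show ?thesis using Bf Bg' dunkl_deriv_bound[OF dg, of r Bg' y] by (auto simp: norm_mult intro!: mult_mono)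
    qed
  qed (use dop0 in auto)
  show i2: "integrable \<mu> (\<lambda>y. dunkl_deriv f f' y * g y)"
  proof (rule integrable_mu_bounded[of _ "((1 + \<kappa>) * Bf') * Bg" r])
    show "norm (dunkl_deriv f f' y * g y) \<le> ((1 + \<kappa>) * Bf') * Bg" for y
    proof (cases "\<bar>y\<bar> > r")
      case True then show ?thesis using R r Bf' Bg \<kappa>_pos by simp
    next
      case False
      then show ?thesis using Bf' Bg \<kappa>_pos dunkl_deriv_bound[OF df, of r Bf' y] by (auto simp: norm_mult intro!: mult_mono)
    qed
  qed (use R r in auto)
  define I where "I y = f y * dunkl_deriv g g' y + dunkl_deriv f f' y * g y" for y
  have [measurable]: "I \<in> borel_measurable borel" unfolding I_def by measurable
  have iI: "integrable \<mu> I" unfolding I_def using i1 i2 by auto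
  have iI': "integrable lborel (\<lambda>y. dens y *\<^sub>R I y)" using iI by (subst (asm) integrable_mu) auto
  define F where "F y = f y * g y" for y
  define F' where "F' y = f y * g' y + f' y * g y" for y
  have dF: "(F has_vector_derivative F' y) (at y)" for y
    unfolding F_def F'_def by (rule has_vector_derivative_mult[OF df dg])
  have dFm: "((\<lambda>y. F (- y)) has_vector_derivative - F' (- y)) (at y)" for y
  proof -
    have "((F \<circ> uminus) has_vector_derivative (-1) *\<^sub>R F' (- y)) (at y)"
      by (rule vector_diff_chain_at) (auto intro!: derivative_eq_intros dF)
    then show ?thesis by (simp add: o_def)
  qed
  \<comment> \<open>The primitive of the folded integrand. It vanishes at 0, where the difference is
    zero, and at r, which lies beyond the support of g.\<close>
  define H where "H y = dens y *\<^sub>R (F y - F (- y))" for y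
  define h where "h y = indicator {0<..} y *\<^sub>R (dens y *\<^sub>R I y + dens (- y) *\<^sub>R I (- y))" for y
  have ih: "integrable lborel h" unfolding h_def using lborel_fold(1)[OF iI'] .
  have "(h has_integral (H r - H 0)) {0..r}"
  proof (rule fundamental_theorem_of_calculus_interior)
    show "continuous_on {0..r} H" unfolding H_def
      using has_vd_continuous[OF dF] has_vd_continuous[OF dFm]
      by (auto intro!: continuous_intros continuous_on_subset[OF dens_continuous] elim!: continuous_on_subset)
    fix y assume y: "y \<in> {0<..<r}"
    have "(H has_vector_derivative dens y *\<^sub>R (F' y + F' (- y)) + (\<kappa> / y * dens y) *\<^sub>R (F y - F (- y))) (at y)"
      unfolding H_def
    proof (rule has_vector_derivative_scaleR)
      show "(dens has_real_derivative \<kappa> / y * dens y) (at y)" using y by (intro dens_has_derivative) auto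
      show "((\<lambda>y. F y - F (- y)) has_vector_derivative F' y + F' (- y)) (at y)"
        using has_vector_derivative_diff[OF dF dFm, of y] by simp
    qed
    moreover have "I y + I (- y) = (F' y + F' (- y)) + (\<kappa> / y) *\<^sub>R (F y - F (- y))"
      using y by (simp add: I_def F_def F'_def dunkl_deriv_def scaleR_conv_of_real field_simps)
    then have "h y = dens y *\<^sub>R (F' y + F' (- y)) + (\<kappa> / y * dens y) *\<^sub>R (F y - F (- y))"
      using y by (simp add: h_def scaleR_add_right[symmetric]) (simp add: scaleR_add_right mult_ac)
    ultimately show "(H has_vector_derivative h y) (at y)" by simp
  qed (use r in simp)
  moreover have "H r - H 0 = 0" using R r by (simp add: H_def F_def)
  moreover have "h x = 0" if "x \<notin> {0..r}" for x
  proof (cases "x \<le> 0")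
    case True then show ?thesis by (simp add: h_def)
  next
    case False
    then have "\<bar>x\<bar> > r" using that by auto
    then show ?thesis using R r dop0[of x] dop0[of "-x"] by (simp add: h_def I_def)
  qed
  ultimately have "(LINT y|lborel. h y) = 0"
    using has_integral_zero_outside_unique[OF ih, of 0 0 r] by simp
  then have "(LINT y|\<mu>. I y) = 0"
    using lborel_fold(2)[OF iI'] by (subst integral_mu) (auto simp: h_def)
  then show "(LINT y|\<mu>. f y * dunkl_deriv g g' y) = - (LINT y|\<mu>. dunkl_deriv f f' y * g y)"
    unfolding I_def using i1 i2 by (simp add: eq_neg_iff_add_eq_0)
qed

(* Write u_e, u_o for the even and odd parts of u and kappa = 2 alpha + 1. The odd part of Lambda u is
   u_e', and its even part is s^(-kappa) (s^kappa u_o)'; integrating both from 0 gives this kernel. *)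
definition taylor_kernel :: "real \<Rightarrow> real \<Rightarrow> real" where
  "taylor_kernel t s = indicator {-\<bar>t\<bar>..\<bar>t\<bar>} s * ((sgn s + sgn t * (\<bar>s\<bar> / \<bar>t\<bar>) powr \<kappa>) / 2)"

lemma taylor_kernel_measurable[measurable]: "taylor_kernel t \<in> borel_measurable borel" unfolding taylor_kernel_def[abs_def] sgn_real_def by measurable

lemma taylor_kernel_bound: "\<bar>taylor_kernel t s\<bar> \<le> indicator {-\<bar>t\<bar>..\<bar>t\<bar>} s"
proof (cases "s \<in> {-\<bar>t\<bar>..\<bar>t\<bar>}")
  case True
  then have "\<bar>s\<bar> / \<bar>t\<bar> \<le> 1" by (auto simp: divide_le_eq)
  then have "(\<bar>s\<bar> / \<bar>t\<bar>) powr \<kappa> \<le> 1" using \<kappa>_pos powr_mono2[of \<kappa> "\<bar>s\<bar> / \<bar>t\<bar>" 1] by simp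
  then have "\<bar>sgn s + sgn t * a\<bar> \<le> 2" if "a = (\<bar>s\<bar> / \<bar>t\<bar>) powr \<kappa>" for a
    using powr_ge_zero[of "\<bar>s\<bar> / \<bar>t\<bar>" \<kappa>] unfolding that[symmetric] by (auto simp: sgn_real_def)
  then show ?thesis using True by (simp add: taylor_kernel_def)
qed (simp add: taylor_kernel_def)

lemma nn_integral_taylor_kernel: "(\<integral>\<^sup>+s. ennreal \<bar>taylor_kernel t s\<bar> \<partial>lborel) \<le> ennreal (2 * \<bar>t\<bar>)"
proof -
  have "(\<integral>\<^sup>+s. ennreal \<bar>taylor_kernel t s\<bar> \<partial>lborel) \<le> (\<integral>\<^sup>+s. indicator {-\<bar>t\<bar>..\<bar>t\<bar>} s \<partial>lborel)"
    by (intro nn_integral_mono order_trans[OF ennreal_leI[OF taylor_kernel_bound]]) (simp add: ennreal_indicator)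
  also have "\<dots> = ennreal (2 * \<bar>t\<bar>)" by (simp add: emeasure_lborel_Icc_eq)
  finally show ?thesis .
qed

lemma dunkl_taylor:
  fixes u u' :: "real \<Rightarrow> real"
  assumes du: "\<And>x. (u has_real_derivative u' x) (at x)" and cu': "continuous_on UNIV u'" and t: "t \<noteq> 0"
  shows "u t - u 0 = (LINT s|lborel. taylor_kernel t s * dunkl_deriv u u' s)"
proof -
  have vu: "(u has_vector_derivative u' x) (at x)" for x using du by (simp add: has_real_derivative_iff_has_vector_derivative)
  have cu: "continuous_on UNIV u" by (rule has_vd_continuous[OF vu])
  have [measurable]: "u \<in> borel_measurable borel" "u' \<in> borel_measurable borel"
    using cu cu' by (auto intro: borel_measurable_continuous_onI)
  obtain B where B: "B \<ge> 0" "\<And>x. \<bar>x\<bar> \<le> \<bar>t\<bar> \<Longrightarrow> norm (u' x) \<le> B" by (rule continuous_on_bounded_interval[OF cu', of "\<bar>t\<bar>"]) blast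
  define w where "w s = taylor_kernel t s * dunkl_deriv u u' s" for s
  have iw: "integrable lborel w"
  proof (rule Bochner_Integration.integrable_bound)
    show "integrable lborel (\<lambda>s. (1 + \<kappa>) * B * indicator {-\<bar>t\<bar>..\<bar>t\<bar>} s)"
      by (intro integrable_mult_right integrable_real_indicator) (auto simp: emeasure_lborel_Icc_eq)
    show "AE s in lborel. norm (w s) \<le> norm ((1 + \<kappa>) * B * indicator {-\<bar>t\<bar>..\<bar>t\<bar>} s :: real)"
    proof (rule AE_I2)
      fix s
      show "norm (w s) \<le> norm ((1 + \<kappa>) * B * indicator {-\<bar>t\<bar>..\<bar>t\<bar>} s :: real)"
      proof (cases "\<bar>s\<bar> \<le> \<bar>t\<bar>")
        case True
        then have s: "s \<in> {-\<bar>t\<bar>..\<bar>t\<bar>}" by auto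
        have "\<bar>taylor_kernel t s\<bar> * \<bar>dunkl_deriv u u' s\<bar> \<le> 1 * ((1 + \<kappa>) * B)"
          using taylor_kernel_bound[of t s] dunkl_deriv_bound[OF vu B(2) True] s by (intro mult_mono) auto
        then show ?thesis using s B \<kappa>_pos by (simp add: w_def abs_mult)
      next
        case False
        then have "s \<notin> {-\<bar>t\<bar>..\<bar>t\<bar>}" by auto
        then show ?thesis by (simp add: w_def taylor_kernel_def)
      qed
    qed
  qed (simp add: w_def[abs_def])
  define c where "c s = (s / \<bar>t\<bar>) powr \<kappa>" for s
  \<comment> \<open>With even part u_e and odd part u_o of u this is u_e(s) + sgn(t) * (s /
    |t|)^\<open>\<kappa>\<close> * u_o(s). At s = |t| it equals u(t) for either sign of t, at s = 0
    it equals u(0), and its derivative is the folded integrand.\<close>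
  define H where "H s = (u s + u (- s)) / 2 + sgn t * (c s * ((u s - u (- s)) / 2))" for s
  define h where "h s = indicator {0<..} s *\<^sub>R (w s + w (- s))" for s
  have ih: "integrable lborel h" unfolding h_def using lborel_fold(1)[OF iw] .
  have dum: "((\<lambda>s. u (- s)) has_real_derivative - u' (- s)) (at s)" for s
    by (rule DERIV_cong[OF DERIV_chain2[OF du DERIV_minus[OF DERIV_ident]]]) simp
  have "(h has_integral (H \<bar>t\<bar> - H 0)) {0..\<bar>t\<bar>}"
  proof (rule fundamental_theorem_of_calculus_interior)
    have "continuous_on UNIV (\<lambda>s. u (- s))" using dum by (meson DERIV_continuous_on DERIV_subset subset_UNIV)
    then show "continuous_on {0..\<bar>t\<bar>} H" unfolding H_def c_def using cu \<kappa>_pos t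
      by (auto intro!: continuous_intros continuous_on_powr' elim!: continuous_on_subset)
    fix s assume s: "s \<in> {0<..<\<bar>t\<bar>}"
    have dc: "(c has_real_derivative \<kappa> / s * c s) (at s)"
      unfolding c_def[abs_def] using has_real_derivative_scaled_powr[of s "\<bar>t\<bar>" 1 \<kappa>] s t by simp
    have "(H has_real_derivative (u' s - u' (- s)) / 2 + sgn t * (\<kappa> / s * c s * ((u s - u (- s)) / 2) + c s * ((u' s + u' (- s)) / 2))) (at s)"
      unfolding H_def[abs_def]
      by (rule DERIV_cong, rule DERIV_add[OF DERIV_cdivide[OF DERIV_add[OF du dum]]
            DERIV_cmult[OF DERIV_mult[OF dc DERIV_cdivide[OF DERIV_diff[OF du dum]]]]]) (simp add: mult_ac)
    moreover have "(u' s - u' (- s)) / 2 + sgn t * (\<kappa> / s * c s * ((u s - u (- s)) / 2) + c s * ((u' s + u' (- s)) / 2)) = h s"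
    proof -
      have tks: "taylor_kernel t s = (1 + sgn t * c s) / 2" "taylor_kernel t (- s) = (- 1 + sgn t * c s) / 2"
        using s by (simp_all add: taylor_kernel_def c_def indicator_def)
      have "h s = (1 + sgn t * c s) / 2 * dunkl_deriv u u' s + (- 1 + sgn t * c s) / 2 * dunkl_deriv u u' (- s)"
        using s by (simp add: h_def w_def tks)
      then show ?thesis using s by (simp add: dunkl_deriv_def field_simps)
    qed
    ultimately show "(H has_vector_derivative h s) (at s)"
      by (simp add: has_real_derivative_iff_has_vector_derivative)
  qed simp
  moreover have "H 0 = u 0" using \<kappa>_pos by (simp add: H_def c_def)
  moreover have "H \<bar>t\<bar> = u t" using t by (cases "t > 0") (auto simp: H_def c_def add_divide_distrib diff_divide_distrib)
  ultimately have "(LINT s|lborel. h s) = u t - u 0"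
    by (intro has_integral_zero_outside_unique[OF ih, of _ 0 "\<bar>t\<bar>"]) (auto simp: h_def w_def taylor_kernel_def)
  then show ?thesis using lborel_fold(2)[OF iw] by (simp add: h_def w_def)
qed

end

(* Test functions of the form psi(z) = E(z^2) + z G(z^2). The quantity eta s v z below is the integrand
   of the translate of psi by s at z; eta 0 v is psi itself. *)
locale even_odd_profile = dunkl +
  fixes E E' G G' :: "real \<Rightarrow> real"
  assumes dE: "\<And>x. (E has_real_derivative E' x) (at x)" and cE': "continuous_on UNIV E'"
    and dG: "\<And>x. (G has_real_derivative G' x) (at x)" and cG': "continuous_on UNIV G'"
begin

definition \<eta> :: "real \<Rightarrow> real \<Rightarrow> real \<Rightarrow> real" where
  "\<eta> s v z = E (s\<^sup>2 + z\<^sup>2 + 2 * s * z * v) + (s + z) * G (s\<^sup>2 + z\<^sup>2 + 2 * s * z * v)"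

definition \<eta>' :: "real \<Rightarrow> real \<Rightarrow> real \<Rightarrow> real" where
  "\<eta>' s v z = E' (s\<^sup>2 + z\<^sup>2 + 2 * s * z * v) * (2 * z + 2 * s * v) + G (s\<^sup>2 + z\<^sup>2 + 2 * s * z * v)
     + (s + z) * (G' (s\<^sup>2 + z\<^sup>2 + 2 * s * z * v) * (2 * z + 2 * s * v))"

lemma cE: "continuous_on UNIV E" using dE by (meson DERIV_continuous_on DERIV_subset subset_UNIV)
lemma cG: "continuous_on UNIV G" using dG by (meson DERIV_continuous_on DERIV_subset subset_UNIV)

lemma profile_measurable[measurable]: "E \<in> borel_measurable borel" "E' \<in> borel_measurable borel"
  "G \<in> borel_measurable borel" "G' \<in> borel_measurable borel"
  using cE cE' cG cG' by (auto intro: borel_measurable_continuous_onI)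

text \<open>Through this symmetry the translation parameter can be read as the variable, so that the
  Taylor formula applies to the dependence on the parameter.\<close>

lemma \<eta>_commute: "\<eta> s v z = \<eta> z v s" by (simp add: \<eta>_def algebra_simps)

lemma \<eta>_deriv: "(\<eta> s v has_real_derivative \<eta>' s v z) (at z)"
proof -
  have q: "((\<lambda>z. s\<^sup>2 + z\<^sup>2 + 2 * s * z * v) has_real_derivative 2 * z + 2 * s * v) (at z)"
    by (auto intro!: derivative_eq_intros)
  show ?thesis unfolding \<eta>_def[abs_def] \<eta>'_def
    by (rule DERIV_cong, rule DERIV_add[OF DERIV_chain2[OF dE q]
          DERIV_mult[OF DERIV_add[OF DERIV_const DERIV_ident] DERIV_chain2[OF dG q]]]) (simp add: algebra_simps)
qed

lemma \<eta>'_continuous: "continuous_on UNIV (\<eta>' s v)"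
  unfolding \<eta>'_def
  by (auto intro!: continuous_intros continuous_on_compose2[OF cE'] continuous_on_compose2[OF cG] continuous_on_compose2[OF cG'])

lemma dunkl_deriv_\<eta>_measurable[measurable (raw)]:
  assumes [measurable]: "a \<in> borel_measurable M" "b \<in> borel_measurable M" "c \<in> borel_measurable M"
  shows "(\<lambda>t. dunkl_deriv (\<eta> (a t) (b t)) (\<eta>' (a t) (b t)) (c t)) \<in> borel_measurable M"
    and "(\<lambda>t. \<eta> (a t) (b t) (c t)) \<in> borel_measurable M"
  unfolding dunkl_deriv_def \<eta>_def \<eta>'_def by measurable

(* Integration by parts in v; the right-hand side is symmetric in y and z. *)
lemma integral_dunkl_deriv_\<eta>:
  assumes y: "y \<noteq> 0"
  shows "(LINT v|J. (1 + v) * dunkl_deriv (\<eta> z v) (\<eta>' z v) y)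
    = (LINT v|J. 2 * (y + z) * (1 + v) * E' (y\<^sup>2 + z\<^sup>2 + 2 * y * z * v)
        + (1 + v + \<kappa>) * G (y\<^sup>2 + z\<^sup>2 + 2 * y * z * v)
        + 2 * (1 + v) * (y\<^sup>2 + y * z + y * z * v + z\<^sup>2) * G' (y\<^sup>2 + z\<^sup>2 + 2 * y * z * v))" (is "_ = ?R")
proof -
  define q where "q v = y\<^sup>2 + z\<^sup>2 + 2 * y * z * v" for v
  have dq: "(q has_real_derivative 2 * y * z) (at v)" for v
    unfolding q_def[abs_def] by (auto intro!: derivative_eq_intros)
  have cq: "continuous_on UNIV q" unfolding q_def by (intro continuous_intros)
  define e where "e v = E (q v)" for v
  define e' where "e' v = E' (q v)" for v
  define g where "g v = G (q v)" for v
  define g' where "g' v = G' (q v)" for v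
  have c: "continuous_on UNIV e" "continuous_on UNIV e'" "continuous_on UNIV g" "continuous_on UNIV g'"
    unfolding e_def e'_def g_def g'_def using cE cE' cG cG' cq
    by (auto intro: continuous_on_compose2)
  have cm: "continuous_on UNIV (\<lambda>v. e (- v))" "continuous_on UNIV (\<lambda>v. g (- v))"
    using c by (auto intro!: continuous_on_compose2[of UNIV e UNIV uminus] continuous_on_compose2[of UNIV g UNIV uminus] continuous_intros)
  have [measurable]: "e \<in> borel_measurable borel" "e' \<in> borel_measurable borel" "g \<in> borel_measurable borel" "g' \<in> borel_measurable borel"
    using c by (auto intro: borel_measurable_continuous_onI)
  have ibpE: "\<kappa> * (LINT v|J. v * e v) = (LINT v|J. (1 - v\<^sup>2) * (e' v * (2 * y * z)))"
    unfolding e_def e'_def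
    by (rule J_by_parts) (auto intro!: DERIV_chain2[OF dE dq] continuous_intros continuous_on_compose2[OF cE'] cq)
  have ibpG: "\<kappa> * (LINT v|J. v * g v) = (LINT v|J. (1 - v\<^sup>2) * (g' v * (2 * y * z)))"
    unfolding g_def g'_def
    by (rule J_by_parts) (auto intro!: DERIV_chain2[OF dG dq] continuous_intros continuous_on_compose2[OF cG'] cq)
  have qm: "z\<^sup>2 + (- y)\<^sup>2 + 2 * z * (- y) * v = q (- v)" "z\<^sup>2 + y\<^sup>2 + 2 * z * y * v = q v" for v
    by (simp_all add: q_def)
  define A where "A v = (1 + v) * (e' v * (2 * y + 2 * z * v) + g v + (z + y) * (g' v * (2 * y + 2 * z * v)))" for v
  define P where "P v = (1 + v) * (e v + (z + y) * g v)" for v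
  \<comment> \<open>The argument q(v) at -y is q(-v), so the reflected value carries -v. Replacing v
    by -v under the symmetric J turns its weight 1 + v into 1 - v, and P - Q retains the terms v *
    e, y * g and z * v * g.\<close>
  define Q where "Q v = (1 - v) * (e v + (z - y) * g v)" for v
  have split: "(1 + v) * dunkl_deriv (\<eta> z v) (\<eta>' z v) y = A v + \<kappa> / (2 * y) * (P v - Q (- v))" for v
    unfolding dunkl_deriv_def \<eta>_def \<eta>'_def qm A_def P_def Q_def e_def e'_def g_def g'_def
    using y by (simp add: field_simps)
  have iA: "integrable J A" and iP: "integrable J P" and iQ: "integrable J Q" and iQm: "integrable J (\<lambda>v. Q (- v))"
    unfolding A_def P_def Q_def using c cm by (auto intro!: integrable_J_cont continuous_intros)
  have [measurable]: "Q \<in> borel_measurable borel" unfolding Q_def by measurable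
  have i: "integrable J (\<lambda>v. v * e v)" "integrable J (\<lambda>v. v * g v)" "integrable J g"
     "integrable J (\<lambda>v. (1 - v\<^sup>2) * (e' v * (2 * y * z)))" "integrable J (\<lambda>v. (1 - v\<^sup>2) * (g' v * (2 * y * z)))"
    using c by (auto intro!: integrable_J_cont continuous_intros)
  have lin: "a * (LINT v|J. (1 - v\<^sup>2) * (e' v * (2 * y * z))) + \<kappa> * (LINT v|J. g v) + b * (LINT v|J. (1 - v\<^sup>2) * (g' v * (2 * y * z)))
     = (LINT v|J. a * ((1 - v\<^sup>2) * (e' v * (2 * y * z))) + \<kappa> * g v + b * ((1 - v\<^sup>2) * (g' v * (2 * y * z))))" for a b
    using i by simp
  have iB: "integrable J (\<lambda>v. a * ((1 - v\<^sup>2) * (e' v * (2 * y * z))) + \<kappa> * g v + b * ((1 - v\<^sup>2) * (g' v * (2 * y * z))))" for a b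
    using i by simp
  have "(LINT v|J. (1 + v) * dunkl_deriv (\<eta> z v) (\<eta>' z v) y) = (LINT v|J. A v) + \<kappa> / (2 * y) * ((LINT v|J. P v) - (LINT v|J. Q (- v)))"
    unfolding split using iA iP iQm by simp
  also have "(LINT v|J. Q (- v)) = (LINT v|J. Q v)" by (rule J_reflect) measurable
  also have "(LINT v|J. P v) - (LINT v|J. Q v) = (LINT v|J. P v - Q v)" using iP iQ by simp
  also have "(LINT v|J. P v - Q v) = (LINT v|J. 2 * (v * e v) + 2 * y * g v + 2 * z * (v * g v))"
    by (intro Bochner_Integration.integral_cong) (auto simp: P_def Q_def algebra_simps)
  also have "\<dots> = 2 * (LINT v|J. v * e v) + 2 * y * (LINT v|J. g v) + 2 * z * (LINT v|J. v * g v)"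
    using i by simp
  \<comment> \<open>The terms \<open>\<kappa>\<close> * v * e and \<open>\<kappa>\<close> * v * g
    are ready for integration by parts, which produces the factor 2 * y * z and so removes the
    division by y.\<close>
  also have "\<kappa> / (2 * y) * \<dots> = 1 / y * (\<kappa> * (LINT v|J. v * e v)) + \<kappa> * (LINT v|J. g v) + z / y * (\<kappa> * (LINT v|J. v * g v))"
    using y by (simp add: field_simps)
  also have "\<dots> = (LINT v|J. 1 / y * ((1 - v\<^sup>2) * (e' v * (2 * y * z))) + \<kappa> * g v + z / y * ((1 - v\<^sup>2) * (g' v * (2 * y * z))))"
    unfolding ibpE ibpG by (rule lin)
  also have "(LINT v|J. A v) + \<dots> = (LINT v|J. A v + (1 / y * ((1 - v\<^sup>2) * (e' v * (2 * y * z))) + \<kappa> * g v + z / y * ((1 - v\<^sup>2) * (g' v * (2 * y * z)))))"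
    by (rule Bochner_Integration.integral_add[OF iA iB, symmetric])
  also have "\<dots> = ?R"
    unfolding q_def[symmetric] e'_def[symmetric] g_def[symmetric] g'_def[symmetric]
    using y by (intro Bochner_Integration.integral_cong refl) (simp add: A_def field_simps power2_eq_square)
  finally show ?thesis .
qed

lemma integral_dunkl_deriv_\<eta>_commute:
  assumes "y \<noteq> 0" "z \<noteq> 0"
  shows "(LINT v|J. (1 + v) * dunkl_deriv (\<eta> z v) (\<eta>' z v) y) = (LINT v|J. (1 + v) * dunkl_deriv (\<eta> y v) (\<eta>' y v) z)"
  unfolding integral_dunkl_deriv_\<eta>[OF assms(1)] integral_dunkl_deriv_\<eta>[OF assms(2)]
  by (intro Bochner_Integration.integral_cong refl) (simp add: algebra_simps)

end

section \<open>Duality of translations\<close>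

lemma ennreal_norm_integral_le:
  fixes f :: "'a \<Rightarrow> 'b::{banach, second_countable_topology}"
  shows "ennreal (norm (LINT x|M. f x)) \<le> (\<integral>\<^sup>+x. ennreal (norm (f x)) \<partial>M)"
  by (cases "integrable M f") (auto simp: integral_norm_bound_ennreal not_integrable_integral_eq)

lemma (in dunkl) W_support': "\<bar>y\<bar> > \<bar>x\<bar> + \<bar>z\<bar> \<Longrightarrow> W x y z = 0"
  by (simp add: dunkl_W_def dunkl_Delta_def)

context dunkl_Lp begin

text \<open>Pairings with functions of compact support see f on a bounded interval only, and there
  L^p lies in L^1. This local L^1 norm measures f in the absolute convergence arguments for
  pairings.\<close>

definition loc_norm :: "(real \<Rightarrow> complex) \<Rightarrow> real \<Rightarrow> ennreal" where
  "loc_norm f R = (\<integral>\<^sup>+z. ennreal (norm (f z) * indicator {-R..R} z) \<partial>\<mu>)"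

lemma L_local:
  assumes f: "f \<in> L"
  shows "loc_norm f R < \<infinity>"
proof -
  note [measurable] = Lp_memD(1)[OF f]
  have "(\<integral>\<^sup>+z. ennreal (norm (f z) * indicator {-R..R} z) \<partial>\<mu>)
     \<le> (\<integral>\<^sup>+z. indicator {-R..R} z + ennreal (norm (f z) powr p) \<partial>\<mu>)"
    using le_one_plus_powr[OF norm_ge_zero p]
    by (intro nn_integral_mono) (auto simp: indicator_def ennreal_plus[symmetric] simp flip: ennreal_1 intro!: ennreal_leI simp del: ennreal_plus)
  also have "\<dots> = emeasure \<mu> {-R..R} + (\<integral>\<^sup>+z. ennreal (norm (f z) powr p) \<partial>\<mu>)"
    by (subst nn_integral_add) auto
  also have "\<dots> < \<infinity>"
    using emeasure_mu_compact[of R] nn_integral_eq_integral[OF Lp_memD(2)[OF f]] by simp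
  finally show ?thesis unfolding loc_norm_def .
qed

text \<open>The column integral of |W| is at most 4 for every z other than 0, and the support of W
  confines z to |z| <= R + X once |x| <= X and |y| <= R.\<close>

lemma nn_W_weight:
  fixes \<xi> :: "real \<Rightarrow> complex"
  assumes x: "x \<noteq> 0" "\<bar>x\<bar> \<le> X" and f[measurable]: "f \<in> borel_measurable borel" and [measurable]: "\<xi> \<in> borel_measurable borel"
    and B: "\<And>y. norm (\<xi> y) \<le> B" and R: "\<And>y. \<bar>y\<bar> > R \<Longrightarrow> \<xi> y = 0"
  shows "(\<integral>\<^sup>+y. \<integral>\<^sup>+z. ennreal (norm ((W x y z *\<^sub>R f z) * \<xi> y)) \<partial>\<mu> \<partial>\<mu>) \<le> ennreal (4 * B) * loc_norm f (R + X)"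
proof -
  interpret sigma_finite_measure \<mu> by (rule sigma_finite_mu)
  interpret PP: pair_sigma_finite \<mu> \<mu> ..
  have B0: "B \<ge> 0" using B norm_ge_zero order_trans by blast
  have "(\<integral>\<^sup>+y. \<integral>\<^sup>+z. ennreal (norm ((W x y z *\<^sub>R f z) * \<xi> y)) \<partial>\<mu> \<partial>\<mu>)
     = (\<integral>\<^sup>+z. \<integral>\<^sup>+y. ennreal (norm ((W x y z *\<^sub>R f z) * \<xi> y)) \<partial>\<mu> \<partial>\<mu>)"
    by (rule PP.Fubini') measurable
  also have "\<dots> \<le> (\<integral>\<^sup>+z. ennreal (4 * B) * ennreal (norm (f z) * indicator {-(R+X)..R+X} z) \<partial>\<mu>)"
  proof (rule nn_integral_mono_AE)
    show "AE z in \<mu>. (\<integral>\<^sup>+y. ennreal (norm ((W x y z *\<^sub>R f z) * \<xi> y)) \<partial>\<mu>)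
        \<le> ennreal (4 * B) * ennreal (norm (f z) * indicator {-(R+X)..R+X} z)"
      using AE_mu_nonzero
    proof eventually_elim
      case (elim z)
      show ?case
      proof (cases "\<bar>z\<bar> \<le> R + X")
        case True
        have "(\<integral>\<^sup>+y. ennreal (norm ((W x y z *\<^sub>R f z) * \<xi> y)) \<partial>\<mu>) \<le> (\<integral>\<^sup>+y. ennreal \<bar>W x y z\<bar> * ennreal (norm (f z) * B) \<partial>\<mu>)"
          using B by (intro nn_integral_mono) (auto simp: norm_mult ennreal_mult[symmetric] mult.assoc B0 intro!: ennreal_leI mult_left_mono)
        also have "\<dots> = (\<integral>\<^sup>+y. ennreal \<bar>W x y z\<bar> \<partial>\<mu>) * ennreal (norm (f z) * B)"
          by (rule nn_integral_multc) measurable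
        also have "\<dots> \<le> 4 * ennreal (norm (f z) * B)"
          using W_bound'[OF x(1) elim] by (rule mult_right_mono) simp
        also have "\<dots> = ennreal (4 * B) * ennreal (norm (f z) * indicator {-(R+X)..R+X} z)"
          using True B0 by (simp add: indicator_def abs_le_iff ennreal_mult mult_ac)
        finally show ?thesis .
      next
        case False
        have *: "(W x y z *\<^sub>R f z) * \<xi> y = 0" for y
          using R[of y] W_support[of x y z] False x(2) by (cases "\<bar>y\<bar> > R") auto
        show ?thesis unfolding * by simp
      qed
    qed
  qed
  also have "\<dots> = ennreal (4 * B) * loc_norm f (R + X)" unfolding loc_norm_def by (rule nn_integral_cmult) measurable
  finally show ?thesis .
qed

(* The adjoint of the translation by x is the translation by -x, because W(x, y, z) = W(-x, z, y). *)
lemma T_pairing: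
  fixes \<xi> :: "real \<Rightarrow> complex"
  assumes x: "x \<noteq> 0" and f: "f \<in> L" and [measurable]: "\<xi> \<in> borel_measurable borel"
    and B: "\<And>y. norm (\<xi> y) \<le> B" and R: "\<And>y. \<bar>y\<bar> > R \<Longrightarrow> \<xi> y = 0"
  shows "(LINT y|\<mu>. T x f y * \<xi> y) = (LINT z|\<mu>. f z * T (- x) \<xi> z)"
    and "integrable \<mu> (\<lambda>y. T x f y * \<xi> y)"
    and "(\<integral>\<^sup>+y. ennreal (norm (T x f y * \<xi> y)) \<partial>\<mu>) \<le> ennreal (4 * B) * loc_norm f (R + \<bar>x\<bar>)"
proof -
  note [measurable] = Lp_memD(1)[OF f]
  define F where "F y z = (W x y z *\<^sub>R f z) * \<xi> y" for y z
  have m: "(\<lambda>(y,z). F y z) \<in> borel_measurable (\<mu> \<Otimes>\<^sub>M \<mu>)" unfolding F_def by measurable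
  have bd: "(\<integral>\<^sup>+y. \<integral>\<^sup>+z. ennreal (norm (F y z)) \<partial>\<mu> \<partial>\<mu>) \<le> ennreal (4 * B) * loc_norm f (R + \<bar>x\<bar>)"
    unfolding F_def by (rule nn_W_weight[OF x _ _ _ B R]) auto
  have fin: "(\<integral>\<^sup>+y. \<integral>\<^sup>+z. ennreal (norm (F y z)) \<partial>\<mu> \<partial>\<mu>) < \<infinity>"
    using L_local[OF f, of "R + \<bar>x\<bar>"] by (intro le_less_trans[OF bd]) (simp add: ennreal_mult_less_top)
  note Fu = Fubini_swap[OF sigma_finite_mu sigma_finite_mu m fin]
  have l: "(LINT z|\<mu>. F y z) = T x f y * \<xi> y" for y
    unfolding F_def T_def using x by (subst integral_mult_left_zero) simp
  have r: "(LINT y|\<mu>. F y z) = f z * T (- x) \<xi> z" if z: "z \<noteq> 0" for z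
  proof -
    have "(LINT y|\<mu>. F y z) = (LINT y|\<mu>. f z * (W (- x) z y *\<^sub>R \<xi> y))"
    proof (rule integral_cong_AE)
      show "AE y in \<mu>. F y z = f z * (W (- x) z y *\<^sub>R \<xi> y)"
        using AE_mu_nonzero
      proof eventually_elim
        case (elim y)
        show ?case unfolding F_def W_swap[OF x elim z] by simp
      qed
    qed (simp_all add: F_def)
    also have "\<dots> = f z * T (- x) \<xi> z" using x by (simp only: T_def integral_mult_right_zero) simp
    finally show ?thesis .
  qed
  have "(LINT y|\<mu>. T x f y * \<xi> y) = (LINT z|\<mu>. LINT y|\<mu>. F y z)" using Fu(1) by (simp only: l)
  also have "\<dots> = (LINT z|\<mu>. f z * T (- x) \<xi> z)"
  proof (rule integral_cong_AE)
    show "AE z in \<mu>. (LINT y|\<mu>. F y z) = f z * T (- x) \<xi> z"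
      using AE_mu_nonzero by eventually_elim (rule r)
    interpret sigma_finite_measure \<mu> by (rule sigma_finite_mu)
    show "(\<lambda>z. LINT y|\<mu>. F y z) \<in> borel_measurable \<mu>" unfolding F_def by measurable
  qed measurable
  finally show "(LINT y|\<mu>. T x f y * \<xi> y) = (LINT z|\<mu>. f z * T (- x) \<xi> z)" .
  show "integrable \<mu> (\<lambda>y. T x f y * \<xi> y)" using Fu(3) by (simp only: l)
  show "(\<integral>\<^sup>+y. ennreal (norm (T x f y * \<xi> y)) \<partial>\<mu>) \<le> ennreal (4 * B) * loc_norm f (R + \<bar>x\<bar>)"
    by (rule order_trans[OF nn_integral_mono bd]) (simp only: l[symmetric] ennreal_norm_integral_le)
qed

lemma loc_norm_mono: "R \<le> R' \<Longrightarrow> loc_norm f R \<le> loc_norm f R'"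
  unfolding loc_norm_def by (intro nn_integral_mono ennreal_leI mult_left_mono) (auto simp: indicator_def)

lemma T_bounded:
  fixes \<xi> :: "real \<Rightarrow> complex"
  assumes x: "x \<noteq> 0" and z: "z \<noteq> 0"
    and B: "\<And>y. norm (\<xi> y) \<le> B" and R: "\<And>y. \<bar>y\<bar> > R \<Longrightarrow> \<xi> y = 0"
  shows "norm (T x \<xi> z) \<le> 4 * B * indicator {-(R + \<bar>x\<bar>)..R + \<bar>x\<bar>} z"
proof (cases "\<bar>z\<bar> \<le> R + \<bar>x\<bar>")
  case True
  have B0: "B \<ge> 0" using B norm_ge_zero order_trans by blast
  have "ennreal (norm (T x \<xi> z)) \<le> (\<integral>\<^sup>+y. ennreal (norm (W x z y *\<^sub>R \<xi> y)) \<partial>\<mu>)"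
    unfolding T_def using x by (simp only: if_False ennreal_norm_integral_le)
  also have "\<dots> \<le> (\<integral>\<^sup>+y. ennreal \<bar>W x z y\<bar> * ennreal B \<partial>\<mu>)"
    using B by (intro nn_integral_mono) (auto simp: ennreal_mult[symmetric] B0 intro!: ennreal_leI mult_left_mono)
  also have "\<dots> = (\<integral>\<^sup>+y. ennreal \<bar>W x z y\<bar> \<partial>\<mu>) * ennreal B" by (rule nn_integral_multc) measurable
  also have "\<dots> \<le> 4 * ennreal B" using W_bound[OF x z] by (rule mult_right_mono) simp
  also have "\<dots> = ennreal (4 * B)" using B0 by (simp add: ennreal_mult)
  finally have "norm (T x \<xi> z) \<le> 4 * B" using B0 by (simp add: ennreal_le_iff)
  then show ?thesis using True by (simp add: indicator_def abs_le_iff)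
next
  case False
  have *: "W x z y *\<^sub>R \<xi> y = 0" for y
    using R[of y] W_support'[of x y z] False by (cases "\<bar>y\<bar> > R") auto
  have "T x \<xi> z = 0" using x unfolding T_def * by simp
  then show ?thesis using False by (auto simp: indicator_def)
qed

text \<open>M and the sign c stay open for two uses: Lebesgue measure with c = -1 for the Taylor
  remainder, and the Dunkl measure with c = 1 for convolution with a mollifier.\<close>

lemma average_pairing:
  fixes \<xi> :: "real \<Rightarrow> complex" and b :: "real \<Rightarrow> real" and c :: real
  assumes M: "sigma_finite_measure M" "sets M = sets borel" "AE s in M. s \<noteq> 0"
    and [measurable]: "b \<in> borel_measurable borel"
    and b: "(\<integral>\<^sup>+s. ennreal \<bar>b s\<bar> \<partial>M) < \<infinity>" "\<And>s. \<bar>s\<bar> > X \<Longrightarrow> b s = 0" and c: "\<bar>c\<bar> = 1"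
    and f: "f \<in> L" and [measurable]: "\<xi> \<in> borel_measurable borel"
    and B: "\<And>y. norm (\<xi> y) \<le> B" and R: "\<And>y. \<bar>y\<bar> > R \<Longrightarrow> \<xi> y = 0"
  shows "(LINT y|\<mu>. (LINT s|M. b s *\<^sub>R T (c * s) f y) * \<xi> y) = (LINT s|M. b s *\<^sub>R (LINT z|\<mu>. f z * T (- (c * s)) \<xi> z))"
    and "integrable \<mu> (\<lambda>y. (LINT s|M. b s *\<^sub>R T (c * s) f y) * \<xi> y)"
proof -
  note [measurable] = Lp_memD(1)[OF f]
  note [measurable_cong] = M(2)
  interpret M: sigma_finite_measure M by (rule M(1))
  interpret sigma_finite_measure \<mu> by (rule sigma_finite_mu)
  interpret PP: pair_sigma_finite \<mu> M ..
  define F where "F y s = (b s *\<^sub>R T (c * s) f y) * \<xi> y" for y s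
  have m: "(\<lambda>(y,s). F y s) \<in> borel_measurable (\<mu> \<Otimes>\<^sub>M M)" unfolding F_def by measurable
  have c0: "c \<noteq> 0" using c by auto
  have "(\<integral>\<^sup>+y. \<integral>\<^sup>+s. ennreal (norm (F y s)) \<partial>M \<partial>\<mu>) = (\<integral>\<^sup>+s. \<integral>\<^sup>+y. ennreal (norm (F y s)) \<partial>\<mu> \<partial>M)"
    by (rule PP.Fubini'[symmetric]) (use m in measurable)
  also have "\<dots> \<le> (\<integral>\<^sup>+s. ennreal \<bar>b s\<bar> * (ennreal (4 * B) * loc_norm f (R + X)) \<partial>M)"
  proof (rule nn_integral_mono_AE)
    show "AE s in M. (\<integral>\<^sup>+y. ennreal (norm (F y s)) \<partial>\<mu>) \<le> ennreal \<bar>b s\<bar> * (ennreal (4 * B) * loc_norm f (R + X))"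
      using M(3)
    proof eventually_elim
      case (elim s)
      show ?case
      proof (cases "\<bar>s\<bar> > X")
        case False
        have "(\<integral>\<^sup>+y. ennreal (norm (F y s)) \<partial>\<mu>) = (\<integral>\<^sup>+y. ennreal \<bar>b s\<bar> * ennreal (norm (T (c * s) f y * \<xi> y)) \<partial>\<mu>)"
          by (intro nn_integral_cong) (auto simp: F_def ennreal_mult[symmetric] norm_mult)
        also have "\<dots> = ennreal \<bar>b s\<bar> * (\<integral>\<^sup>+y. ennreal (norm (T (c * s) f y * \<xi> y)) \<partial>\<mu>)"
          by (rule nn_integral_cmult) measurable
        also have "\<dots> \<le> ennreal \<bar>b s\<bar> * (ennreal (4 * B) * loc_norm f (R + \<bar>c * s\<bar>))"
          using elim c0 by (intro mult_left_mono T_pairing(3)[OF _ f _ B R]) auto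
        also have "\<dots> \<le> ennreal \<bar>b s\<bar> * (ennreal (4 * B) * loc_norm f (R + X))"
          using False c by (intro mult_left_mono loc_norm_mono) (auto simp: abs_mult)
        finally show ?thesis .
      qed (simp add: F_def b(2))
    qed
  qed
  also have "\<dots> = (\<integral>\<^sup>+s. ennreal \<bar>b s\<bar> \<partial>M) * (ennreal (4 * B) * loc_norm f (R + X))"
    by (rule nn_integral_multc) measurable
  also have "\<dots> < \<infinity>" using b(1) L_local[OF f, of "R + X"] by (simp add: ennreal_mult_less_top)
  finally have fin: "(\<integral>\<^sup>+y. \<integral>\<^sup>+s. ennreal (norm (F y s)) \<partial>M \<partial>\<mu>) < \<infinity>" .
  note Fu = Fubini_swap[OF sigma_finite_mu M(1) m fin]
  have l: "(LINT s|M. F y s) = (LINT s|M. b s *\<^sub>R T (c * s) f y) * \<xi> y" for y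
    unfolding F_def by (rule integral_mult_left_zero)
  show "integrable \<mu> (\<lambda>y. (LINT s|M. b s *\<^sub>R T (c * s) f y) * \<xi> y)" using Fu(3) by (simp only: l)
  have "(LINT y|\<mu>. (LINT s|M. b s *\<^sub>R T (c * s) f y) * \<xi> y) = (LINT s|M. LINT y|\<mu>. F y s)"
    using Fu(1) by (simp only: l)
  also have "\<dots> = (LINT s|M. b s *\<^sub>R (LINT z|\<mu>. f z * T (- (c * s)) \<xi> z))"
  proof (rule integral_cong_AE)
    show "AE s in M. (LINT y|\<mu>. F y s) = b s *\<^sub>R (LINT z|\<mu>. f z * T (- (c * s)) \<xi> z)"
      using M(3)
    proof eventually_elim
      case (elim s)
      have "(LINT y|\<mu>. F y s) = (LINT y|\<mu>. b s *\<^sub>R (T (c * s) f y * \<xi> y))" by (simp add: F_def)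
      also have "\<dots> = b s *\<^sub>R (LINT y|\<mu>. T (c * s) f y * \<xi> y)" by (rule integral_scaleR_right)
      also have "(LINT y|\<mu>. T (c * s) f y * \<xi> y) = (LINT z|\<mu>. f z * T (- (c * s)) \<xi> z)"
        using elim c0 by (intro T_pairing(1)[OF _ f _ B R]) auto
      finally show ?case .
    qed
    show "(\<lambda>s. LINT y|\<mu>. F y s) \<in> borel_measurable M" unfolding F_def by measurable
    show "(\<lambda>s. b s *\<^sub>R (LINT z|\<mu>. f z * T (- (c * s)) \<xi> z)) \<in> borel_measurable M" by measurable
  qed
  finally show "(LINT y|\<mu>. (LINT s|M. b s *\<^sub>R T (c * s) f y) * \<xi> y) = (LINT s|M. b s *\<^sub>R (LINT z|\<mu>. f z * T (- (c * s)) \<xi> z))" .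
qed

end

section \<open>Smooth bumps and the weak Taylor formula\<close>

text \<open>The classical flat function exp(-1/v), extended by 0, together with the negative powers
  of v that its derivatives bring in.\<close>

definition expinv :: "nat \<Rightarrow> real \<Rightarrow> real" where
  "expinv j v = (if v > 0 then exp (- (1 / v)) / v ^ j else 0)"

lemma expinv_tendsto_0: "(expinv j \<longlongrightarrow> 0) (at 0)"
proof -
  have "((\<lambda>v. inverse v ^ j / exp (inverse v)) \<longlongrightarrow> (0::real)) (at_right 0)"
    using filterlim_compose[OF tendsto_power_div_exp_0[of j] filterlim_inverse_at_top_right] .
  then have r: "(expinv j \<longlongrightarrow> 0) (at_right 0)"
  proof (rule Lim_transform_eventually)
    show "\<forall>\<^sub>F v in at_right 0. inverse v ^ j / exp (inverse v) = expinv j v"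
      unfolding eventually_at_right_field
      by (rule exI[of _ 1]) (auto simp: expinv_def exp_minus field_simps power_one_over inverse_eq_divide)
  qed
  have l: "(expinv j \<longlongrightarrow> 0) (at_left 0)"
  proof (rule Lim_transform_eventually[OF tendsto_const])
    show "\<forall>\<^sub>F v in at_left 0. 0 = expinv j v"
      unfolding eventually_at_left_field by (rule exI[of _ "-1"]) (auto simp: expinv_def)
  qed
  show ?thesis by (rule filterlim_split_at[OF l r])
qed

lemma expinv_deriv: "(expinv j has_real_derivative (expinv (j + 2) v - real j * expinv (j + 1) v)) (at v)"
proof -
  consider "v > 0" | "v < 0" | "v = 0" by linarith
  then show ?thesis
  proof cases
    case 1
    have "((\<lambda>v. exp (- (1 / v)) / v ^ j) has_real_derivative
       (exp (- (1 / v)) * (1 / v^2) * v ^ j - exp (- (1 / v)) * (real j * v ^ (j - 1))) / (v ^ j * v ^ j)) (at v)"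
      using 1 by (auto intro!: derivative_eq_intros simp: power2_eq_square)
    moreover have "(exp (- (1 / v)) * (1 / v^2) * v ^ j - exp (- (1 / v)) * (real j * v ^ (j - 1))) / (v ^ j * v ^ j)
       = expinv (j + 2) v - real j * expinv (j + 1) v"
      using 1 by (cases j) (auto simp: expinv_def field_simps power2_eq_square)
    moreover have "\<forall>\<^sub>F v in nhds v. exp (- (1 / v)) / v ^ j = expinv j v"
      by (rule eventually_mono[OF eventually_nhds_in_open[of "{0<..}" v]]) (use 1 in \<open>auto simp: expinv_def\<close>)
    ultimately show ?thesis by (subst (asm) DERIV_cong_ev[OF refl _ refl]) auto
  next
    case 2
    have "((\<lambda>v. 0) has_real_derivative 0) (at v)" by (rule DERIV_const)
    moreover have "\<forall>\<^sub>F v in nhds v. 0 = expinv j v"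
      by (rule eventually_mono[OF eventually_nhds_in_open[of "{..<0}" v]]) (use 2 in \<open>auto simp: expinv_def\<close>)
    ultimately have "(expinv j has_real_derivative 0) (at v)" by (subst (asm) DERIV_cong_ev[OF refl _ refl]) auto
    then show ?thesis using 2 by (simp add: expinv_def)
  next
    case 3
    \<comment> \<open>At the origin the difference quotient of \<open>expinv j\<close> is
      \<open>expinv (j + 1)\<close>, which tends to 0.\<close>
    have "(\<lambda>h. (expinv j (0 + h) - expinv j 0) / h) = expinv (j + 1)"
      by (auto simp: expinv_def fun_eq_iff field_simps)
    then have "(expinv j has_real_derivative 0) (at 0)"
      unfolding DERIV_def using expinv_tendsto_0[of "j + 1"] by simp
    then show ?thesis using 3 by (simp add: expinv_def)
  qed
qed

text \<open>A class of functions closed under differentiation: the derivative of P *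
  \<open>expinv j\<close> composed with Q is a sum of such products. Derivatives of all orders then
  follow by one induction over the whole class.\<close>

inductive bump_sum :: "(real \<Rightarrow> real) \<Rightarrow> bool" where
  base: "real_polynomial_function P \<Longrightarrow> real_polynomial_function Q \<Longrightarrow> bump_sum (\<lambda>z. P z * expinv j (Q z))"
| add: "bump_sum f \<Longrightarrow> bump_sum g \<Longrightarrow> bump_sum (\<lambda>z. f z + g z)"

lemma bump_sum_deriv: "bump_sum f \<Longrightarrow> \<exists>f'. bump_sum f' \<and> (\<forall>z. (f has_real_derivative f' z) (at z))"
proof (induction rule: bump_sum.induct)
  case (base P Q j)
  obtain P' where P': "real_polynomial_function P'" "\<And>x. (P has_real_derivative P' x) (at x)"
    using has_real_derivative_polynomial_function[OF base(1)] by blast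
  obtain Q' where Q': "real_polynomial_function Q'" "\<And>x. (Q has_real_derivative Q' x) (at x)"
    using has_real_derivative_polynomial_function[OF base(2)] by blast
  define f' where "f' z = (P' z * expinv j (Q z) + (P z * Q' z) * expinv (j + 2) (Q z)) + (P z * (- real j * Q' z)) * expinv (j + 1) (Q z)" for z
  have "bump_sum f'" unfolding f'_def
    by (intro bump_sum.intros real_polynomial_function.intros(2-) P' Q' base)
  moreover have "((\<lambda>z. P z * expinv j (Q z)) has_real_derivative f' z) (at z)" for z
    by (rule DERIV_cong, rule DERIV_mult[OF P'(2) DERIV_chain2[OF expinv_deriv Q'(2)]])
       (simp add: f'_def algebra_simps)
  ultimately show ?case by blast
next
  case (add f g)
  then obtain f' g' where "bump_sum f'" "\<forall>z. (f has_real_derivative f' z) (at z)" "bump_sum g'" "\<forall>z. (g has_real_derivative g' z) (at z)"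
    by blast
  then show ?case by (intro exI[of _ "\<lambda>z. f' z + g' z"]) (auto intro: bump_sum.intros DERIV_add)
qed

lemma bump_sum_smooth:
  assumes "bump_sum f"
  shows "smooth (\<lambda>z. complex_of_real (f z))"
proof -
  have "((\<lambda>g y. vector_derivative g (at y)) ^^ n) (\<lambda>z. complex_of_real (f z)) differentiable (at x)"
    if "bump_sum f" for n f x
    using that
  proof (induction n arbitrary: f)
    case (Suc n)
    obtain f' where f': "bump_sum f'" "\<And>z. (f has_real_derivative f' z) (at z)" using bump_sum_deriv[OF Suc.prems] by blast
    have "((\<lambda>z. complex_of_real (f z)) has_vector_derivative complex_of_real (f' y)) (at y)" for y
      by (rule has_vector_derivative_of_real) (rule f')
    then have "(\<lambda>y. vector_derivative (\<lambda>z. complex_of_real (f z)) (at y)) = (\<lambda>z. complex_of_real (f' z))"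
      by (simp add: vector_derivative_at fun_eq_iff)
    then show ?case using Suc.IH[OF f'(1)] by (simp only: funpow_Suc_right o_def)
  next
    case 0
    obtain f' where "\<And>z. (f has_real_derivative f' z) (at z)" using bump_sum_deriv[OF 0] by blast
    then have "((\<lambda>z. complex_of_real (f z)) has_vector_derivative complex_of_real (f' x)) (at x)"
      by (intro has_vector_derivative_of_real)
    then show ?case by (simp add: differentiableI_vector)
  qed
  with assms show ?thesis unfolding smooth_def by blast
qed

section \<open>Interchanging pairings with weighted averages\<close>

context dunkl_Lp begin

lemma weighted_Fubini_complex:
  fixes w :: "real \<Rightarrow> real" and F :: "real \<Rightarrow> real \<Rightarrow> complex"
  assumes f: "f \<in> L" and M: "sigma_finite_measure M" "sets M = sets borel"
    and [measurable]: "w \<in> borel_measurable borel" and fw: "(\<integral>\<^sup>+s. ennreal \<bar>w s\<bar> \<partial>M) < \<infinity>"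
    and F[measurable]: "(\<lambda>(z,s). F z s) \<in> borel_measurable (borel \<Otimes>\<^sub>M borel)" and B: "B \<ge> 0"
    and bd: "\<And>z. z \<noteq> 0 \<Longrightarrow> AE s in M. w s \<noteq> 0 \<longrightarrow> norm (F z s) \<le> B * indicator {-R..R} z"
  shows "(LINT z|\<mu>. f z * (LINT s|M. w s *\<^sub>R F z s)) = (LINT s|M. w s *\<^sub>R (LINT z|\<mu>. f z * F z s))"
proof -
  note [measurable] = Lp_memD(1)[OF f]
  note [measurable_cong] = M(2)
  interpret M: sigma_finite_measure M by (rule M(1))
  interpret sigma_finite_measure \<mu> by (rule sigma_finite_mu)
  interpret PP: pair_sigma_finite \<mu> M ..
  define H where "H z s = f z * (w s *\<^sub>R F z s)" for z s
  have m: "(\<lambda>(z,s). H z s) \<in> borel_measurable (\<mu> \<Otimes>\<^sub>M M)" unfolding H_def by measurable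
  have "(\<integral>\<^sup>+z. \<integral>\<^sup>+s. ennreal (norm (H z s)) \<partial>M \<partial>\<mu>)
     \<le> (\<integral>\<^sup>+z. \<integral>\<^sup>+s. ennreal (norm (f z) * indicator {-R..R} z) * (ennreal B * ennreal \<bar>w s\<bar>) \<partial>M \<partial>\<mu>)"
  proof (rule nn_integral_mono_AE)
    show "AE z in \<mu>. (\<integral>\<^sup>+s. ennreal (norm (H z s)) \<partial>M)
       \<le> (\<integral>\<^sup>+s. ennreal (norm (f z) * indicator {-R..R} z) * (ennreal B * ennreal \<bar>w s\<bar>) \<partial>M)"
      using AE_mu_nonzero
    proof eventually_elim
      case (elim z)
      show ?case
      proof (rule nn_integral_mono_AE)
        show "AE s in M. ennreal (norm (H z s)) \<le> ennreal (norm (f z) * indicator {-R..R} z) * (ennreal B * ennreal \<bar>w s\<bar>)"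
          using bd[OF elim]
        proof eventually_elim
          case (elim s)
          have "\<bar>w s\<bar> * norm (F z s) \<le> \<bar>w s\<bar> * (B * indicator {-R..R} z)"
            using elim by (cases "w s = 0") (auto intro!: mult_left_mono)
          then have "norm (f z) * (\<bar>w s\<bar> * norm (F z s)) \<le> norm (f z) * (\<bar>w s\<bar> * (B * indicator {-R..R} z))"
            by (rule mult_left_mono) simp
          then have "norm (H z s) \<le> (norm (f z) * indicator {-R..R} z) * (B * \<bar>w s\<bar>)"
            by (simp add: H_def norm_mult mult_ac)
          then show ?case using B by (simp add: ennreal_mult[symmetric] ennreal_leI)
        qed
      qed
    qed
  qed
  also have "\<dots> = (\<integral>\<^sup>+z. ennreal (norm (f z) * indicator {-R..R} z) * (ennreal B * (\<integral>\<^sup>+s. ennreal \<bar>w s\<bar> \<partial>M)) \<partial>\<mu>)"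
    by (simp add: nn_integral_cmult)
  also have "\<dots> = loc_norm f R * (ennreal B * (\<integral>\<^sup>+s. ennreal \<bar>w s\<bar> \<partial>M))"
    unfolding loc_norm_def by (rule nn_integral_multc) measurable
  also have "\<dots> < \<infinity>" using L_local[OF f, of R] fw by (simp add: ennreal_mult_less_top)
  finally have fin: "(\<integral>\<^sup>+z. \<integral>\<^sup>+s. ennreal (norm (H z s)) \<partial>M \<partial>\<mu>) < \<infinity>" .
  have l: "(LINT s|M. H z s) = f z * (LINT s|M. w s *\<^sub>R F z s)" for z
    unfolding H_def by (simp only: integral_mult_right_zero)
  have r: "(LINT z|\<mu>. H z s) = w s *\<^sub>R (LINT z|\<mu>. f z * F z s)" for s
    unfolding H_def by (simp only: mult_scaleR_right integral_scaleR_right)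
  show ?thesis using Fubini_swap(1)[OF sigma_finite_mu M(1) m fin] by (simp only: l r)
qed

lemma weighted_Fubini:
  fixes w :: "real \<Rightarrow> real" and F :: "real \<Rightarrow> real \<Rightarrow> real"
  assumes f: "f \<in> L" and M: "sigma_finite_measure M" "sets M = sets borel"
    and w: "w \<in> borel_measurable borel" and fw: "(\<integral>\<^sup>+s. ennreal \<bar>w s\<bar> \<partial>M) < \<infinity>"
    and F[measurable]: "(\<lambda>(z,s). F z s) \<in> borel_measurable (borel \<Otimes>\<^sub>M borel)" and B: "B \<ge> 0"
    and bd: "AE s in M. w s \<noteq> 0 \<longrightarrow> (\<forall>z. \<bar>F z s\<bar> \<le> B * indicator {-R..R} z)"
  shows "(LINT z|\<mu>. f z * of_real (LINT s|M. w s * F z s)) = (LINT s|M. w s *\<^sub>R (LINT z|\<mu>. f z * of_real (F z s)))"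
proof -
  have m: "(\<lambda>(z,s). complex_of_real (F z s)) \<in> borel_measurable (borel \<Otimes>\<^sub>M borel)" by measurable
  have b: "AE s in M. w s \<noteq> 0 \<longrightarrow> norm (complex_of_real (F z s)) \<le> B * indicator {-R..R} z" for z
    using bd by eventually_elim simp
  have "complex_of_real (LINT s|M. w s * F z s) = (LINT s|M. w s *\<^sub>R of_real (F z s))" for z
    by (simp add: scaleR_conv_of_real integral_complex_of_real[symmetric] del: integral_complex_of_real)
  then show ?thesis using weighted_Fubini_complex[OF f M w fw m B b] by (simp only:)
qed

end

text \<open>The quadratic form is at least (|z| - |s|)^2 for |v| <= 1. Hence translating by s
  enlarges a support in |z| <= R to |z| <= R + |s| at most.\<close>

lemma polarization_gt:
  fixes R s z v :: real
  assumes "R \<ge> 0" "\<bar>v\<bar> \<le> 1" "\<bar>z\<bar> > R + \<bar>s\<bar>"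
  shows "s\<^sup>2 + z\<^sup>2 + 2 * s * z * v > R\<^sup>2"
proof -
  have "\<bar>s * z * v\<bar> \<le> \<bar>s\<bar> * \<bar>z\<bar> * 1" unfolding abs_mult using assms(2) by (intro mult_left_mono) auto
  then have "- (\<bar>s\<bar> * \<bar>z\<bar>) \<le> s * z * v" by linarith
  moreover have "(\<bar>z\<bar> - \<bar>s\<bar>)\<^sup>2 = s\<^sup>2 + z\<^sup>2 - 2 * (\<bar>s\<bar> * \<bar>z\<bar>)" by (simp add: power2_diff)
  ultimately have "(\<bar>z\<bar> - \<bar>s\<bar>)\<^sup>2 \<le> s\<^sup>2 + z\<^sup>2 + 2 * s * z * v" by linarith
  moreover have "R\<^sup>2 < (\<bar>z\<bar> - \<bar>s\<bar>)\<^sup>2" using assms(1,3) by (intro power_strict_mono) auto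
  ultimately show ?thesis by linarith
qed

text \<open>The profiles are functions of z^2, hence the threshold R^2. Class C^1 is asked for, so
  that the mollifiers are covered besides the smooth bumps.\<close>

locale compact_profile = dunkl_Lp \<alpha> p + even_odd_profile \<alpha> E E' G G'
  for \<alpha> p :: real and E E' G G' +
  fixes R :: real
  assumes R: "R \<ge> 0"
    and supp: "\<And>u. u > R\<^sup>2 \<Longrightarrow> E u = 0 \<and> E' u = 0 \<and> G u = 0 \<and> G' u = 0"
begin

lemma \<eta>_zero: "\<bar>v\<bar> \<le> 1 \<Longrightarrow> \<bar>z\<bar> > R + \<bar>s\<bar> \<Longrightarrow> \<eta> s v z = 0"
  and \<eta>'_zero: "\<bar>v\<bar> \<le> 1 \<Longrightarrow> \<bar>z\<bar> > R + \<bar>s\<bar> \<Longrightarrow> \<eta>' s v z = 0"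
  using supp[OF polarization_gt[OF R]] by (simp_all add: \<eta>_def \<eta>'_def)

lemma \<eta>_vderiv: "(\<eta> s v has_vector_derivative \<eta>' s v z) (at z)"
  using \<eta>_deriv by (simp add: has_real_derivative_iff_has_vector_derivative)

lemma box_bound:
  fixes F :: "real \<Rightarrow> real \<Rightarrow> real \<Rightarrow> real" and X Y :: real
  assumes "continuous_on UNIV (\<lambda>(s,v,z). F s v z)"
  obtains B where "B \<ge> 0" "\<And>s v z. \<bar>s\<bar> \<le> X \<Longrightarrow> \<bar>v\<bar> \<le> 1 \<Longrightarrow> \<bar>z\<bar> \<le> Y \<Longrightarrow> \<bar>F s v z\<bar> \<le> B"
proof -
  have "compact ((\<lambda>(s,v,z). F s v z) ` ({-X..X} \<times> {-1..1} \<times> {-Y..Y}))"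
    by (intro compact_continuous_image continuous_on_subset[OF assms] compact_Times) auto
  then obtain B where B: "\<And>t. t \<in> (\<lambda>(s,v,z). F s v z) ` ({-X..X} \<times> {-1..1} \<times> {-Y..Y}) \<Longrightarrow> norm t \<le> B"
    using compact_imp_bounded bounded_iff by metis
  have "\<bar>F s v z\<bar> \<le> max 0 B" if "\<bar>s\<bar> \<le> X" "\<bar>v\<bar> \<le> 1" "\<bar>z\<bar> \<le> Y" for s v z
  proof -
    have "F s v z \<in> (\<lambda>(s,v,z). F s v z) ` ({-X..X} \<times> {-1..1} \<times> {-Y..Y})"
      by (rule image_eqI[of _ _ "(s,v,z)"]) (use that in \<open>auto simp: abs_le_iff\<close>)
    from B[OF this] show ?thesis by simp
  qed
  then show thesis by (intro that[of "max 0 B"]) auto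
qed

lemma \<eta>_joint: "continuous_on UNIV (\<lambda>(s,v,z). \<eta> s v z)" "continuous_on UNIV (\<lambda>(s,v,z). \<eta>' s v z)"
  unfolding \<eta>_def \<eta>'_def case_prod_unfold
  by (auto intro!: continuous_intros continuous_on_compose2[OF cE] continuous_on_compose2[OF cE']
      continuous_on_compose2[OF cG] continuous_on_compose2[OF cG'])

text \<open>Joint continuity on a compact box gives one constant for all parameters; it dominates
  the integrands in the interchanges of integrals that follow.\<close>

lemma \<eta>_bound:
  obtains B where "B \<ge> 0"
    "\<And>s v z. \<bar>s\<bar> \<le> X \<Longrightarrow> \<bar>v\<bar> \<le> 1 \<Longrightarrow> \<bar>\<eta> s v z\<bar> \<le> B * indicator {-(R+X)..R+X} z"
    "\<And>s v z. \<bar>s\<bar> \<le> X \<Longrightarrow> \<bar>v\<bar> \<le> 1 \<Longrightarrow> \<bar>dunkl_deriv (\<eta> s v) (\<eta>' s v) z\<bar> \<le> B * indicator {-(R+X)..R+X} z"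
proof -
  obtain B1 where B1: "B1 \<ge> 0" "\<And>s v z. \<bar>s\<bar> \<le> X \<Longrightarrow> \<bar>v\<bar> \<le> 1 \<Longrightarrow> \<bar>z\<bar> \<le> R + X \<Longrightarrow> \<bar>\<eta> s v z\<bar> \<le> B1"
    by (rule box_bound[OF \<eta>_joint(1)]) blast
  obtain B2 where B2: "B2 \<ge> 0" "\<And>s v z. \<bar>s\<bar> \<le> X \<Longrightarrow> \<bar>v\<bar> \<le> 1 \<Longrightarrow> \<bar>z\<bar> \<le> R + X \<Longrightarrow> \<bar>\<eta>' s v z\<bar> \<le> B2"
    by (rule box_bound[OF \<eta>_joint(2)]) blast
  define B where "B = max B1 ((1 + \<kappa>) * B2)"
  show thesis
  proof (rule that[of B])
    show "B \<ge> 0" using B1 by (simp add: B_def)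
    fix s v z :: real assume sv: "\<bar>s\<bar> \<le> X" "\<bar>v\<bar> \<le> 1"
    show "\<bar>\<eta> s v z\<bar> \<le> B * indicator {-(R+X)..R+X} z"
      using B1(2)[OF sv, of z] \<eta>_zero[OF sv(2), of s z] sv(1)
      by (cases "\<bar>z\<bar> \<le> R + X") (auto simp: B_def indicator_def abs_le_iff)
    show "\<bar>dunkl_deriv (\<eta> s v) (\<eta>' s v) z\<bar> \<le> B * indicator {-(R+X)..R+X} z"
    proof (cases "\<bar>z\<bar> \<le> R + X")
      case True
      have "\<bar>dunkl_deriv (\<eta> s v) (\<eta>' s v) z\<bar> \<le> (1 + \<kappa>) * B2"
        using dunkl_deriv_bound[OF \<eta>_vderiv, of "R + X" s v B2 z] B2(2)[OF sv] True by simp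
      also have "\<dots> \<le> B" unfolding B_def by (rule max.cobounded2)
      finally have "\<bar>dunkl_deriv (\<eta> s v) (\<eta>' s v) z\<bar> \<le> B" .
      moreover have "z \<in> {-(R+X)..R+X}" using True by auto
      ultimately show ?thesis by simp
    next
      case False
      then have "dunkl_deriv (\<eta> s v) (\<eta>' s v) z = 0"
        using \<eta>_zero[OF sv(2), of s z] \<eta>_zero[OF sv(2), of s "-z"] \<eta>'_zero[OF sv(2), of s z] sv(1) by (simp add: dunkl_deriv_def)
      then show ?thesis using False by (auto simp: indicator_def)
    qed
  qed
qed

definition \<psi> :: "real \<Rightarrow> complex" where "\<psi> z = of_real (\<eta> 0 0 z)"

lemma \<eta>_at_0: "\<eta> 0 v z = \<eta> 0 0 z" by (simp add: \<eta>_def)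

lemma dunkl_op_\<eta>: "dunkl_op \<alpha> (\<lambda>z. of_real (\<eta> s v z)) z = of_real (dunkl_deriv (\<eta> s v) (\<eta>' s v) z)"
proof -
  have "((\<lambda>z. complex_of_real (\<eta> s v z)) has_vector_derivative of_real (\<eta>' s v z)) (at z)"
    by (rule has_vector_derivative_of_real[OF \<eta>_deriv])
  from dunkl_op_eq[where f' = "\<lambda>z. of_real (\<eta>' s v z)", OF this] show ?thesis by (simp only: dunkl_deriv_of_real)
qed

lemma \<psi>_measurable[measurable]: "\<psi> \<in> borel_measurable borel"
  unfolding \<psi>_def[abs_def] by measurable

lemma \<psi>_zero: "\<bar>y\<bar> > R \<Longrightarrow> \<psi> y = 0" using \<eta>_zero[of 0 0 y] by (simp add: \<psi>_def)

lemma \<psi>_bound: obtains B where "B \<ge> 0" "\<And>y. norm (\<psi> y) \<le> B"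
proof -
  obtain B where B: "B \<ge> 0" "\<And>s v z. \<bar>s\<bar> \<le> 0 \<Longrightarrow> \<bar>v\<bar> \<le> 1 \<Longrightarrow> \<bar>\<eta> s v z\<bar> \<le> B * indicator {-(R+0)..R+0} z"
    by (rule \<eta>_bound[of 0]) blast
  have "norm (\<psi> y) \<le> B" for y
  proof -
    have "\<bar>\<eta> 0 0 y\<bar> \<le> B * indicator {-(R+0)..R+0} y" by (rule B(2)) auto
    also have "\<dots> \<le> B" using B(1) by (auto simp: indicator_def)
    finally show ?thesis by (simp add: \<psi>_def)
  qed
  with B(1) show thesis by (rule that)
qed

lemma T_\<psi>:
  assumes x: "x \<noteq> 0" and z: "z \<noteq> 0"
  shows "T x \<psi> z = of_real (LINT v|J. (1 + v) * \<eta> x v z)"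
proof -
  have "T x \<psi> z = (LINT y|\<mu>. of_real (W x z y * (E (y\<^sup>2) + y * G (y\<^sup>2))))"
    using x by (simp add: T_def \<psi>_def \<eta>_def scaleR_conv_of_real)
  also have "\<dots> = of_real (LINT y|\<mu>. W x z y * (E (y\<^sup>2) + y * G (y\<^sup>2)))" by (rule integral_complex_of_real)
  also have "(LINT y|\<mu>. W x z y * (E (y\<^sup>2) + y * G (y\<^sup>2))) = (LINT v|J. (1 + v) * \<eta> x v z)"
    unfolding \<eta>_def by (rule W_even_odd[OF x z cE cG])
  finally show ?thesis .
qed

lemma nn_J_weight: "(\<integral>\<^sup>+v. ennreal \<bar>1 + v\<bar> \<partial>J) < \<infinity>"
proof -
  have "integrable J (\<lambda>v. 1 + v)" by (intro integrable_J_cont continuous_intros)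
  then show ?thesis using integrable_iff_bounded[of J "\<lambda>v. 1 + v"] by simp
qed

lemma taylor_kernel_outside: "\<bar>s\<bar> > \<bar>t\<bar> \<Longrightarrow> taylor_kernel t s = 0" by (auto simp: taylor_kernel_def indicator_def abs_le_iff)

text \<open>A first order Taylor formula for the translate of psi in which the operator already acts
  on z rather than on the translation parameter. In this form it can be paired with a function that
  has only a weak derivative.\<close>

lemma T_\<psi>_increment:
  assumes t: "t \<noteq> 0" and z: "z \<noteq> 0"
  shows "T t \<psi> z - \<psi> z = of_real (LINT s|lborel. taylor_kernel t s * (LINT v|J. (1 + v) * dunkl_deriv (\<eta> s v) (\<eta>' s v) z))"
proof -
  obtain B where B: "B \<ge> 0" "\<And>s v y. \<bar>s\<bar> \<le> \<bar>z\<bar> \<Longrightarrow> \<bar>v\<bar> \<le> 1 \<Longrightarrow> \<bar>dunkl_deriv (\<eta> s v) (\<eta>' s v) y\<bar> \<le> B * indicator {-(R+\<bar>z\<bar>)..R+\<bar>z\<bar>} y"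
    by (rule \<eta>_bound[of "\<bar>z\<bar>"]) blast
  have cc: "continuous_on UNIV (\<lambda>v. \<eta> x v y)" for x y
    unfolding \<eta>_def by (auto intro!: continuous_intros continuous_on_compose2[OF cE] continuous_on_compose2[OF cG])
  have i: "integrable J (\<lambda>v. (1 + v) * \<eta> x v y)" for x y by (intro integrable_J_cont continuous_intros cc)
  \<comment> \<open>psi(z) is written as an average with weight 1 + v as well, so that the increment
    can be taken under the integral over v.\<close>
  have "T t \<psi> z - \<psi> z = of_real ((LINT v|J. (1 + v) * \<eta> t v z) - (LINT v|J. (1 + v) * \<eta> 0 0 z))"
    unfolding T_\<psi>[OF t z] J_weight_one by (simp add: \<psi>_def)
  also have "(LINT v|J. (1 + v) * \<eta> t v z) - (LINT v|J. (1 + v) * \<eta> 0 0 z) = (LINT v|J. (1 + v) * \<eta> t v z - (1 + v) * \<eta> 0 v z)"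
  proof -
    have "(LINT v|J. (1 + v) * \<eta> 0 0 z) = (LINT v|J. (1 + v) * \<eta> 0 v z)"
      by (rule Bochner_Integration.integral_cong[OF refl]) (metis \<eta>_at_0)
    then show ?thesis by (simp only: Bochner_Integration.integral_diff[OF i i])
  qed
  also have "\<dots> = (LINT v|J. LINT s|lborel. (1 + v) * (taylor_kernel t s * dunkl_deriv (\<eta> z v) (\<eta>' z v) s))"
  proof (rule Bochner_Integration.integral_cong[OF refl])
    fix v
    \<comment> \<open>By \<open>\<eta>_commute\<close> the translation parameter is the argument
      here: the Taylor formula is applied to \<open>\<eta> z v\<close> between 0 and t.\<close>
    have "\<eta> z v t - \<eta> z v 0 = (LINT s|lborel. taylor_kernel t s * dunkl_deriv (\<eta> z v) (\<eta>' z v) s)"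
      by (rule dunkl_taylor[OF \<eta>_deriv \<eta>'_continuous t])
    then show "(1 + v) * \<eta> t v z - (1 + v) * \<eta> 0 v z = (LINT s|lborel. (1 + v) * (taylor_kernel t s * dunkl_deriv (\<eta> z v) (\<eta>' z v) s))"
      by (simp only: integral_mult_right_zero right_diff_distrib[symmetric] \<eta>_commute[of _ v z])
  qed
  also have "\<dots> = (LINT s|lborel. LINT v|J. (1 + v) * (taylor_kernel t s * dunkl_deriv (\<eta> z v) (\<eta>' z v) s))"
  proof (rule Fubini_swap(1)[OF sigma_finite_J sigma_finite_lborel])
    show "(\<lambda>(v, s). (1 + v) * (taylor_kernel t s * dunkl_deriv (\<eta> z v) (\<eta>' z v) s)) \<in> borel_measurable (J \<Otimes>\<^sub>M lborel)" by measurable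
    have "(\<integral>\<^sup>+v. \<integral>\<^sup>+s. ennreal (norm ((1 + v) * (taylor_kernel t s * dunkl_deriv (\<eta> z v) (\<eta>' z v) s))) \<partial>lborel \<partial>J)
      \<le> (\<integral>\<^sup>+v. \<integral>\<^sup>+s. ennreal (2 * B) * ennreal \<bar>taylor_kernel t s\<bar> \<partial>lborel \<partial>J)"
    proof (rule nn_integral_mono_AE)
      show "AE v in J. (\<integral>\<^sup>+s. ennreal (norm ((1 + v) * (taylor_kernel t s * dunkl_deriv (\<eta> z v) (\<eta>' z v) s))) \<partial>lborel)
         \<le> (\<integral>\<^sup>+s. ennreal (2 * B) * ennreal \<bar>taylor_kernel t s\<bar> \<partial>lborel)"
        using AE_J
      proof eventually_elim
        case (elim v)
        show ?case
        proof (rule nn_integral_mono)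
          fix s
          have "\<bar>dunkl_deriv (\<eta> z v) (\<eta>' z v) s\<bar> \<le> B"
          proof -
            have "\<bar>dunkl_deriv (\<eta> z v) (\<eta>' z v) s\<bar> \<le> B * indicator {-(R+\<bar>z\<bar>)..R+\<bar>z\<bar>} s"
              by (rule B(2)) (use elim in auto)
            also have "\<dots> \<le> B" using B(1) by (auto simp: indicator_def)
            finally show ?thesis .
          qed
          then have "\<bar>1 + v\<bar> * (\<bar>taylor_kernel t s\<bar> * \<bar>dunkl_deriv (\<eta> z v) (\<eta>' z v) s\<bar>) \<le> 2 * (\<bar>taylor_kernel t s\<bar> * B)"
            using elim by (intro mult_mono mult_left_mono) auto
          then show "ennreal (norm ((1 + v) * (taylor_kernel t s * dunkl_deriv (\<eta> z v) (\<eta>' z v) s))) \<le> ennreal (2 * B) * ennreal \<bar>taylor_kernel t s\<bar>"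
            using B(1) by (simp add: ennreal_mult[symmetric] ennreal_leI abs_mult mult_ac)
        qed
      qed
    qed
    also have "\<dots> = ennreal (2 * B) * (\<integral>\<^sup>+s. ennreal \<bar>taylor_kernel t s\<bar> \<partial>lborel)"
      by (simp add: nn_integral_cmult emeasure_J)
    also have "\<dots> < \<infinity>" using nn_integral_taylor_kernel[of t] by (auto simp: ennreal_mult_less_top intro: le_less_trans)
    finally show "(\<integral>\<^sup>+v. \<integral>\<^sup>+s. ennreal (norm ((1 + v) * (taylor_kernel t s * dunkl_deriv (\<eta> z v) (\<eta>' z v) s))) \<partial>lborel \<partial>J) < \<infinity>" .
  qed
  also have "\<dots> = (LINT s|lborel. taylor_kernel t s * (LINT v|J. (1 + v) * dunkl_deriv (\<eta> s v) (\<eta>' s v) z))"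
  proof (rule integral_cong_AE)
    interpret J: sigma_finite_measure J by (rule sigma_finite_J)
    show "(\<lambda>s. LINT v|J. (1 + v) * (taylor_kernel t s * dunkl_deriv (\<eta> z v) (\<eta>' z v) s)) \<in> borel_measurable lborel" by measurable
    show "(\<lambda>s. taylor_kernel t s * (LINT v|J. (1 + v) * dunkl_deriv (\<eta> s v) (\<eta>' s v) z)) \<in> borel_measurable lborel" by measurable
    show "AE s in lborel. (LINT v|J. (1 + v) * (taylor_kernel t s * dunkl_deriv (\<eta> z v) (\<eta>' z v) s)) = taylor_kernel t s * (LINT v|J. (1 + v) * dunkl_deriv (\<eta> s v) (\<eta>' s v) z)"
      using AE_lborel_singleton[of "0::real"]
    proof eventually_elim
      case (elim s)
      have "(LINT v|J. (1 + v) * (taylor_kernel t s * dunkl_deriv (\<eta> z v) (\<eta>' z v) s)) = taylor_kernel t s * (LINT v|J. (1 + v) * dunkl_deriv (\<eta> z v) (\<eta>' z v) s)"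
        by (simp only: mult.left_commute[of _ "taylor_kernel t s"] integral_mult_right_zero)
      \<comment> \<open>The Dunkl operator passes from the translation parameter to the space
        variable; the identity is one between averages over v, so the integral over v had to be
        moved inside first.\<close>
      then show ?case using integral_dunkl_deriv_\<eta>_commute[OF elim z] by simp
    qed
  qed
  finally show ?thesis .
qed

end

text \<open>The weak derivative is tested against \<open>\<eta> s v\<close> with v fixed and
  averaged over v afterwards, so smoothness is asked of these integrands.\<close>

locale admissible_profile = compact_profile +
  assumes test: "\<And>s v. \<bar>v\<bar> \<le> 1 \<Longrightarrow> test_function (\<lambda>z. of_real (\<eta> s v z))"
begin

text \<open>The dual of \<open>T_\<psi>_increment\<close>: the increment of f, paired with psi, is
  the increment of psi paired with f; its expansion is paired with f under the integrals over s and
  v, and each pairing is converted into one with g.\<close>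

lemma weak_taylor:
  assumes f: "f \<in> L" and g: "g \<in> L" and fg: "has_dunkl_derivative \<alpha> f g" and t: "t \<noteq> 0"
  shows "(LINT y|\<mu>. (T t f y - f y + (LINT s|lborel. taylor_kernel (- t) s *\<^sub>R T (- s) g y)) * \<psi> y) = 0"
    and "integrable \<mu> (\<lambda>y. (T t f y - f y + (LINT s|lborel. taylor_kernel (- t) s *\<^sub>R T (- s) g y)) * \<psi> y)"
proof -
  note [measurable] = Lp_memD(1)[OF f] Lp_memD(1)[OF g]
  interpret J: sigma_finite_measure J by (rule sigma_finite_J)
  interpret m: sigma_finite_measure \<mu> by (rule sigma_finite_mu)
  have t': "- t \<noteq> 0" using t by simp
  obtain C where C: "C \<ge> 0" "\<And>y. norm (\<psi> y) \<le> C" by (rule \<psi>_bound) blast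
  obtain B where B: "B \<ge> 0"
    "\<And>s v z. \<bar>s\<bar> \<le> \<bar>t\<bar> \<Longrightarrow> \<bar>v\<bar> \<le> 1 \<Longrightarrow> \<bar>\<eta> s v z\<bar> \<le> B * indicator {-(R+\<bar>t\<bar>)..R+\<bar>t\<bar>} z"
    "\<And>s v z. \<bar>s\<bar> \<le> \<bar>t\<bar> \<Longrightarrow> \<bar>v\<bar> \<le> 1 \<Longrightarrow> \<bar>dunkl_deriv (\<eta> s v) (\<eta>' s v) z\<bar> \<le> B * indicator {-(R+\<bar>t\<bar>)..R+\<bar>t\<bar>} z"
    by (rule \<eta>_bound[of "\<bar>t\<bar>"]) blast
  note P = T_pairing[OF t f \<psi>_measurable C(2) \<psi>_zero]
  have tkb: "taylor_kernel (- t) s = 0" if "\<bar>s\<bar> > \<bar>t\<bar>" for s using taylor_kernel_outside[of "-t" s] that by simp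
  have tkf: "(\<integral>\<^sup>+s. ennreal \<bar>taylor_kernel (- t) s\<bar> \<partial>lborel) < \<infinity>" using nn_integral_taylor_kernel[of "-t"] by (auto intro: le_less_trans)
  \<comment> \<open>Taken with c = -1, so that the adjoint translation is by s, the parameter that
    the expansion of psi produces.\<close>
  have A: "(LINT y|\<mu>. (LINT s|lborel. taylor_kernel (- t) s *\<^sub>R T (- 1 * s) g y) * \<psi> y) = (LINT s|lborel. taylor_kernel (- t) s *\<^sub>R (LINT z|\<mu>. g z * T (- (- 1 * s)) \<psi> z))"
      "integrable \<mu> (\<lambda>y. (LINT s|lborel. taylor_kernel (- t) s *\<^sub>R T (- 1 * s) g y) * \<psi> y)"
    by (rule average_pairing[OF sigma_finite_lborel _ AE_lborel_singleton[of 0] _ tkf tkb _ g \<psi>_measurable C(2) \<psi>_zero]; simp)+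
  have if': "integrable \<mu> (\<lambda>y. f y * \<psi> y)"
  proof (rule integrableI_bounded)
    have "(\<integral>\<^sup>+y. ennreal (norm (f y * \<psi> y)) \<partial>\<mu>) \<le> (\<integral>\<^sup>+y. ennreal C * ennreal (norm (f y) * indicator {-R..R} y) \<partial>\<mu>)"
    proof (rule nn_integral_mono)
      fix y
      have "norm (f y * \<psi> y) \<le> C * (norm (f y) * indicator {-R..R} y)"
        using C \<psi>_zero[of y] by (cases "\<bar>y\<bar> > R") (auto simp: norm_mult indicator_def abs_le_iff mult.commute[of C] intro!: mult_left_mono)
      then show "ennreal (norm (f y * \<psi> y)) \<le> ennreal C * ennreal (norm (f y) * indicator {-R..R} y)"
        using C by (simp add: ennreal_mult[symmetric] ennreal_leI)
    qed
    also have "\<dots> = ennreal C * loc_norm f R" unfolding loc_norm_def by (rule nn_integral_cmult) measurable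
    also have "\<dots> < \<infinity>" using L_local[OF f, of R] by (simp add: ennreal_mult_less_top)
    finally show "(\<integral>\<^sup>+y. ennreal (norm (f y * \<psi> y)) \<partial>\<mu>) < \<infinity>" .
  qed measurable
  have split: "(T t f y - f y + (LINT s|lborel. taylor_kernel (- t) s *\<^sub>R T (- s) g y)) * \<psi> y
    = T t f y * \<psi> y - f y * \<psi> y + (LINT s|lborel. taylor_kernel (- t) s *\<^sub>R T (- 1 * s) g y) * \<psi> y" for y
    by (simp add: algebra_simps)
  show "integrable \<mu> (\<lambda>y. (T t f y - f y + (LINT s|lborel. taylor_kernel (- t) s *\<^sub>R T (- s) g y)) * \<psi> y)"
    unfolding split by (intro Bochner_Integration.integrable_add Bochner_Integration.integrable_diff P(2) if' A(2))
  have bT: "integrable \<mu> (\<lambda>z. f z * T (- t) \<psi> z)"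
  proof (rule integrableI_bounded)
    have "(\<integral>\<^sup>+z. ennreal (norm (f z * T (- t) \<psi> z)) \<partial>\<mu>) \<le> (\<integral>\<^sup>+z. ennreal (4 * C) * ennreal (norm (f z) * indicator {-(R+\<bar>t\<bar>)..R+\<bar>t\<bar>} z) \<partial>\<mu>)"
    proof (rule nn_integral_mono_AE)
      show "AE z in \<mu>. ennreal (norm (f z * T (- t) \<psi> z)) \<le> ennreal (4 * C) * ennreal (norm (f z) * indicator {-(R+\<bar>t\<bar>)..R+\<bar>t\<bar>} z)"
        using AE_mu_nonzero
      proof eventually_elim
        case (elim z)
        have "norm (T (- t) \<psi> z) \<le> 4 * C * indicator {-(R + \<bar>-t\<bar>)..R + \<bar>-t\<bar>} z"
          by (rule T_bounded[OF t' elim C(2) \<psi>_zero])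
        then have "norm (f z) * norm (T (- t) \<psi> z) \<le> norm (f z) * (4 * C * indicator {-(R + \<bar>-t\<bar>)..R + \<bar>-t\<bar>} z)"
          by (rule mult_left_mono) simp
        then have "norm (f z * T (- t) \<psi> z) \<le> (4 * C) * (norm (f z) * indicator {-(R+\<bar>t\<bar>)..R+\<bar>t\<bar>} z)"
          by (simp add: norm_mult mult_ac)
        then show ?case using C by (simp add: ennreal_mult[symmetric] ennreal_leI)
      qed
    qed
    also have "\<dots> = ennreal (4 * C) * loc_norm f (R + \<bar>t\<bar>)" unfolding loc_norm_def by (rule nn_integral_cmult) measurable
    also have "\<dots> < \<infinity>" using L_local[OF f, of "R + \<bar>t\<bar>"] by (simp add: ennreal_mult_less_top)
    finally show "(\<integral>\<^sup>+z. ennreal (norm (f z * T (- t) \<psi> z)) \<partial>\<mu>) < \<infinity>" .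
  qed measurable
  define K where "K s z = (LINT v|J. (1 + v) * dunkl_deriv (\<eta> s v) (\<eta>' s v) z)" for s z
  \<comment> \<open>The adjoint of T t is T (-t); this is why the Taylor kernel appears with
    -t.\<close>
  have "(LINT y|\<mu>. T t f y * \<psi> y) - (LINT y|\<mu>. f y * \<psi> y) = (LINT z|\<mu>. f z * T (- t) \<psi> z - f z * \<psi> z)"
    using P(1) by (simp add: Bochner_Integration.integral_diff[OF bT if'])
  also have "\<dots> = (LINT z|\<mu>. f z * of_real (LINT s|lborel. taylor_kernel (- t) s * K s z))"
  proof (rule integral_cong_AE)
    show "AE z in \<mu>. f z * T (- t) \<psi> z - f z * \<psi> z = f z * of_real (LINT s|lborel. taylor_kernel (- t) s * K s z)"
      using AE_mu_nonzero
    proof eventually_elim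
      case (elim z)
      show ?case using T_\<psi>_increment[OF t' elim] by (simp only: right_diff_distrib[symmetric] K_def)
    qed
    show "(\<lambda>z. f z * T (- t) \<psi> z - f z * \<psi> z) \<in> borel_measurable \<mu>" by measurable
    show "(\<lambda>z. f z * of_real (LINT s|lborel. taylor_kernel (- t) s * K s z)) \<in> borel_measurable \<mu>" unfolding K_def by measurable
  qed
  also have "\<dots> = (LINT s|lborel. taylor_kernel (- t) s *\<^sub>R (LINT z|\<mu>. f z * of_real (K s z)))"
  proof (rule weighted_Fubini[OF f sigma_finite_lborel _ _ tkf])
    show "(\<lambda>(z, s). K s z) \<in> borel_measurable (borel \<Otimes>\<^sub>M borel)" unfolding K_def by measurable
    show "0 \<le> 2 * B" using B by simp
    show "AE s in lborel. taylor_kernel (- t) s \<noteq> 0 \<longrightarrow> (\<forall>z. \<bar>K s z\<bar> \<le> 2 * B * indicator {-(R+\<bar>t\<bar>)..R+\<bar>t\<bar>} z)"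
    proof (intro AE_I2 impI allI)
      fix s z assume "taylor_kernel (- t) s \<noteq> 0"
      then have s: "\<bar>s\<bar> \<le> \<bar>t\<bar>" using tkb[of s] by (auto simp: not_less[symmetric])
      have b1: "\<bar>(1 + v) * dunkl_deriv (\<eta> s v) (\<eta>' s v) z\<bar> \<le> 2 * B * indicator {-(R+\<bar>t\<bar>)..R+\<bar>t\<bar>} z" if v: "\<bar>v\<bar> \<le> 1" for v
      proof -
        have "\<bar>1 + v\<bar> * \<bar>dunkl_deriv (\<eta> s v) (\<eta>' s v) z\<bar> \<le> 2 * (B * indicator {-(R+\<bar>t\<bar>)..R+\<bar>t\<bar>} z)"
          using B(3)[OF s v, of z] v by (intro mult_mono) auto
        then show ?thesis by (simp add: abs_mult mult.assoc)
      qed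
      have "norm (K s z) \<le> (LINT v|J. norm ((1 + v) * dunkl_deriv (\<eta> s v) (\<eta>' s v) z))"
        unfolding K_def by (rule integral_norm_bound)
      also have "\<dots> \<le> (LINT v|J. 2 * B * indicator {-(R+\<bar>t\<bar>)..R+\<bar>t\<bar>} z)"
      proof (rule integral_mono_AE)
        show "integrable J (\<lambda>v. norm ((1 + v) * dunkl_deriv (\<eta> s v) (\<eta>' s v) z))"
          by (rule integrable_J_bounded[where B = "2 * B * indicator {-(R+\<bar>t\<bar>)..R+\<bar>t\<bar>} z"]) (use b1 in simp_all)
        show "AE v in J. norm ((1 + v) * dunkl_deriv (\<eta> s v) (\<eta>' s v) z) \<le> 2 * B * indicator {-(R+\<bar>t\<bar>)..R+\<bar>t\<bar>} z"
          using AE_J by eventually_elim (use b1 in simp)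
      qed (intro integrable_J_cont continuous_intros)
      finally show "\<bar>K s z\<bar> \<le> 2 * B * indicator {-(R+\<bar>t\<bar>)..R+\<bar>t\<bar>} z" by (simp add: measure_def emeasure_J)
    qed
  qed simp_all
  also have "\<dots> = (LINT s|lborel. taylor_kernel (- t) s *\<^sub>R (- (LINT z|\<mu>. g z * T s \<psi> z)))"
  proof (rule integral_cong_AE)
    show "(\<lambda>s. taylor_kernel (- t) s *\<^sub>R (LINT z|\<mu>. f z * of_real (K s z))) \<in> borel_measurable lborel" unfolding K_def by measurable
    show "(\<lambda>s. taylor_kernel (- t) s *\<^sub>R (- (LINT z|\<mu>. g z * T s \<psi> z))) \<in> borel_measurable lborel" by measurable
    show "AE s in lborel. taylor_kernel (- t) s *\<^sub>R (LINT z|\<mu>. f z * of_real (K s z)) = taylor_kernel (- t) s *\<^sub>R (- (LINT z|\<mu>. g z * T s \<psi> z))"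
      using AE_lborel_singleton[of "0::real"]
    proof eventually_elim
      case (elim s)
      show ?case
      proof (cases "\<bar>s\<bar> \<le> \<bar>t\<bar>")
        case True
        have bd1: "AE v in J. 1 + v \<noteq> 0 \<longrightarrow> (\<forall>z. \<bar>dunkl_deriv (\<eta> s v) (\<eta>' s v) z\<bar> \<le> B * indicator {-(R+\<bar>t\<bar>)..R+\<bar>t\<bar>} z)"
          using AE_J by eventually_elim (use B(3)[OF True] in blast)
        have bd2: "AE v in J. 1 + v \<noteq> 0 \<longrightarrow> (\<forall>z. \<bar>\<eta> s v z\<bar> \<le> B * indicator {-(R+\<bar>t\<bar>)..R+\<bar>t\<bar>} z)"
          using AE_J by eventually_elim (use B(2)[OF True] in blast)
        have "(LINT z|\<mu>. f z * of_real (K s z)) = (LINT v|J. (1 + v) *\<^sub>R (LINT z|\<mu>. f z * of_real (dunkl_deriv (\<eta> s v) (\<eta>' s v) z)))"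
          unfolding K_def by (rule weighted_Fubini[OF f sigma_finite_J sets_J _ nn_J_weight _ B(1) bd1]) measurable
        also have "\<dots> = (LINT v|J. (1 + v) *\<^sub>R (- (LINT z|\<mu>. g z * of_real (\<eta> s v z))))"
        proof (rule integral_cong_AE)
          show "AE v in J. (1 + v) *\<^sub>R (LINT z|\<mu>. f z * of_real (dunkl_deriv (\<eta> s v) (\<eta>' s v) z)) = (1 + v) *\<^sub>R (- (LINT z|\<mu>. g z * of_real (\<eta> s v z)))"
            using AE_J
          proof eventually_elim
            case (elim v)
            \<comment> \<open>The hypothesis that g is the weak derivative of f enters here, with
              \<open>\<eta> s v\<close> as the test function.\<close>
            have "(LINT z|\<mu>. f z * dunkl_op \<alpha> (\<lambda>z. of_real (\<eta> s v z)) z) = - (LINT z|\<mu>. g z * of_real (\<eta> s v z))"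
              using fg test[OF elim, of s] unfolding has_dunkl_derivative_def by blast
            then show ?case by (simp only: dunkl_op_\<eta>)
          qed
        qed measurable
        also have "\<dots> = - (LINT v|J. (1 + v) *\<^sub>R (LINT z|\<mu>. g z * of_real (\<eta> s v z)))" by simp
        also have "(LINT v|J. (1 + v) *\<^sub>R (LINT z|\<mu>. g z * of_real (\<eta> s v z))) = (LINT z|\<mu>. g z * of_real (LINT v|J. (1 + v) * \<eta> s v z))"
          by (rule weighted_Fubini[OF g sigma_finite_J sets_J _ nn_J_weight _ B(1) bd2, symmetric]) measurable
        also have "\<dots> = (LINT z|\<mu>. g z * T s \<psi> z)"
        proof (rule integral_cong_AE)
          show "AE z in \<mu>. g z * of_real (LINT v|J. (1 + v) * \<eta> s v z) = g z * T s \<psi> z"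
            using AE_mu_nonzero by eventually_elim (simp add: T_\<psi>[OF elim])
        qed measurable
        finally show ?thesis by simp
      qed (simp add: tkb)
    qed
  qed
  also have "\<dots> = - (LINT s|lborel. taylor_kernel (- t) s *\<^sub>R (LINT z|\<mu>. g z * T (- (- 1 * s)) \<psi> z))" by simp
  also have "\<dots> = - (LINT y|\<mu>. (LINT s|lborel. taylor_kernel (- t) s *\<^sub>R T (- 1 * s) g y) * \<psi> y)" unfolding A(1) ..
  finally have main: "(LINT y|\<mu>. T t f y * \<psi> y) - (LINT y|\<mu>. f y * \<psi> y) = - (LINT y|\<mu>. (LINT s|lborel. taylor_kernel (- t) s *\<^sub>R T (- 1 * s) g y) * \<psi> y)" .
  have "(LINT y|\<mu>. (T t f y - f y + (LINT s|lborel. taylor_kernel (- t) s *\<^sub>R T (- s) g y)) * \<psi> y)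
    = (LINT y|\<mu>. T t f y * \<psi> y) - (LINT y|\<mu>. f y * \<psi> y) + (LINT y|\<mu>. (LINT s|lborel. taylor_kernel (- t) s *\<^sub>R T (- 1 * s) g y) * \<psi> y)"
    unfolding split
  proof -
    have lin: "(LINT y|\<mu>. a y - b y + c y) = (LINT y|\<mu>. a y) - (LINT y|\<mu>. b y) + (LINT y|\<mu>. c y)"
      if "integrable \<mu> a" "integrable \<mu> b" "integrable \<mu> c" for a b c :: "real \<Rightarrow> complex"
      using that by simp
    show "(LINT y|\<mu>. T t f y * \<psi> y - f y * \<psi> y + (LINT s|lborel. taylor_kernel (- t) s *\<^sub>R T (- 1 * s) g y) * \<psi> y)
      = (LINT y|\<mu>. T t f y * \<psi> y) - (LINT y|\<mu>. f y * \<psi> y) + (LINT y|\<mu>. (LINT s|lborel. taylor_kernel (- t) s *\<^sub>R T (- 1 * s) g y) * \<psi> y)"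
      by (rule lin[OF P(2) if' A(2)])
  qed
  with main show "(LINT y|\<mu>. (T t f y - f y + (LINT s|lborel. taylor_kernel (- t) s *\<^sub>R T (- s) g y)) * \<psi> y) = 0" by simp
qed

end

section \<open>Increments of translations\<close>

lemma expinv_continuous: "continuous_on UNIV (expinv j)"
  using expinv_deriv by (intro continuous_at_imp_continuous_on ballI) (rule DERIV_isCont)

context dunkl_Lp begin

text \<open>A profile in u = z^2. As an even part it yields the moments z^(2m) times a smooth
  cut-off at |z| = r, as an odd part the moments z^(2m + 1).\<close>

definition bump :: "nat \<Rightarrow> real \<Rightarrow> real \<Rightarrow> real" where
  "bump m r u = u ^ m * expinv 0 (r\<^sup>2 - u)"
definition bump' :: "nat \<Rightarrow> real \<Rightarrow> real \<Rightarrow> real" where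
  "bump' m r u = real m * u ^ (m - 1) * expinv 0 (r\<^sup>2 - u) - u ^ m * expinv 2 (r\<^sup>2 - u)"

lemma bump_deriv: "(bump m r has_real_derivative bump' m r u) (at u)"
proof -
  have d: "((\<lambda>u. r\<^sup>2 - u) has_real_derivative -1) (at u)" by (auto intro!: derivative_eq_intros)
  show ?thesis unfolding bump_def[abs_def] bump'_def
    by (rule DERIV_cong, rule DERIV_mult[OF DERIV_pow DERIV_chain2[OF expinv_deriv d]]) (simp add: numeral_2_eq_2)
qed

lemma bump'_continuous: "continuous_on UNIV (bump' m r)"
  unfolding bump'_def by (auto intro!: continuous_intros continuous_on_compose2[OF expinv_continuous])

lemma bump_zero: "u > r\<^sup>2 \<Longrightarrow> bump m r u = 0" "u > r\<^sup>2 \<Longrightarrow> bump' m r u = 0"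
  by (simp_all add: bump_def bump'_def expinv_def)

text \<open>For fixed s and v the integrand is a polynomial in z times \<open>expinv 0\<close> of a
  polynomial in z, hence a member of \<open>bump_sum\<close>.\<close>

lemma bump_admissible:
  fixes a b r :: real
  assumes r: "r \<ge> 0"
  shows "admissible_profile \<alpha> p (\<lambda>u. a * bump m r u) (\<lambda>u. a * bump' m r u) (\<lambda>u. b * bump m r u) (\<lambda>u. b * bump' m r u) r"
proof -
  interpret C: compact_profile \<alpha> p "\<lambda>u. a * bump m r u" "\<lambda>u. a * bump' m r u" "\<lambda>u. b * bump m r u" "\<lambda>u. b * bump' m r u" r
    by unfold_locales (auto intro!: DERIV_cmult bump_deriv continuous_intros bump'_continuous simp: r bump_zero)
  show ?thesis
  proof unfold_locales
    fix s v :: real assume v: "\<bar>v\<bar> \<le> 1"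
    have id: "real_polynomial_function (\<lambda>z::real. z)"
      using real_polynomial_function.intros(1)[OF bounded_linear_ident] .
    have q: "real_polynomial_function (\<lambda>z::real. s\<^sup>2 + z\<^sup>2 + 2 * s * z * v)"
      by (intro real_polynomial_function.intros(2-) real_polynomial_function_power id)
    have "bump_sum (\<lambda>z. ((a + b * (s + z)) * (s\<^sup>2 + z\<^sup>2 + 2 * s * z * v) ^ m) * expinv 0 (r\<^sup>2 - (s\<^sup>2 + z\<^sup>2 + 2 * s * z * v)))"
      by (intro bump_sum.base real_polynomial_function_diff real_polynomial_function.intros(2-) real_polynomial_function_power q id)
    also have "(\<lambda>z. ((a + b * (s + z)) * (s\<^sup>2 + z\<^sup>2 + 2 * s * z * v) ^ m) * expinv 0 (r\<^sup>2 - (s\<^sup>2 + z\<^sup>2 + 2 * s * z * v))) = C.\<eta> s v"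
      unfolding C.\<eta>_def[abs_def] by (simp add: fun_eq_iff bump_def algebra_simps)
    finally have sm: "smooth (\<lambda>z. of_real (C.\<eta> s v z))" by (rule bump_sum_smooth)
    have "{z. complex_of_real (C.\<eta> s v z) \<noteq> 0} \<subseteq> {-(r + \<bar>s\<bar>)..r + \<bar>s\<bar>}"
      using C.\<eta>_zero[OF v, of s] by (force simp: abs_le_iff not_less[symmetric])
    then have "bounded {z. complex_of_real (C.\<eta> s v z) \<noteq> 0}" by (rule bounded_subset[rotated]) simp
    then show "test_function (\<lambda>z. of_real (C.\<eta> s v z))" using sm by (simp add: test_function_def compact_closure)
  qed
qed

text \<open>Multiplied by the cut-off and the density, the defect H has compact support and
  vanishing moments of every order. It is therefore zero wherever cut-off and density are
  positive.\<close>

lemma translation_taylor: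
  assumes f: "f \<in> L" and g: "g \<in> L" and fg: "has_dunkl_derivative \<alpha> f g" and t: "t \<noteq> 0"
  shows "AE y in \<mu>. T t f y - f y = - (LINT s|lborel. taylor_kernel (- t) s *\<^sub>R T (- s) g y)"
proof -
  note [measurable] = Lp_memD(1)[OF f] Lp_memD(1)[OF g]
  define H where "H y = T t f y - f y + (LINT s|lborel. taylor_kernel (- t) s *\<^sub>R T (- s) g y)" for y
  have [measurable]: "H \<in> borel_measurable borel" unfolding H_def by measurable
  have e0[measurable]: "expinv 0 \<in> borel_measurable borel" by (rule borel_measurable_continuous_onI[OF expinv_continuous])
  have main: "AE y in lborel. \<bar>y\<bar> < r \<longrightarrow> y \<noteq> 0 \<longrightarrow> H y = 0" if r: "r > 0" for r
  proof -
    have mom: "(LINT y|\<mu>. H y * of_real (y ^ i * expinv 0 (r\<^sup>2 - y\<^sup>2))) = 0 \<and> integrable \<mu> (\<lambda>y. H y * of_real (y ^ i * expinv 0 (r\<^sup>2 - y\<^sup>2)))" for i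
    proof -
      \<comment> \<open>A switch: even moments use the even part of the profile, odd ones the odd
        part, in both cases with exponent \<open>i div 2\<close>.\<close>
      define a where "a = (if even i then 1 else 0::real)"
      interpret A: admissible_profile \<alpha> p "\<lambda>u. a * bump (i div 2) r u" "\<lambda>u. a * bump' (i div 2) r u"
         "\<lambda>u. (1 - a) * bump (i div 2) r u" "\<lambda>u. (1 - a) * bump' (i div 2) r u" r
        using r by (intro bump_admissible) simp
      have "A.\<psi> y = of_real (y ^ i * expinv 0 (r\<^sup>2 - y\<^sup>2))" for y
      proof (cases "even i")
        case True
        then obtain k where "i = 2 * k" by (elim evenE)
        then show ?thesis unfolding A.\<psi>_def A.\<eta>_def unfolding bump_def a_def by (simp add: power_mult)
      next
        case False
        then obtain k where "i = 2 * k + 1" by (elim oddE)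
        then show ?thesis unfolding A.\<psi>_def A.\<eta>_def unfolding bump_def a_def by (simp add: power_mult)
      qed
      then show ?thesis using A.weak_taylor[OF f g fg t] unfolding H_def by simp
    qed
    define h where "h y = dens y *\<^sub>R (H y * of_real (expinv 0 (r\<^sup>2 - y\<^sup>2)))" for y
    have "AE y in lborel. h y = 0"
    proof (rule AE_zero_if_moments_zero[of _ r])
      show "integrable lborel h"
        using mom[of 0] by (subst (asm) integrable_mu) (auto simp: h_def[abs_def])
      show "h x = 0" if "\<bar>x\<bar> > r" for x
      proof -
        have "r\<^sup>2 < x\<^sup>2" using power_strict_mono[of r "\<bar>x\<bar>" 2] that r by simp
        then show ?thesis by (simp add: h_def expinv_def)
      qed
      fix n
      have "(LINT x|lborel. h x * of_real (x ^ n)) = (LINT y|\<mu>. H y * of_real (y ^ n * expinv 0 (r\<^sup>2 - y\<^sup>2)))"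
        by (subst integral_mu) (auto simp: h_def mult_ac)
      then show "(LINT x|lborel. h x * of_real (x ^ n)) = 0" using mom[of n] by simp
    qed
    then show ?thesis
    proof eventually_elim
      case (elim y)
      show ?case
      proof (intro impI)
        assume y: "\<bar>y\<bar> < r" "y \<noteq> 0"
        have "y\<^sup>2 < r\<^sup>2" using power_strict_mono[of "\<bar>y\<bar>" r 2] y r by simp
        then have "expinv 0 (r\<^sup>2 - y\<^sup>2) \<noteq> 0" by (simp add: expinv_def)
        then show "H y = 0" using elim dens_pos[OF y(2)] by (simp add: h_def)
      qed
    qed
  qed
  \<comment> \<open>Countably many radii exhaust the line, so the exceptional sets unite to a null
    set.\<close>
  have "AE y in lborel. \<forall>n::nat. \<bar>y\<bar> < real (Suc n) \<longrightarrow> y \<noteq> 0 \<longrightarrow> H y = 0"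
    by (subst AE_all_countable) (intro allI main, simp)
  then have "AE y in lborel. T t f y - f y = - (LINT s|lborel. taylor_kernel (- t) s *\<^sub>R T (- s) g y)"
    using AE_lborel_singleton[of "0::real"]
  proof eventually_elim
    case (elim y)
    obtain n where "\<bar>y\<bar> < real n" using reals_Archimedean2[of "\<bar>y\<bar>"] by blast
    then have "\<bar>y\<bar> < real (Suc n)" by simp
    then have "H y = 0" using elim by blast
    then show ?case by (simp add: H_def eq_neg_iff_add_eq_0)
  qed
  then show ?thesis by (simp add: AE_mu_iff)
qed

text \<open>Minkowski's integral inequality, obtained from Schur's test with a kernel that does not
  depend on y: A^(p - 1) * (A * D^p) = (A * D)^p.\<close>

lemma average_Lp:
  fixes b :: "real \<Rightarrow> real" and h :: "real \<Rightarrow> real \<Rightarrow> complex"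
  assumes M: "sigma_finite_measure M" "sets M = sets borel"
    and [measurable]: "b \<in> borel_measurable borel" "(\<lambda>(y,s). h y s) \<in> borel_measurable (borel \<Otimes>\<^sub>M borel)"
    and A: "A \<ge> 0" "(\<integral>\<^sup>+s. ennreal \<bar>b s\<bar> \<partial>M) \<le> ennreal A" and D: "D \<ge> 0"
    and hD: "AE s in M. b s \<noteq> 0 \<longrightarrow> (\<lambda>y. h y s) \<in> L \<and> Lp_norm \<alpha> p (\<lambda>y. h y s) \<le> D"
  shows "AE y in \<mu>. integrable M (\<lambda>s. b s *\<^sub>R h y s)"
    and "(\<lambda>y. LINT s|M. b s *\<^sub>R h y s) \<in> L"
    and "Lp_norm \<alpha> p (\<lambda>y. LINT s|M. b s *\<^sub>R h y s) \<le> A * D"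
proof -
  note [measurable_cong] = M(2)
  interpret M: sigma_finite_measure M by (rule M(1))
  interpret sigma_finite_measure \<mu> by (rule sigma_finite_mu)
  interpret PP: pair_sigma_finite \<mu> M ..
  have mK: "(\<lambda>(y,s). b s) \<in> borel_measurable (\<mu> \<Otimes>\<^sub>M M)" and mh: "(\<lambda>(y,s). h y s) \<in> borel_measurable (\<mu> \<Otimes>\<^sub>M M)"
    by measurable
  have "(\<integral>\<^sup>+y. \<integral>\<^sup>+s. ennreal (\<bar>b s\<bar> * norm (h y s) powr p) \<partial>M \<partial>\<mu>) = (\<integral>\<^sup>+s. \<integral>\<^sup>+y. ennreal (\<bar>b s\<bar> * norm (h y s) powr p) \<partial>\<mu> \<partial>M)"
    by (rule PP.Fubini'[symmetric]) measurable
  also have "\<dots> \<le> (\<integral>\<^sup>+s. ennreal \<bar>b s\<bar> * ennreal (D powr p) \<partial>M)"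
  proof (rule nn_integral_mono_AE)
    show "AE s in M. (\<integral>\<^sup>+y. ennreal (\<bar>b s\<bar> * norm (h y s) powr p) \<partial>\<mu>) \<le> ennreal \<bar>b s\<bar> * ennreal (D powr p)"
      using hD
    proof eventually_elim
      case (elim s)
      show ?case
      proof (cases "b s = 0")
        case False
        then have hs: "(\<lambda>y. h y s) \<in> L" "Lp_norm \<alpha> p (\<lambda>y. h y s) \<le> D" using elim by auto
        have "(\<integral>\<^sup>+y. ennreal (\<bar>b s\<bar> * norm (h y s) powr p) \<partial>\<mu>) = ennreal \<bar>b s\<bar> * (\<integral>\<^sup>+y. ennreal (norm (h y s) powr p) \<partial>\<mu>)"
          by (simp add: ennreal_mult nn_integral_cmult)
        also have "(\<integral>\<^sup>+y. ennreal (norm (h y s) powr p) \<partial>\<mu>) = ennreal (Ip (\<lambda>y. h y s))"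
          unfolding Ip_def by (rule nn_integral_eq_integral) (use Lp_memD(2)[OF hs(1)] in auto)
        also have "ennreal \<bar>b s\<bar> * \<dots> \<le> ennreal \<bar>b s\<bar> * ennreal (D powr p)"
          unfolding Ip_eq using hs(2) p by (intro mult_left_mono ennreal_leI powr_mono2) auto
        finally show ?thesis .
      qed simp
    qed
  qed
  also have "\<dots> = (\<integral>\<^sup>+s. ennreal \<bar>b s\<bar> \<partial>M) * ennreal (D powr p)" by (rule nn_integral_multc) measurable
  also have "\<dots> \<le> ennreal A * ennreal (D powr p)" by (rule mult_right_mono[OF A(2)]) simp
  also have "\<dots> = ennreal (A * D powr p)" using A by (simp add: ennreal_mult)
  finally have B: "(\<integral>\<^sup>+y. \<integral>\<^sup>+s. ennreal (\<bar>b s\<bar> * norm (h y s) powr p) \<partial>M \<partial>\<mu>) \<le> ennreal (A * D powr p)" .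
  have A': "AE y in \<mu>. (\<integral>\<^sup>+s. ennreal \<bar>b s\<bar> \<partial>M) \<le> ennreal A" using A by simp
  have B0: "0 \<le> A * D powr p" using A by simp
  note S = schur_kernel[OF p M(1) mK mh A(1) A' B0 B]
  show "AE y in \<mu>. integrable M (\<lambda>s. b s *\<^sub>R h y s)" by (rule S(1))
  have S2: "(\<lambda>y. LINT s|M. b s *\<^sub>R h y s) \<in> borel_measurable borel" using S(2) by simp
  show "(\<lambda>y. LINT s|M. b s *\<^sub>R h y s) \<in> L" by (rule Lp_memI[OF S2 S(3)])
  have "A powr (p - 1) * (A * D powr p) = (A * D) powr p"
    using A D by (cases "A = 0") (simp_all add: powr_diff powr_mult)
  then have "Ip (\<lambda>y. LINT s|M. b s *\<^sub>R h y s) \<le> (A * D) powr p" using S(4) by (simp add: Ip_def)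
  then have "Ip (\<lambda>y. LINT s|M. b s *\<^sub>R h y s) powr (1/p) \<le> ((A * D) powr p) powr (1/p)" using p by (intro powr_mono2) auto
  then show "Lp_norm \<alpha> p (\<lambda>y. LINT s|M. b s *\<^sub>R h y s) \<le> A * D"
    using A D p by (simp add: Lp_norm_eq powr_powr)
qed

text \<open>The 8 is the L^1 bound 2 * |t| of the Taylor kernel, divided by |t|, times the operator
  bound 4 of the translations.\<close>

lemma translation_difference_bound:
  assumes f: "f \<in> L" and g: "g \<in> L" and fg: "has_dunkl_derivative \<alpha> f g"
  shows "Lp_norm \<alpha> p (\<lambda>y. T t f y - f y) \<le> 8 * \<bar>t\<bar> * Lp_norm \<alpha> p g"
proof (cases "t = 0")
  case True
  then show ?thesis using p by (simp add: T_def Lp_norm_def)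
next
  case False
  note [measurable] = Lp_memD(1)[OF f] Lp_memD(1)[OF g]
  define A where "A y = (LINT s|lborel. taylor_kernel (- t) s *\<^sub>R T (- s) g y)" for y
  have m: "(\<lambda>(y,s). T (- s) g y) \<in> borel_measurable (borel \<Otimes>\<^sub>M borel)" by measurable
  have b: "(\<integral>\<^sup>+s. ennreal \<bar>taylor_kernel (- t) s\<bar> \<partial>lborel) \<le> ennreal (2 * \<bar>t\<bar>)" using nn_integral_taylor_kernel[of "-t"] by simp
  have hD: "AE s in lborel. taylor_kernel (- t) s \<noteq> 0 \<longrightarrow> (\<lambda>y. T (- s) g y) \<in> L \<and> Lp_norm \<alpha> p (\<lambda>y. T (- s) g y) \<le> 4 * Lp_norm \<alpha> p g"
    using T_L(1)[OF g] T_norm[OF g] by simp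
  have t0: "0 \<le> 2 * \<bar>t\<bar>" and g0: "0 \<le> 4 * Lp_norm \<alpha> p g" by simp_all
  note AL = average_Lp[OF sigma_finite_lborel sets_lborel taylor_kernel_measurable m t0 b g0 hD, folded A_def]
  have AL2: "A \<in> L" "Lp_norm \<alpha> p A \<le> 2 * \<bar>t\<bar> * (4 * Lp_norm \<alpha> p g)" using AL(2,3) by (simp_all add: A_def[abs_def])
  have "Lp_norm \<alpha> p (\<lambda>y. T t f y - f y) = Lp_norm \<alpha> p (\<lambda>y. (-1) * A y)"
    by (rule Ip_cong_AE(2)) (use translation_taylor[OF f g fg False] in \<open>auto simp: A_def intro!: Lp_memD L_diff T_L f\<close>)
  also have "\<dots> = Lp_norm \<alpha> p A" using L_cmult(3)[OF AL2(1), of "-1"] by simp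
  also have "\<dots> \<le> 8 * \<bar>t\<bar> * Lp_norm \<alpha> p g" using AL2(2) by simp
  finally show ?thesis .
qed

end

section \<open>Mollification\<close>

lemma test_function_C1:
  assumes "test_function \<phi>"
  obtains \<phi>' r where "\<And>x. (\<phi> has_vector_derivative \<phi>' x) (at x)" "continuous_on UNIV \<phi>'"
    "\<And>x. \<bar>x\<bar> > r \<Longrightarrow> \<phi> x = 0" "\<And>x. \<bar>x\<bar> > r \<Longrightarrow> \<phi>' x = 0"
proof -
  define \<phi>' where "\<phi>' x = vector_derivative \<phi> (at x)" for x
  have sm: "((\<lambda>g y. vector_derivative g (at y)) ^^ n) \<phi> differentiable (at x)" for n x
    using assms by (simp add: test_function_def smooth_def)
  have d: "(\<phi> has_vector_derivative \<phi>' x) (at x)" for x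
    using sm[of 0 x] by (simp add: vector_derivative_works \<phi>'_def)
  have "\<phi>' differentiable (at x)" for x using sm[of 1 x] by (simp add: \<phi>'_def[abs_def])
  then have c: "continuous_on UNIV \<phi>'"
    by (intro continuous_at_imp_continuous_on ballI differentiable_imp_continuous_within)
  have "bounded (closure {x. \<phi> x \<noteq> 0})" using assms by (simp add: test_function_def compact_imp_bounded)
  then have "bounded {x. \<phi> x \<noteq> 0}" using bounded_subset closure_subset by blast
  then obtain r where r: "\<And>x. \<phi> x \<noteq> 0 \<Longrightarrow> \<bar>x\<bar> \<le> r" unfolding bounded_iff by auto
  have z: "\<phi> x = 0" if "\<bar>x\<bar> > r" for x using r[of x] that by fastforce
  have z': "\<phi>' x = 0" if x: "\<bar>x\<bar> > r" for x
  proof -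
    have "open {y::real. \<bar>y\<bar> > r}" by (intro open_Collect_less continuous_intros)
    then have "(\<phi> has_vector_derivative 0) (at x)"
      using has_vector_derivative_transform_within_open[of "\<lambda>_. 0" 0 x "{y. \<bar>y\<bar> > r}" \<phi>] x z by auto
    then show ?thesis using d[of x] vector_derivative_unique_at by blast
  qed
  show thesis by (rule that[OF d c z z'])
qed

text \<open>At 0 the difference quotient is again a positive power of \<open>max 0 h\<close> and
  tends to 0; from the second power on, the positive part is of class C^1.\<close>

lemma pos_part_power_deriv:
  "((\<lambda>x::real. max 0 x ^ Suc (Suc n)) has_real_derivative real (Suc (Suc n)) * max 0 x ^ Suc n) (at x)"
proof -
  consider "x > 0" | "x < 0" | "x = 0" by linarith
  then show ?thesis
  proof cases
    case 1
    have "((\<lambda>x. x ^ Suc (Suc n)) has_real_derivative real (Suc (Suc n)) * x ^ Suc n) (at x)"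
      using DERIV_pow[of "Suc (Suc n)" x UNIV] by simp
    moreover have "\<forall>\<^sub>F y in nhds x. y ^ Suc (Suc n) = max 0 y ^ Suc (Suc n)"
      by (rule eventually_mono[OF eventually_nhds_in_open[of "{0<..}" x]]) (use 1 in auto)
    ultimately show ?thesis using 1 by (subst (asm) DERIV_cong_ev[OF refl _ refl]) auto
  next
    case 2
    have "((\<lambda>x. 0) has_real_derivative 0) (at x)" by (rule DERIV_const)
    moreover have "\<forall>\<^sub>F y in nhds x. 0 = max 0 y ^ Suc (Suc n)"
      by (rule eventually_mono[OF eventually_nhds_in_open[of "{..<0}" x]]) (use 2 in auto)
    ultimately show ?thesis using 2 by (subst (asm) DERIV_cong_ev[OF refl _ refl]) auto
  next
    case 3
    have "((\<lambda>h::real. max 0 h ^ Suc n) \<longlongrightarrow> max 0 0 ^ Suc n) (at 0)" by (intro tendsto_intros)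
    moreover have "(\<lambda>h. (max 0 (0 + h) ^ Suc (Suc n) - max 0 0 ^ Suc (Suc n)) / (h::real)) = (\<lambda>h. max 0 h ^ Suc n)"
      by (auto simp: fun_eq_iff max_def)
    ultimately show ?thesis using 3 by (simp only: DERIV_def) simp
  qed
qed

section \<open>Dunkl convolution with a profile as an integral operator\<close>

context compact_profile begin

lemma integral_W_profile:
  assumes y: "y \<noteq> 0" and z: "z \<noteq> 0"
  shows "(LINT x|\<mu>. W (- y) z x * \<eta> 0 0 x) = (LINT v|J. (1 + v) * \<eta> (- y) v z)"
  using W_even_odd[of "- y" z E G] y z cE cG by (simp add: \<eta>_def)

text \<open>Adjointness moves the translation from f to xi, and the symmetries of W move it on to
  the profile. The convolution thereby has a kernel that is itself a translate of the profile and
  can be differentiated.\<close>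

lemma average_kernel:
  fixes \<xi> :: "real \<Rightarrow> complex"
  assumes f: "f \<in> L" and [measurable]: "\<xi> \<in> borel_measurable borel"
    and B: "\<And>y. norm (\<xi> y) \<le> B" and r: "\<And>y. \<bar>y\<bar> > r \<Longrightarrow> \<xi> y = 0"
  shows "(LINT y|\<mu>. (LINT x|\<mu>. \<eta> 0 0 x *\<^sub>R T x f y) * \<xi> y)
    = (LINT z|\<mu>. f z * (LINT y|\<mu>. \<xi> y * of_real (LINT v|J. (1 + v) * \<eta> (- y) v z)))"
proof -
  note [measurable] = Lp_memD(1)[OF f]
  interpret J: sigma_finite_measure J by (rule sigma_finite_J)
  interpret m: sigma_finite_measure \<mu> by (rule sigma_finite_mu)
  define b where "b = \<eta> 0 0"
  have [measurable]: "b \<in> borel_measurable borel" unfolding b_def by measurable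
  have b0: "b x = 0" if "\<bar>x\<bar> > R" for x using \<eta>_zero[of 0 0 x] that by (simp add: b_def)
  obtain C where C: "C \<ge> 0" "\<And>y. norm (\<psi> y) \<le> C" by (rule \<psi>_bound) blast
  have bC: "\<bar>b x\<bar> \<le> C" for x using C(2)[of x] by (simp add: \<psi>_def b_def)
  have "integrable \<mu> b" by (rule integrable_mu_bounded[of _ C R]) (use bC b0 in auto)
  then have bf: "(\<integral>\<^sup>+x. ennreal \<bar>b x\<bar> \<partial>\<mu>) < \<infinity>" using integrable_iff_bounded[of \<mu> b] by simp
  have B0: "B \<ge> 0" using B norm_ge_zero order_trans by blast
  have "(LINT y|\<mu>. (LINT x|\<mu>. b x *\<^sub>R T (1 * x) f y) * \<xi> y) = (LINT x|\<mu>. b x *\<^sub>R (LINT z|\<mu>. f z * T (- (1 * x)) \<xi> z))"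
    by (rule average_pairing(1)[OF sigma_finite_mu sets_mu AE_mu_nonzero _ bf b0 _ f _ B r]) simp_all
  also have "\<dots> = (LINT z|\<mu>. f z * (LINT x|\<mu>. b x *\<^sub>R T (- (1 * x)) \<xi> z))"
  proof (rule weighted_Fubini_complex[OF f sigma_finite_mu sets_mu _ bf, symmetric])
    show "0 \<le> 4 * B" using B0 by simp
    fix z :: real assume z: "z \<noteq> 0"
    show "AE x in \<mu>. b x \<noteq> 0 \<longrightarrow> norm (T (- (1 * x)) \<xi> z) \<le> 4 * B * indicator {-(r + R)..r + R} z"
      using AE_mu_nonzero
    proof eventually_elim
      case (elim x)
      show ?case
      proof
        assume "b x \<noteq> 0"
        then have x: "\<bar>x\<bar> \<le> R" using b0[of x] by (auto simp: not_less[symmetric])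
        have "norm (T (- (1 * x)) \<xi> z) \<le> 4 * B * indicator {-(r + \<bar>- (1 * x)\<bar>)..r + \<bar>- (1 * x)\<bar>} z"
          by (rule T_bounded[OF _ z B r]) (use elim in auto)
        also have "\<dots> \<le> 4 * B * indicator {-(r + R)..r + R} z"
          using x B0 by (intro mult_left_mono) (auto simp: indicator_def)
        finally show "norm (T (- (1 * x)) \<xi> z) \<le> 4 * B * indicator {-(r + R)..r + R} z" .
      qed
    qed
  qed measurable
  also have "\<dots> = (LINT z|\<mu>. f z * (LINT y|\<mu>. \<xi> y * of_real (LINT v|J. (1 + v) * \<eta> (- y) v z)))"
  proof (rule integral_cong_AE)
    show "AE z in \<mu>. f z * (LINT x|\<mu>. b x *\<^sub>R T (- (1 * x)) \<xi> z) = f z * (LINT y|\<mu>. \<xi> y * of_real (LINT v|J. (1 + v) * \<eta> (- y) v z))"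
      using AE_mu_nonzero
    proof eventually_elim
      case (elim z)
      define H where "H x y = b x *\<^sub>R (W (- x) z y *\<^sub>R \<xi> y)" for x y
      have m: "(\<lambda>(x,y). H x y) \<in> borel_measurable (\<mu> \<Otimes>\<^sub>M \<mu>)" unfolding H_def by measurable
      have "(\<integral>\<^sup>+x. \<integral>\<^sup>+y. ennreal (norm (H x y)) \<partial>\<mu> \<partial>\<mu>) \<le> (\<integral>\<^sup>+x. ennreal \<bar>b x\<bar> * ennreal (4 * B) \<partial>\<mu>)"
      proof (rule nn_integral_mono_AE)
        show "AE x in \<mu>. (\<integral>\<^sup>+y. ennreal (norm (H x y)) \<partial>\<mu>) \<le> ennreal \<bar>b x\<bar> * ennreal (4 * B)"
          using AE_mu_nonzero
        proof eventually_elim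
          case x: (elim x)
          have "(\<integral>\<^sup>+y. ennreal (norm (H x y)) \<partial>\<mu>) \<le> (\<integral>\<^sup>+y. ennreal \<bar>W (- x) z y\<bar> * (ennreal \<bar>b x\<bar> * ennreal B) \<partial>\<mu>)"
          proof (rule nn_integral_mono)
            fix y
            have "\<bar>b x\<bar> * (\<bar>W (- x) z y\<bar> * norm (\<xi> y)) \<le> \<bar>b x\<bar> * (\<bar>W (- x) z y\<bar> * B)"
              using B by (intro mult_left_mono) auto
            then have "ennreal (norm (H x y)) \<le> ennreal (\<bar>b x\<bar> * (\<bar>W (- x) z y\<bar> * B))"
              unfolding H_def norm_scaleR by (rule ennreal_leI)
            also have "\<dots> = ennreal \<bar>W (- x) z y\<bar> * (ennreal \<bar>b x\<bar> * ennreal B)"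
              using B0 by (simp add: ennreal_mult mult_ac)
            finally show "ennreal (norm (H x y)) \<le> ennreal \<bar>W (- x) z y\<bar> * (ennreal \<bar>b x\<bar> * ennreal B)" .
          qed
          also have "\<dots> = (\<integral>\<^sup>+y. ennreal \<bar>W (- x) z y\<bar> \<partial>\<mu>) * (ennreal \<bar>b x\<bar> * ennreal B)"
            by (rule nn_integral_multc) measurable
          also have "\<dots> \<le> 4 * (ennreal \<bar>b x\<bar> * ennreal B)"
            using W_bound[of "- x" z] x elim by (intro mult_right_mono) auto
          also have "\<dots> = ennreal \<bar>b x\<bar> * ennreal (4 * B)" using B0 by (simp add: ennreal_mult mult_ac)
          finally show ?case .
        qed
      qed
      also have "\<dots> = (\<integral>\<^sup>+x. ennreal \<bar>b x\<bar> \<partial>\<mu>) * ennreal (4 * B)" by (rule nn_integral_multc) measurable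
      also have "\<dots> < \<infinity>" using bf by (simp add: ennreal_mult_less_top)
      finally have fin: "(\<integral>\<^sup>+x. \<integral>\<^sup>+y. ennreal (norm (H x y)) \<partial>\<mu> \<partial>\<mu>) < \<infinity>" .
      have "(LINT x|\<mu>. b x *\<^sub>R T (- (1 * x)) \<xi> z) = (LINT x|\<mu>. LINT y|\<mu>. H x y)"
      proof (rule integral_cong_AE)
        show "AE x in \<mu>. b x *\<^sub>R T (- (1 * x)) \<xi> z = (LINT y|\<mu>. H x y)"
          using AE_mu_nonzero
        proof eventually_elim
          case (elim x)
          then show ?case unfolding H_def integral_scaleR_right by (simp add: T_def)
        qed
        show "(\<lambda>x. LINT y|\<mu>. H x y) \<in> borel_measurable \<mu>" unfolding H_def by measurable
      qed measurable
      also have "\<dots> = (LINT y|\<mu>. LINT x|\<mu>. H x y)" by (rule Fubini_swap(1)[OF sigma_finite_mu sigma_finite_mu m fin])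
      also have "\<dots> = (LINT y|\<mu>. \<xi> y * of_real (LINT v|J. (1 + v) * \<eta> (- y) v z))"
      proof (rule integral_cong_AE)
        show "AE y in \<mu>. (LINT x|\<mu>. H x y) = \<xi> y * of_real (LINT v|J. (1 + v) * \<eta> (- y) v z)"
          using AE_mu_nonzero
        proof eventually_elim
          case y: (elim y)
          have "(LINT x|\<mu>. H x y) = (LINT x|\<mu>. \<xi> y * of_real (W (- y) z x * b x))"
          proof (rule integral_cong_AE)
            show "AE x in \<mu>. H x y = \<xi> y * of_real (W (- y) z x * b x)"
              using AE_mu_nonzero
            proof eventually_elim
              case x: (elim x)
              \<comment> \<open>Both sides equal \<open>W x y z\<close>. This makes x the variable
                in which the translate of the profile is integrated.\<close>
              have "W (- x) z y = W (- y) z x" using W_swap[OF x y elim] W_rot[OF x y elim] by simp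
              then show ?case by (simp add: H_def scaleR_conv_of_real)
            qed
            show "(\<lambda>x. H x y) \<in> borel_measurable \<mu>" unfolding H_def by measurable
          qed measurable
          also have "\<dots> = \<xi> y * of_real (LINT x|\<mu>. W (- y) z x * b x)"
            by (simp only: integral_mult_right_zero integral_complex_of_real)
          finally show ?case by (simp only: b_def integral_W_profile[OF y elim])
        qed
        show "(\<lambda>y. LINT x|\<mu>. H x y) \<in> borel_measurable \<mu>" unfolding H_def by measurable
      qed measurable
      finally show ?case by simp
    qed
  qed measurable
  finally show ?thesis by (simp add: b_def)
qed

end

section \<open>The mollifier and the Dunkl derivative of the mollified function\<close>

context dunkl_Lp begin

(* The third power makes the mollifier and, up to the factor x, its derivative profiles of class C^1. *)
definition mollifier :: "real \<Rightarrow> real \<Rightarrow> real" where "mollifier t x = max 0 (1 - x\<^sup>2 / t\<^sup>2) ^ 3"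
definition mollifier_base :: "real \<Rightarrow> real \<Rightarrow> real" where "mollifier_base t x = max 0 (1 - x\<^sup>2 / t\<^sup>2)"

lemma mollifier_le: "0 \<le> mollifier_base t x" "mollifier_base t x \<le> 1" "0 \<le> mollifier t x" "mollifier t x \<le> 1"
  unfolding mollifier_def mollifier_base_def by (auto intro!: power_le_one)

lemma mollifier_base_zero: "t > 0 \<Longrightarrow> \<bar>x\<bar> > t \<Longrightarrow> mollifier_base t x = 0"
  using power_strict_mono[of t "\<bar>x\<bar>" 2] by (simp add: mollifier_base_def)

lemma mollifier_eq: "mollifier t x = mollifier_base t x ^ 3" by (simp add: mollifier_def mollifier_base_def)

lemma mollifier_measurable[measurable]: "mollifier t \<in> borel_measurable borel" "mollifier_base t \<in> borel_measurable borel"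
  unfolding mollifier_def[abs_def] mollifier_base_def[abs_def] by measurable

lemma mollifier_integrable: "t > 0 \<Longrightarrow> integrable \<mu> (mollifier t)" "t > 0 \<Longrightarrow> integrable \<mu> (mollifier_base t)"
  by (rule integrable_mu_bounded[of _ 1 t]; simp add: mollifier_le mollifier_base_zero mollifier_eq power_le_one)+

text \<open>The measure is homogeneous of degree 2 alpha + 2: one from dx and 2 alpha + 1 from the
  density.\<close>

lemma mu_scale:
  fixes h :: "real \<Rightarrow> real"
  assumes t: "t > 0" and [measurable]: "h \<in> borel_measurable borel"
  shows "(LINT x|\<mu>. h (x / t)) = t powr (\<kappa> + 1) * (LINT x|\<mu>. h x)"
proof -
  have "(LINT x|\<mu>. h (x / t)) = (LINT x|lborel. dens x *\<^sub>R h (x / t))" by (subst integral_mu) auto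
  also have "\<dots> = t * (LINT x|lborel. dens (t * x) *\<^sub>R h x)"
    using t by (subst lborel_integral_real_affine[of t _ 0]) auto
  also have "(LINT x|lborel. dens (t * x) *\<^sub>R h x) = (LINT x|lborel. t powr \<kappa> * (dens x *\<^sub>R h x))"
    using t by (intro Bochner_Integration.integral_cong) (auto simp: dens_def abs_mult powr_mult)
  also have "\<dots> = t powr \<kappa> * (LINT x|\<mu>. h x)" by (subst integral_mu) auto
  finally have "(LINT x|\<mu>. h (x / t)) = t * (t powr \<kappa> * (LINT x|\<mu>. h x))" .
  moreover have "t powr (\<kappa> + 1) = t powr \<kappa> * t" using t by (simp only: powr_add powr_one less_imp_le)
  ultimately show ?thesis by (simp only: mult_ac)
qed

lemma mollifier_scale: "t > 0 \<Longrightarrow> mollifier t x = mollifier 1 (x / t)" "t > 0 \<Longrightarrow> mollifier_base t x = mollifier_base 1 (x / t)"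
  by (simp_all add: mollifier_def mollifier_base_def power_divide)

lemma mollifier_pos: "t > 0 \<Longrightarrow> (LINT x|\<mu>. mollifier t x) > 0"
proof -
  assume t: "t > 0"
  have "(LINT x|\<mu>. mollifier t x) \<noteq> 0"
  proof
    assume "(LINT x|\<mu>. mollifier t x) = 0"
    then have "AE x in \<mu>. mollifier t x = 0"
      using integral_nonneg_eq_0_iff_AE[OF mollifier_integrable(1)[OF t]] mollifier_le by simp
    then have "AE x in lborel. x \<notin> {0<..<t}"
      unfolding AE_mu_iff
    proof eventually_elim
      case (elim x)
      show ?case
      proof
        assume "x \<in> {0<..<t}"
        then have "x\<^sup>2 < t\<^sup>2" by (intro power_strict_mono) auto
        then show False using elim t by (auto simp: mollifier_def divide_less_eq)
      qed
    qed
    then have "emeasure lborel {0<..<t} = 0" by (subst (asm) AE_iff_measurable[of "{0<..<t}"]) auto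
    then show False using t by simp
  qed
  moreover have "(LINT x|\<mu>. mollifier t x) \<ge> 0" using mollifier_le by (intro integral_nonneg_AE) auto
  ultimately show ?thesis by linarith
qed

text \<open>The 6 is 3 * 2, from the cube and the square in the mollifier. The number bounds t times
  the L^1 norm of the derivative of the mollifier of width t and mass 1, for every t.\<close>

definition mollifier_const :: real where "mollifier_const = 6 * (LINT x|\<mu>. mollifier_base 1 x) / (LINT x|\<mu>. mollifier 1 x)"

lemma mollifier_const_nonneg: "mollifier_const \<ge> 0"
  unfolding mollifier_const_def using mollifier_pos[of 1] mollifier_le by (intro divide_nonneg_pos mult_nonneg_nonneg integral_nonneg_AE) auto

lemma integral_odd:
  fixes h :: "real \<Rightarrow> real"
  assumes [measurable]: "h \<in> borel_measurable borel" and odd: "\<And>x. h (- x) = - h x"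
  shows "(LINT x|\<mu>. h x) = 0"
proof -
  have "(LINT x|\<mu>. h x) = (LINT x|lborel. dens x *\<^sub>R h x)" by (rule integral_mu) measurable
  also have "\<dots> = (LINT x|lborel. dens (- x) *\<^sub>R h (- x))" by (subst lborel_integral_real_affine[of "-1" _ 0]) auto
  also have "\<dots> = - (LINT x|\<mu>. h x)" by (subst integral_mu) (simp_all add: odd)
  finally show ?thesis by simp
qed

text \<open>Subtracting the mass of b times f turns an average of translates into an average of
  increments, all with |x| <= t and hence bounded by w. Mass 1 gives the approximation error, mass 0
  the derivative.\<close>

lemma average_minus:
  fixes b :: "real \<Rightarrow> real"
  assumes f: "f \<in> L" and [measurable]: "b \<in> borel_measurable borel" and b0: "\<And>x. \<bar>x\<bar> > t \<Longrightarrow> b x = 0"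
    and ib: "integrable \<mu> b" and A: "(LINT x|\<mu>. \<bar>b x\<bar>) \<le> A"
    and w: "w \<ge> 0" "\<And>x. \<bar>x\<bar> \<le> t \<Longrightarrow> Lp_norm \<alpha> p (\<lambda>y. T x f y - f y) \<le> w"
  shows "(\<lambda>y. LINT x|\<mu>. b x *\<^sub>R T x f y) \<in> L"
    and "Lp_norm \<alpha> p (\<lambda>y. (LINT x|\<mu>. b x *\<^sub>R T x f y) - (LINT x|\<mu>. b x) *\<^sub>R f y) \<le> A * w"
proof -
  note [measurable] = Lp_memD(1)[OF f]
  interpret m: sigma_finite_measure \<mu> by (rule sigma_finite_mu)
  have A0: "A \<ge> 0" by (rule order_trans[OF _ A]) (auto intro: integral_nonneg_AE)
  have nb: "(\<integral>\<^sup>+x. ennreal \<bar>b x\<bar> \<partial>\<mu>) \<le> ennreal A"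
    using nn_integral_eq_integral[OF integrable_abs[OF ib]] A by (simp add: ennreal_leI)
  have m1: "(\<lambda>(y,x). T x f y) \<in> borel_measurable (borel \<Otimes>\<^sub>M borel)" by measurable
  have m2: "(\<lambda>(y,x). T x f y - f y) \<in> borel_measurable (borel \<Otimes>\<^sub>M borel)" by measurable
  have h1: "AE x in \<mu>. b x \<noteq> 0 \<longrightarrow> (\<lambda>y. T x f y) \<in> L \<and> Lp_norm \<alpha> p (\<lambda>y. T x f y) \<le> 4 * Lp_norm \<alpha> p f"
    using T_L(1)[OF f] T_norm[OF f] by simp
  have f0: "0 \<le> 4 * Lp_norm \<alpha> p f" by simp
  have h2: "AE x in \<mu>. b x \<noteq> 0 \<longrightarrow> (\<lambda>y. T x f y - f y) \<in> L \<and> Lp_norm \<alpha> p (\<lambda>y. T x f y - f y) \<le> w"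
  proof (intro AE_I2 impI conjI)
    fix x assume "b x \<noteq> 0"
    then have "\<bar>x\<bar> \<le> t" using b0[of x] by (auto simp: not_less[symmetric])
    then show "Lp_norm \<alpha> p (\<lambda>y. T x f y - f y) \<le> w" by (rule w)
    show "(\<lambda>y. T x f y - f y) \<in> L" using f T_L(1)[OF f] by (intro L_diff)
  qed
  have bm: "b \<in> borel_measurable borel" by measurable
  note S1 = average_Lp[OF sigma_finite_mu sets_mu bm m1 A0 nb f0 h1]
  note S2 = average_Lp[OF sigma_finite_mu sets_mu bm m2 A0 nb w(1) h2]
  show L1: "(\<lambda>y. LINT x|\<mu>. b x *\<^sub>R T x f y) \<in> L" by (rule S1(2))
  have "Lp_norm \<alpha> p (\<lambda>y. (LINT x|\<mu>. b x *\<^sub>R T x f y) - (LINT x|\<mu>. b x) *\<^sub>R f y) = Lp_norm \<alpha> p (\<lambda>y. LINT x|\<mu>. b x *\<^sub>R (T x f y - f y))"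
  proof (rule Ip_cong_AE(2))
    show "AE y in \<mu>. (LINT x|\<mu>. b x *\<^sub>R T x f y) - (LINT x|\<mu>. b x) *\<^sub>R f y = (LINT x|\<mu>. b x *\<^sub>R (T x f y - f y))"
      using S1(1)
    proof eventually_elim
      case (elim y)
      have i: "integrable \<mu> (\<lambda>x. b x *\<^sub>R f y)" using ib by simp
      have "(LINT x|\<mu>. b x *\<^sub>R (T x f y - f y)) = (LINT x|\<mu>. b x *\<^sub>R T x f y - b x *\<^sub>R f y)"
        by (simp add: scaleR_diff_right)
      also have "\<dots> = (LINT x|\<mu>. b x *\<^sub>R T x f y) - (LINT x|\<mu>. b x *\<^sub>R f y)"
        by (rule Bochner_Integration.integral_diff[OF elim i])
      finally show ?case using ib by simp
    qed
    show "(\<lambda>y. (LINT x|\<mu>. b x *\<^sub>R T x f y) - (LINT x|\<mu>. b x) *\<^sub>R f y) \<in> borel_measurable borel"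
      using Lp_memD(1)[OF L1] by measurable
    show "(\<lambda>y. LINT x|\<mu>. b x *\<^sub>R (T x f y - f y)) \<in> borel_measurable borel" by (rule Lp_memD(1)[OF S2(2)])
  qed
  also have "\<dots> \<le> A * w" by (rule S2(3))
  finally show "Lp_norm \<alpha> p (\<lambda>y. (LINT x|\<mu>. b x *\<^sub>R T x f y) - (LINT x|\<mu>. b x) *\<^sub>R f y) \<le> A * w" .
qed

text \<open>The Dunkl operator is moved from phi to the translate of the mollifier by antisymmetry,
  for each v. The resulting kernel is recognised as the translate of an odd profile, minus the
  derivative of the mollifier.\<close>

lemma mollified_derivative:
  assumes t: "t > 0" and f: "f \<in> L"
  shows "has_dunkl_derivative \<alpha> (\<lambda>y. LINT x|\<mu>. (c * mollifier t x) *\<^sub>R T x f y)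
    (\<lambda>y. LINT x|\<mu>. (c * (6 * x / t\<^sup>2) * (mollifier_base t x)\<^sup>2) *\<^sub>R T x f y)"
  unfolding has_dunkl_derivative_def
proof (intro allI impI)
  fix \<phi> assume "test_function \<phi>"
  then obtain \<phi>' r where d\<phi>: "\<And>x. (\<phi> has_vector_derivative \<phi>' x) (at x)" and c\<phi>': "continuous_on UNIV \<phi>'"
    and z: "\<And>x. \<bar>x\<bar> > r \<Longrightarrow> \<phi> x = 0" "\<And>x. \<bar>x\<bar> > r \<Longrightarrow> \<phi>' x = 0"
    by (rule test_function_C1) blast
  have c\<phi>: "continuous_on UNIV \<phi>" by (rule has_vd_continuous[OF d\<phi>])
  have [measurable]: "\<phi> \<in> borel_measurable borel" "\<phi>' \<in> borel_measurable borel"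
    using c\<phi> c\<phi>' by (auto intro: borel_measurable_continuous_onI)
  note [measurable] = Lp_memD(1)[OF f]
  interpret J: sigma_finite_measure J by (rule sigma_finite_J)
  interpret m: sigma_finite_measure \<mu> by (rule sigma_finite_mu)
  define g where "g u = max 0 (1 - u / t\<^sup>2)" for u
  have dg: "((\<lambda>u. c * g u ^ 3) has_real_derivative - (3 * c / t\<^sup>2) * (g u)\<^sup>2) (at u)" for u
  proof -
    have d: "((\<lambda>u. 1 - u / t\<^sup>2) has_real_derivative - (1 / t\<^sup>2)) (at u)"
      by (rule DERIV_cong, rule DERIV_diff[OF DERIV_const DERIV_cdivide[OF DERIV_ident]]) simp
    have e: "((\<lambda>x::real. max 0 x ^ 3) has_real_derivative 3 * (max 0 x)\<^sup>2) (at x)" for x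
      using pos_part_power_deriv[of 1 x] by (simp add: eval_nat_numeral)
    show ?thesis unfolding g_def
      by (rule DERIV_cong, rule DERIV_cmult[OF DERIV_chain2[OF e d]]) simp
  qed
  have cg: "continuous_on UNIV g" unfolding g_def by (intro continuous_intros) (use t in auto)
  have g0: "g u = 0" if "u > t\<^sup>2" for u using that t by (simp add: g_def)
  interpret P: compact_profile \<alpha> p "\<lambda>u. c * g u ^ 3" "\<lambda>u. - (3 * c / t\<^sup>2) * (g u)\<^sup>2" "\<lambda>_. 0" "\<lambda>_. 0" t
  proof unfold_locales
    show "((\<lambda>u. c * g u ^ 3) has_real_derivative - (3 * c / t\<^sup>2) * (g x)\<^sup>2) (at x)" for x by (rule dg)
    show "continuous_on UNIV (\<lambda>u. - (3 * c / t\<^sup>2) * (g u)\<^sup>2)" by (intro continuous_intros cg)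
  qed (use t g0 in auto)
  have P\<eta>: "P.\<eta> s v z = c * g (s\<^sup>2 + z\<^sup>2 + 2 * s * z * v) ^ 3" for s v z by (simp add: P.\<eta>_def)
  have Pmol: "P.\<eta> 0 0 x = c * mollifier t x" for x unfolding P\<eta> by (simp add: g_def mollifier_def)
  obtain B0 where B0: "\<And>x. \<bar>x\<bar> \<le> \<bar>r\<bar> \<Longrightarrow> norm (\<phi> x) \<le> B0" "B0 \<ge> 0" by (rule continuous_on_bounded_interval[OF c\<phi>, of "\<bar>r\<bar>"]) blast
  obtain B1 where B1: "\<And>x. \<bar>x\<bar> \<le> \<bar>r\<bar> \<Longrightarrow> norm (\<phi>' x) \<le> B1" "B1 \<ge> 0" by (rule continuous_on_bounded_interval[OF c\<phi>', of "\<bar>r\<bar>"]) blast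
  have z\<phi>: "\<phi> x = 0" "\<phi>' x = 0" "dunkl_deriv \<phi> \<phi>' x = 0" if "\<bar>x\<bar> > \<bar>r\<bar>" for x
    using that z[of x] z(1)[of "-x"] by (auto simp: dunkl_deriv_def)
  have b\<phi>: "norm (\<phi> x) \<le> B0" for x using B0 z\<phi>(1)[of x] by (cases "\<bar>x\<bar> \<le> \<bar>r\<bar>") auto
  have bd: "norm (dunkl_deriv \<phi> \<phi>' x) \<le> (1 + \<kappa>) * B1" for x
    using dunkl_deriv_bound[OF d\<phi> B1(1)] z\<phi>(3)[of x] B1(2) \<kappa>_pos by (cases "\<bar>x\<bar> \<le> \<bar>r\<bar>") auto
  have L\<phi>: "\<phi> \<in> L" by (rule L_bounded[of _ B0 "\<bar>r\<bar>"]) (use b\<phi> z\<phi> in auto)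
  have Ld: "dunkl_deriv \<phi> \<phi>' \<in> L" by (rule L_bounded[of _ "(1 + \<kappa>) * B1" "\<bar>r\<bar>"]) (use bd z\<phi> in auto)
  have dm: "dunkl_deriv \<phi> \<phi>' \<in> borel_measurable borel" by measurable
  define k where "k y z = (LINT v|J. (1 + v) * dunkl_deriv (P.\<eta> (- z) v) (P.\<eta>' (- z) v) y)" for y z
  have inner: "(LINT y|\<mu>. dunkl_deriv \<phi> \<phi>' y * of_real (LINT v|J. (1 + v) * P.\<eta> (- y) v z)) = - (LINT y|\<mu>. \<phi> y * of_real (k y z))"
    if z: "z \<noteq> 0" for z
  proof -
    obtain B where B: "B \<ge> 0"
      "\<And>s v y. \<bar>s\<bar> \<le> \<bar>z\<bar> \<Longrightarrow> \<bar>v\<bar> \<le> 1 \<Longrightarrow> \<bar>P.\<eta> s v y\<bar> \<le> B * indicator {-(t+\<bar>z\<bar>)..t+\<bar>z\<bar>} y"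
      "\<And>s v y. \<bar>s\<bar> \<le> \<bar>z\<bar> \<Longrightarrow> \<bar>v\<bar> \<le> 1 \<Longrightarrow> \<bar>dunkl_deriv (P.\<eta> s v) (P.\<eta>' s v) y\<bar> \<le> B * indicator {-(t+\<bar>z\<bar>)..t+\<bar>z\<bar>} y"
      by (rule P.\<eta>_bound[of "\<bar>z\<bar>"]) blast
    have bd1: "AE v in J. 1 + v \<noteq> 0 \<longrightarrow> (\<forall>y. \<bar>P.\<eta> (- z) v y\<bar> \<le> B * indicator {-(t+\<bar>z\<bar>)..t+\<bar>z\<bar>} y)"
      using AE_J by eventually_elim (use B(2)[of "-z"] in simp)
    have bd2: "AE v in J. 1 + v \<noteq> 0 \<longrightarrow> (\<forall>y. \<bar>dunkl_deriv (P.\<eta> (- z) v) (P.\<eta>' (- z) v) y\<bar> \<le> B * indicator {-(t+\<bar>z\<bar>)..t+\<bar>z\<bar>} y)"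
      using AE_J by eventually_elim (use B(3)[of "-z"] in simp)
    have com: "P.\<eta> (- y) v z = P.\<eta> (- z) v y" for v y by (simp add: P\<eta> algebra_simps)
    have "(LINT y|\<mu>. dunkl_deriv \<phi> \<phi>' y * of_real (LINT v|J. (1 + v) * P.\<eta> (- y) v z))
        = (LINT v|J. (1 + v) *\<^sub>R (LINT y|\<mu>. dunkl_deriv \<phi> \<phi>' y * of_real (P.\<eta> (- z) v y)))"
      unfolding com by (rule weighted_Fubini[OF Ld sigma_finite_J sets_J _ P.nn_J_weight _ B(1) bd1]) measurable
    also have "\<dots> = (LINT v|J. (1 + v) *\<^sub>R (- (LINT y|\<mu>. \<phi> y * of_real (dunkl_deriv (P.\<eta> (- z) v) (P.\<eta>' (- z) v) y))))"
    proof (intro Bochner_Integration.integral_cong refl arg_cong[where f = "\<lambda>u. _ *\<^sub>R u"])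
      fix v
      have dd: "((\<lambda>y. complex_of_real (P.\<eta> (- z) v y)) has_vector_derivative of_real (P.\<eta>' (- z) v y)) (at y)" for y
        by (rule has_vector_derivative_of_real[OF P.\<eta>_deriv])
      have ce: "continuous_on UNIV (\<lambda>y. complex_of_real (P.\<eta>' (- z) v y))"
        by (intro continuous_on_of_real P.\<eta>'_continuous)
      have "(LINT y|\<mu>. of_real (P.\<eta> (- z) v y) * dunkl_deriv \<phi> \<phi>' y)
          = - (LINT y|\<mu>. dunkl_deriv (\<lambda>y. of_real (P.\<eta> (- z) v y)) (\<lambda>y. of_real (P.\<eta>' (- z) v y)) y * \<phi> y)"
        by (rule dunkl_deriv_antisymmetric(1)[OF dd ce d\<phi> c\<phi>' z\<phi>(1,2)])
      then show "(LINT y|\<mu>. dunkl_deriv \<phi> \<phi>' y * of_real (P.\<eta> (- z) v y)) = - (LINT y|\<mu>. \<phi> y * of_real (dunkl_deriv (P.\<eta> (- z) v) (P.\<eta>' (- z) v) y))"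
        unfolding dunkl_deriv_of_real by (simp add: mult.commute)
    qed
    also have "\<dots> = - (LINT v|J. (1 + v) *\<^sub>R (LINT y|\<mu>. \<phi> y * of_real (dunkl_deriv (P.\<eta> (- z) v) (P.\<eta>' (- z) v) y)))" by simp
    also have "(LINT v|J. (1 + v) *\<^sub>R (LINT y|\<mu>. \<phi> y * of_real (dunkl_deriv (P.\<eta> (- z) v) (P.\<eta>' (- z) v) y))) = (LINT y|\<mu>. \<phi> y * of_real (k y z))"
      unfolding k_def by (rule weighted_Fubini[OF L\<phi> sigma_finite_J sets_J _ P.nn_J_weight _ B(1) bd2, symmetric]) measurable
    finally show ?thesis .
  qed
  have dg2: "((\<lambda>u. (6 * c / t\<^sup>2) * (g u)\<^sup>2) has_real_derivative - (12 * c / t ^ 4) * g u) (at u)" for u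
  proof -
    have d: "((\<lambda>u. 1 - u / t\<^sup>2) has_real_derivative - (1 / t\<^sup>2)) (at u)"
      by (rule DERIV_cong, rule DERIV_diff[OF DERIV_const DERIV_cdivide[OF DERIV_ident]]) simp
    have e: "((\<lambda>x::real. (max 0 x)\<^sup>2) has_real_derivative 2 * max 0 x) (at x)" for x
      using pos_part_power_deriv[of 0 x] by (simp add: numeral_2_eq_2)
    show ?thesis unfolding g_def
      by (rule DERIV_cong, rule DERIV_cmult[OF DERIV_chain2[OF e d]]) (use t in \<open>simp add: field_simps eval_nat_numeral\<close>)
  qed
  \<comment> \<open>The odd profile with G = -2 * E', where E is the even profile of P: then z *
    G(z^2) is minus the derivative of E(z^2).\<close>
  interpret Q: compact_profile \<alpha> p "\<lambda>_. 0" "\<lambda>_. 0" "\<lambda>u. (6 * c / t\<^sup>2) * (g u)\<^sup>2" "\<lambda>u. - (12 * c / t ^ 4) * g u" t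
  proof unfold_locales
    show "((\<lambda>u. (6 * c / t\<^sup>2) * (g u)\<^sup>2) has_real_derivative - (12 * c / t ^ 4) * g x) (at x)" for x by (rule dg2)
    show "continuous_on UNIV (\<lambda>u. - (12 * c / t ^ 4) * g u)" by (intro continuous_intros cg)
  qed (use t g0 in auto)
  have Q\<eta>: "Q.\<eta> s v z = (s + z) * ((6 * c / t\<^sup>2) * (g (s\<^sup>2 + z\<^sup>2 + 2 * s * z * v))\<^sup>2)" for s v z
    unfolding Q.\<eta>_def by simp
  have Qmol: "Q.\<eta> 0 0 x = c * (6 * x / t\<^sup>2) * (mollifier_base t x)\<^sup>2" for x unfolding Q\<eta> by (simp add: g_def mollifier_base_def)
  \<comment> \<open>With G = 0 the general formula keeps only 2 * (y - z) * (1 + v) * E', the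
    weighted integrand of the odd profile with parameter -y.\<close>
  have kQ: "k y z = (LINT v|J. (1 + v) * Q.\<eta> (- y) v z)" if y: "y \<noteq> 0" for y z
    unfolding k_def P.integral_dunkl_deriv_\<eta>[OF y] Q\<eta>
    by (intro Bochner_Integration.integral_cong refl) (simp add: algebra_simps add_divide_distrib diff_divide_distrib)
  have op: "dunkl_op \<alpha> \<phi> x = dunkl_deriv \<phi> \<phi>' x" for x by (rule dunkl_op_eq[OF d\<phi>])
  have "(LINT x|\<mu>. (LINT x'|\<mu>. (c * mollifier t x') *\<^sub>R T x' f x) * dunkl_op \<alpha> \<phi> x)
     = (LINT z|\<mu>. f z * (LINT y|\<mu>. dunkl_deriv \<phi> \<phi>' y * of_real (LINT v|J. (1 + v) * P.\<eta> (- y) v z)))"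
    unfolding Pmol[symmetric] op by (rule P.average_kernel[OF f dm bd z\<phi>(3)])
  also have "\<dots> = (LINT z|\<mu>. - (f z * (LINT y|\<mu>. \<phi> y * of_real (LINT v|J. (1 + v) * Q.\<eta> (- y) v z))))"
  proof (rule integral_cong_AE)
    show "AE z in \<mu>. f z * (LINT y|\<mu>. dunkl_deriv \<phi> \<phi>' y * of_real (LINT v|J. (1 + v) * P.\<eta> (- y) v z))
       = - (f z * (LINT y|\<mu>. \<phi> y * of_real (LINT v|J. (1 + v) * Q.\<eta> (- y) v z)))"
      using AE_mu_nonzero
    proof eventually_elim
      case (elim z)
      have "(LINT y|\<mu>. \<phi> y * of_real (k y z)) = (LINT y|\<mu>. \<phi> y * of_real (LINT v|J. (1 + v) * Q.\<eta> (- y) v z))"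
      proof (rule integral_cong_AE)
        show "AE y in \<mu>. \<phi> y * of_real (k y z) = \<phi> y * of_real (LINT v|J. (1 + v) * Q.\<eta> (- y) v z)"
          using AE_mu_nonzero
        proof eventually_elim
          case (elim y)
          show ?case by (simp only: kQ[OF elim])
        qed
        show "(\<lambda>y. \<phi> y * of_real (k y z)) \<in> borel_measurable \<mu>" unfolding k_def by measurable
      qed measurable
      then show ?case unfolding inner[OF elim] by simp
    qed
  qed measurable
  also have "\<dots> = - (LINT z|\<mu>. f z * (LINT y|\<mu>. \<phi> y * of_real (LINT v|J. (1 + v) * Q.\<eta> (- y) v z)))" by simp
  also have "(LINT z|\<mu>. f z * (LINT y|\<mu>. \<phi> y * of_real (LINT v|J. (1 + v) * Q.\<eta> (- y) v z)))
      = (LINT x|\<mu>. (LINT x'|\<mu>. (c * (6 * x' / t\<^sup>2) * (mollifier_base t x')\<^sup>2) *\<^sub>R T x' f x) * \<phi> x)"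
    unfolding Qmol[symmetric] by (rule Q.average_kernel[OF f _ b\<phi> z\<phi>(1), symmetric]) measurable
  finally show "(LINT x|\<mu>. (LINT x'|\<mu>. (c * mollifier t x') *\<^sub>R T x' f x) * dunkl_op \<alpha> \<phi> x)
     = - (LINT x|\<mu>. (LINT x'|\<mu>. (c * (6 * x' / t\<^sup>2) * (mollifier_base t x')\<^sup>2) *\<^sub>R T x' f x) * \<phi> x)" .
qed

lemma mollification:
  assumes t: "t > 0" and f: "f \<in> L" and w: "w \<ge> 0" "\<And>x. \<bar>x\<bar> \<le> t \<Longrightarrow> Lp_norm \<alpha> p (\<lambda>y. T x f y - f y) \<le> w"
  obtains f1 g where "f1 \<in> L" "g \<in> L" "has_dunkl_derivative \<alpha> f1 g"
    "Lp_norm \<alpha> p (\<lambda>y. f y - f1 y) \<le> w" "t * Lp_norm \<alpha> p g \<le> mollifier_const * w"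
proof -
  define N where "N = (LINT x|\<mu>. mollifier t x)"
  define c where "c = 1 / N"
  have N: "N > 0" using mollifier_pos[OF t] by (simp add: N_def)
  have c: "c > 0" using N by (simp add: c_def)
  define b where "b x = c * mollifier t x" for x
  define b2 where "b2 x = c * (6 * x / t\<^sup>2) * (mollifier_base t x)\<^sup>2" for x
  have bm: "b \<in> borel_measurable borel" and b2m: "b2 \<in> borel_measurable borel" unfolding b_def b2_def by measurable
  have b0: "b x = 0" "b2 x = 0" if "\<bar>x\<bar> > t" for x using mollifier_base_zero[OF t that] by (simp_all add: b_def b2_def mollifier_eq)
  have ib: "integrable \<mu> b" unfolding b_def using mollifier_integrable(1)[OF t] by simp
  have Ib: "(LINT x|\<mu>. b x) = 1" unfolding b_def using N by (simp add: c_def N_def[symmetric])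
  have Ab: "(LINT x|\<mu>. \<bar>b x\<bar>) \<le> 1" using Ib c mollifier_le by (simp add: b_def abs_mult)
  have b2_le: "\<bar>b2 x\<bar> \<le> c * (6 / t) * mollifier_base t x" for x
  proof (cases "\<bar>x\<bar> > t")
    case True then show ?thesis using b0 c t mollifier_le(1)[of t x] by simp
  next
    case False
    have "\<bar>x\<bar> * (mollifier_base t x)\<^sup>2 \<le> t * mollifier_base t x"
      using False t mollifier_le(1,2)[of t x] by (intro mult_mono) (auto simp: power2_eq_square mult_left_le)
    then have "c * (6 / t\<^sup>2) * (\<bar>x\<bar> * (mollifier_base t x)\<^sup>2) \<le> c * (6 / t\<^sup>2) * (t * mollifier_base t x)"
      using c t by (intro mult_left_mono) auto
    also have "\<dots> = c * (6 / t) * mollifier_base t x" using t by (simp add: power2_eq_square)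
    finally show ?thesis using c t by (simp add: b2_def abs_mult mult_ac)
  qed
  have i1: "integrable \<mu> (\<lambda>x. c * (6 / t) * mollifier_base t x)" using mollifier_integrable(2)[OF t] by simp
  have ib2: "integrable \<mu> b2"
  proof (rule Bochner_Integration.integrable_bound[OF i1])
    show "b2 \<in> borel_measurable \<mu>" using b2m by measurable
    show "AE x in \<mu>. norm (b2 x) \<le> norm (c * (6 / t) * mollifier_base t x)"
      unfolding real_norm_def by (intro AE_I2 order_trans[OF b2_le abs_ge_self])
  qed
  \<comment> \<open>An odd kernel has mass zero, so \<open>average_minus\<close> subtracts nothing
    and bounds the derivative by w, which measures increments, in place of the norm of f.\<close>
  have Ib2: "(LINT x|\<mu>. b2 x) = 0" by (rule integral_odd[OF b2m]) (simp add: b2_def mollifier_base_def)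
  have "(LINT x|\<mu>. \<bar>b2 x\<bar>) \<le> (LINT x|\<mu>. c * (6 / t) * mollifier_base t x)"
    by (rule integral_mono[OF integrable_abs[OF ib2] i1 b2_le])
  \<comment> \<open>The numerator and the normalising mass N scale by the same power of t, so only
    the factor 1 / t of \<open>b2_le\<close> is left.\<close>
  also have "\<dots> = mollifier_const / t"
  proof -
    have m1: "(LINT x|\<mu>. mollifier_base t x) = t powr (\<kappa> + 1) * (LINT x|\<mu>. mollifier_base 1 x)"
      unfolding mollifier_scale(2)[OF t] by (rule mu_scale[OF t]) measurable
    have m2: "N = t powr (\<kappa> + 1) * (LINT x|\<mu>. mollifier 1 x)"
      unfolding N_def mollifier_scale(1)[OF t] by (rule mu_scale[OF t]) measurable
    have "t powr (\<kappa> + 1) > 0" using t by simp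
    then show ?thesis unfolding mollifier_const_def c_def m2 by (simp add: m1)
  qed
  finally have Ab2: "(LINT x|\<mu>. \<bar>b2 x\<bar>) \<le> mollifier_const / t" .
  define f1 where "f1 y = (LINT x|\<mu>. b x *\<^sub>R T x f y)" for y
  define g where "g y = (LINT x|\<mu>. b2 x *\<^sub>R T x f y)" for y
  note A1 = average_minus[OF f bm b0(1) ib Ab w, folded f1_def]
  note A2 = average_minus[OF f b2m b0(2) ib2 Ab2 w, folded g_def]
  have f1L: "f1 \<in> L" using A1(1) by (simp add: f1_def[abs_def])
  have gL: "g \<in> L" using A2(1) by (simp add: g_def[abs_def])
  show thesis
  proof (rule that[OF f1L gL])
    show "has_dunkl_derivative \<alpha> f1 g"
      unfolding f1_def[abs_def] g_def[abs_def] b_def b2_def by (rule mollified_derivative[OF t f])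
    have "Lp_norm \<alpha> p (\<lambda>y. f y - f1 y) = Lp_norm \<alpha> p (\<lambda>y. (-1) * (f1 y - f y))" by simp
    also have "\<dots> = Lp_norm \<alpha> p (\<lambda>y. f1 y - f y)"
      using L_cmult(3)[OF L_diff(1)[OF f1L f], of "-1"] by simp
    finally show "Lp_norm \<alpha> p (\<lambda>y. f y - f1 y) \<le> w" using A1(2) by (simp add: Ib)
    have "Lp_norm \<alpha> p g \<le> mollifier_const / t * w" using A2(2) by (simp add: Ib2)
    then show "t * Lp_norm \<alpha> p g \<le> mollifier_const * w" using t by (simp add: field_simps)
  qed
qed

section \<open>Comparison of the modulus of smoothness with the K-functional\<close>

lemma modulus_step:
  assumes f: "f \<in> L"
  shows "Lp_norm \<alpha> p (\<lambda>y. dunkl_translation \<alpha> p t f y - f y) = Lp_norm \<alpha> p (\<lambda>y. T t f y - f y)"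
proof (rule Ip_cong_AE(2))
  show "AE y in \<mu>. dunkl_translation \<alpha> p t f y - f y = T t f y - f y"
    using dunkl_translation_AE(1)[OF f, of t] by eventually_elim simp
qed (intro Lp_memD L_diff dunkl_translation_AE(2) T_L f)+

text \<open>20 = 4 * (4 + 1): the quasi-triangle constant times the bounds of the translation and
  the identity.\<close>

lemma modulus_step_bound: "f \<in> L \<Longrightarrow> Lp_norm \<alpha> p (\<lambda>y. T t f y - f y) \<le> 20 * Lp_norm \<alpha> p f"
  using L_diff(3)[OF T_L(1) , of f f t] T_norm[of f t] by simp

lemma modulus_upper:
  assumes f: "f \<in> L" and t: "\<bar>t\<bar> \<le> x"
  shows "Lp_norm \<alpha> p (\<lambda>y. T t f y - f y) \<le> dunkl_modulus \<alpha> p f x"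
  unfolding dunkl_modulus_def modulus_step[OF f]
  by (rule cSUP_upper) (use t modulus_step_bound[OF f] in \<open>auto intro!: bdd_aboveI2\<close>)

lemma modulus_le_K:
  assumes f: "f \<in> L" and x: "x > 0"
  shows "dunkl_modulus \<alpha> p f x \<le> 80 * dunkl_K \<alpha> p f x"
proof -
  have zero: "(\<lambda>_. 0) \<in> L" by (rule L_bounded[of _ 0 0]) auto
  define S where "S = {Lp_norm \<alpha> p f0 + x * Lp_norm \<alpha> p g | f0 f1 g.
            f0 \<in> L \<and> f1 \<in> L \<and> g \<in> L \<and> has_dunkl_derivative \<alpha> f1 g \<and> (AE y in \<mu>. f y = f0 y + f1 y)}"
  \<comment> \<open>A lower bound passes to a real infimum only if some decomposition exists; f = f
    + 0 is one.\<close>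
  have ne: "S \<noteq> {}"
  proof -
    have "has_dunkl_derivative \<alpha> (\<lambda>_. 0) (\<lambda>_. 0)" by (simp add: has_dunkl_derivative_def)
    then have "Lp_norm \<alpha> p f + x * Lp_norm \<alpha> p (\<lambda>_. 0) \<in> S" unfolding S_def using f zero by fastforce
    then show ?thesis by blast
  qed
  have "dunkl_modulus \<alpha> p f x / 80 \<le> s" if s: "s \<in> S" for s
  proof -
    obtain f0 f1 g where fg: "f0 \<in> L" "f1 \<in> L" "g \<in> L" "has_dunkl_derivative \<alpha> f1 g"
      "AE y in \<mu>. f y = f0 y + f1 y" and s: "s = Lp_norm \<alpha> p f0 + x * Lp_norm \<alpha> p g"
      using s unfolding S_def by blast
    note m = Lp_memD(1)[OF f] Lp_memD(1)[OF fg(1)] Lp_memD(1)[OF fg(2)]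
    have "Lp_norm \<alpha> p (\<lambda>y. T t f y - f y) \<le> 80 * s" if t: "\<bar>t\<bar> \<le> x" for t
    proof -
      have sum: "(\<lambda>y. f0 y + f1 y) \<in> L" by (rule L_add(1)[OF fg(1,2)])
      have "AE y in \<mu>. T t f y - f y = (T t f0 y - f0 y) + (T t f1 y - f1 y)"
        using T_cong_AE[OF m(1) Lp_memD(1)[OF sum] fg(5), of t] T_add[OF fg(1,2), of t] fg(5)
        by eventually_elim simp
      then have "Lp_norm \<alpha> p (\<lambda>y. T t f y - f y) = Lp_norm \<alpha> p (\<lambda>y. (T t f0 y - f0 y) + (T t f1 y - f1 y))"
        by (rule Ip_cong_AE(2)[rotated 2]) (intro Lp_memD L_add L_diff T_L f fg)+
      also have "\<dots> \<le> 4 * (Lp_norm \<alpha> p (\<lambda>y. T t f0 y - f0 y) + Lp_norm \<alpha> p (\<lambda>y. T t f1 y - f1 y))"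
        by (intro Lp_norm_add L_diff T_L fg)
      \<comment> \<open>The part f0 is controlled by boundedness, f1 by its derivative and |t| <= x.
        Of the products 4 * 20 and 4 * 8 the larger one gives the 80.\<close>
      also have "\<dots> \<le> 4 * (20 * Lp_norm \<alpha> p f0 + 8 * x * Lp_norm \<alpha> p g)"
      proof -
        have "8 * \<bar>t\<bar> * Lp_norm \<alpha> p g \<le> 8 * x * Lp_norm \<alpha> p g" using t by (intro mult_right_mono) auto
        then show ?thesis using modulus_step_bound[OF fg(1), of t] translation_difference_bound[OF fg(2,3,4), of t] by simp
      qed
      also have "\<dots> \<le> 80 * s"
      proof -
        have "x * Lp_norm \<alpha> p g \<ge> 0" using x by simp
        then show ?thesis unfolding s by simp
      qed
      finally show ?thesis .
    qed
    then have "dunkl_modulus \<alpha> p f x \<le> 80 * s"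
      unfolding dunkl_modulus_def modulus_step[OF f] using x by (intro cSUP_least) (auto intro!: exI[of _ 0])
    then show ?thesis by simp
  qed
  then have "dunkl_modulus \<alpha> p f x / 80 \<le> Inf S" using ne by (intro cInf_greatest) auto
  then show ?thesis by (simp add: dunkl_K_def S_def)
qed

text \<open>Mollification at scale x, with w the modulus at x, provides one admissible
  decomposition, and the infimum is at most its value.\<close>

lemma K_le_modulus:
  assumes f: "f \<in> L" and x: "x > 0"
  shows "dunkl_K \<alpha> p f x \<le> (1 + mollifier_const) * dunkl_modulus \<alpha> p f x" and "0 \<le> dunkl_K \<alpha> p f x"
    and "0 \<le> dunkl_modulus \<alpha> p f x"
proof -
  define w where "w = dunkl_modulus \<alpha> p f x"
  have wu: "\<And>t. \<bar>t\<bar> \<le> x \<Longrightarrow> Lp_norm \<alpha> p (\<lambda>y. T t f y - f y) \<le> w" unfolding w_def by (rule modulus_upper[OF f])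
  have w0: "w \<ge> 0" using wu[of 0] x by (intro order_trans[OF Lp_norm_nonneg]) auto
  then show "0 \<le> dunkl_modulus \<alpha> p f x" by (simp add: w_def)
  define S where "S = {Lp_norm \<alpha> p f0 + x * Lp_norm \<alpha> p g | f0 f1 g.
            f0 \<in> L \<and> f1 \<in> L \<and> g \<in> L \<and> has_dunkl_derivative \<alpha> f1 g \<and> (AE y in \<mu>. f y = f0 y + f1 y)}"
  have nn: "s \<ge> 0" if "s \<in> S" for s using that x unfolding S_def by auto
  obtain f1 g where fg: "f1 \<in> L" "g \<in> L" "has_dunkl_derivative \<alpha> f1 g"
    "Lp_norm \<alpha> p (\<lambda>y. f y - f1 y) \<le> w" "x * Lp_norm \<alpha> p g \<le> mollifier_const * w"
    by (rule mollification[OF x f w0 wu]) blast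
  define s where "s = Lp_norm \<alpha> p (\<lambda>y. f y - f1 y) + x * Lp_norm \<alpha> p g"
  have sS: "s \<in> S" unfolding S_def s_def
  proof (rule CollectI, intro exI conjI)
    show "(\<lambda>y. f y - f1 y) \<in> L" by (rule L_diff(1)[OF f fg(1)])
    show "AE y in \<mu>. f y = (f y - f1 y) + f1 y" by simp
  qed (use fg in auto)
  have K: "dunkl_K \<alpha> p f x = Inf S" by (simp add: dunkl_K_def S_def)
  have "Inf S \<le> s" using sS nn by (intro cInf_lower bdd_belowI) auto
  also have "s \<le> (1 + mollifier_const) * w" unfolding s_def using fg(4,5) by (simp add: algebra_simps)
  finally show "dunkl_K \<alpha> p f x \<le> (1 + mollifier_const) * dunkl_modulus \<alpha> p f x" by (simp add: K w_def)
  show "0 \<le> dunkl_K \<alpha> p f x" unfolding K using sS nn by (intro cInf_greatest) auto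
qed

end

text \<open>Nonnegativity of h1 makes the power monotone, and C leaves the integral as C^q. Applied
  in both directions it turns comparability for all x > 0 into equality of the spaces.\<close>

lemma finite_weighted_norm_mono:
  assumes q: "1 \<le> q" and C: "C > 0" and h: "\<And>x. x > 0 \<Longrightarrow> 0 \<le> h1 x \<and> h1 x \<le> C * h2 x"
    and fin: "finite_weighted_norm q \<beta> h2"
  shows "finite_weighted_norm q \<beta> h1"
proof (cases "q = \<infinity>")
  case True
  then have "bdd_above ((\<lambda>x. h2 x / x powr \<beta>) ` {0<..})" using fin by (simp add: finite_weighted_norm_def)
  then obtain M where M: "\<And>x. x > 0 \<Longrightarrow> h2 x / x powr \<beta> \<le> M" by (auto simp: bdd_above_def)
  have "h1 x / x powr \<beta> \<le> C * M" if x: "x > 0" for x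
  proof -
    have "h1 x / x powr \<beta> \<le> C * h2 x / x powr \<beta>" using h[OF x] by (intro divide_right_mono) auto
    also have "\<dots> \<le> C * M" using mult_left_mono[OF M[OF x], of C] C by simp
    finally show ?thesis .
  qed
  then show ?thesis using True by (auto simp: finite_weighted_norm_def intro!: bdd_aboveI2[where M = "C * M"])
next
  case False
  define r where "r = real_of_ereal q"
  \<comment> \<open>The bound 1 <= q excludes minus infinity, so r is q itself as a real
    exponent.\<close>
  have r: "r \<ge> 0" using q False by (cases q) (auto simp: r_def one_ereal_def)
  have "(\<integral>\<^sup>+x\<in>{0<..}. ennreal ((h1 x / x powr \<beta>) powr r / x) \<partial>lborel)
     \<le> (\<integral>\<^sup>+x. ennreal (C powr r) * (ennreal ((h2 x / x powr \<beta>) powr r / x) * indicator {0<..} x) \<partial>lborel)"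
  proof (rule nn_integral_mono)
    fix x :: real
    show "ennreal ((h1 x / x powr \<beta>) powr r / x) * indicator {0<..} x
        \<le> ennreal (C powr r) * (ennreal ((h2 x / x powr \<beta>) powr r / x) * indicator {0<..} x)"
    proof (cases "x > 0")
      case True
      have h2: "h2 x \<ge> 0" using h[OF True] C by (meson order_trans zero_le_mult_iff not_less)
      have "(h1 x / x powr \<beta>) powr r \<le> (C * (h2 x / x powr \<beta>)) powr r"
        using h[OF True] r by (intro powr_mono2) (auto intro: divide_right_mono)
      also have "\<dots> = C powr r * (h2 x / x powr \<beta>) powr r"
        using C h2 by (subst powr_mult) auto
      finally have "(h1 x / x powr \<beta>) powr r / x \<le> C powr r * ((h2 x / x powr \<beta>) powr r / x)"
        using True by (simp add: divide_right_mono)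
      then have "ennreal ((h1 x / x powr \<beta>) powr r / x) \<le> ennreal (C powr r) * ennreal ((h2 x / x powr \<beta>) powr r / x)"
        using True by (subst ennreal_mult[symmetric]) (auto intro: ennreal_leI)
      then show ?thesis using True by simp
    qed simp
  qed
  also have "\<dots> \<le> ennreal (C powr r) * (\<integral>\<^sup>+x\<in>{0<..}. ennreal ((h2 x / x powr \<beta>) powr r / x) \<partial>lborel)"
    using C by (intro nn_integral_cmult_le) simp
  also have "\<dots> < \<infinity>" using fin False by (simp add: finite_weighted_norm_def r_def ennreal_mult_less_top)
  finally show ?thesis using False by (simp add: finite_weighted_norm_def r_def)
qed

theorem theorem1:
  fixes \<alpha> p \<beta> :: real and q :: ereal
  assumes "\<alpha> > - (1/2)" and "1 \<le> p" and "1 \<le> q" and "\<beta> > 0"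
  shows "besov_dunkl \<alpha> p q \<beta> = peetre_dunkl \<alpha> p q \<beta>"
proof -
  interpret dunkl_Lp \<alpha> p using assms by unfold_locales auto
  have "finite_weighted_norm q \<beta> (dunkl_modulus \<alpha> p f) \<longleftrightarrow> finite_weighted_norm q \<beta> (dunkl_K \<alpha> p f)" if f: "f \<in> L" for f
  proof
    assume "finite_weighted_norm q \<beta> (dunkl_modulus \<alpha> p f)"
    then show "finite_weighted_norm q \<beta> (dunkl_K \<alpha> p f)"
      by (rule finite_weighted_norm_mono[OF assms(3), of "1 + mollifier_const", rotated -1])
         (use K_le_modulus[OF f] mollifier_const_nonneg in auto)
  next
    assume "finite_weighted_norm q \<beta> (dunkl_K \<alpha> p f)"
    then show "finite_weighted_norm q \<beta> (dunkl_modulus \<alpha> p f)"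
      by (rule finite_weighted_norm_mono[OF assms(3), of 80, rotated -1])
         (use K_le_modulus(3)[OF f] modulus_le_K[OF f] in auto)
  qed
  then show ?thesis by (auto simp: besov_dunkl_def peetre_dunkl_def)
qed

end
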